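(* For every fixed $n\ge2$, $\sqrt{m\log m}\,R^{\mathrm{ML}}_{m,n}\to\sqrt{\frac{2n}{n-1}}$ in $\sigma_{m,n}$-measure as $m\to\infty$; that is, for every $\varepsilon>0$, $$\sigma_{m,n}\left\{a:\left|\sqrt{m\log m}\,R^{\mathrm{ML}}_{m,n}(a)-\sqrt{\tfrac{2n}{n-1}}\right|>\varepsilon\right\}\to0\qquad(m\to\infty).$$
   Context: Let $q_m:=2m/(m+1)$ and $[n]:=\{1,\dots,n\}$. For $a=(a_{i_1,\dots,i_m})\in\mathbb C^{[n]^m}$ let $T_a:(\mathbb C^n)^m\to\mathbb C$, $T_a(x^{(1)},\dots,x^{(m)}):=\sum_{i_1,\dots,i_m=1}^n a_{i_1,\dots,i_m}x^{(1)}_{i_1}\cdots x^{(m)}_{i_m}$, let $\|T_a\|:=\sup\{|T_a(x^{(1)},\dots,x^{(m)})|:\|x^{(1)}\|_\infty,\dots,\|x^{(m)}\|_\infty\le1\}$, and for $a\ne0$ $$R^{\mathrm{ML}}_{m,n}(a):=\frac{\left(\sum_{i_1,\dots,i_m=1}^n|a_{i_1,\dots,i_m}|^{q_m}\right)^{1/q_m}}{\|T_a\|}.$$ $\sigma_{m,n}$ denotes normalized (total mass one) Euclidean surface measure on the unit Euclidean sphere of $\mathbb C^{n^m}=\mathbb C^{[n]^m}$. *)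

theory Defs
  imports "HOL-Probability.Probability"
begin

text \<open>
  For a finite index set \<open>I\<close>, the space of complex vectors indexed by \<open>I\<close> is \<open>I \<rightarrow>\<^sub>E UNIV\<close>, the
  functions that take the value \<open>undefined\<close> outside \<open>I\<close>. Its Lebesgue measure is
  \<open>\<Pi>\<^sub>M i\<in>I. lborel\<close>, where \<open>lborel\<close> on \<^typ>\<open>complex\<close> is planar Lebesgue measure.
\<close>

definition l2_norm :: "'i set \<Rightarrow> ('i \<Rightarrow> complex) \<Rightarrow> real" where
  "l2_norm I a = L2_set (\<lambda>i. cmod (a i)) I"

definition unit_ball :: "'i set \<Rightarrow> ('i \<Rightarrow> complex) set" where
  "unit_ball I = {a \<in> I \<rightarrow>\<^sub>E UNIV. l2_norm I a \<le> 1}"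

definition unit_sphere :: "'i set \<Rightarrow> ('i \<Rightarrow> complex) set" where
  "unit_sphere I = {a \<in> I \<rightarrow>\<^sub>E UNIV. l2_norm I a = 1}"

definition radial_proj :: "'i set \<Rightarrow> ('i \<Rightarrow> complex) \<Rightarrow> ('i \<Rightarrow> complex)" where
  "radial_proj I a = (\<lambda>i\<in>I. a i / complex_of_real (l2_norm I a))"

text \<open>
  Surface measure on the sphere, as it arises from polar coordinates: in real dimension \<open>d\<close> the area
  of a Borel subset \<open>E\<close> of the sphere is \<open>d\<close> times the Lebesgue measure of the cone
  \<open>{r x | 0 < r \<le> 1, x \<in> E}\<close>. Dividing by the total area, which is \<open>d\<close> times the volume of
  the unit ball, the normalized surface measure is the image of the uniform distribution on the
  ball under \<open>a \<mapsto> a / \<parallel>a\<parallel>\<close>. The origin, which is mapped off the sphere, is a null set.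
\<close>

definition sphere_measure :: "'i set \<Rightarrow> ('i \<Rightarrow> complex) measure" where
  "sphere_measure I =
     restrict_space
       (distr (uniform_measure (\<Pi>\<^sub>M i\<in>I. lborel) (unit_ball I)) (\<Pi>\<^sub>M i\<in>I. borel) (radial_proj I))
       (unit_sphere I)"

definition multi_indices :: "nat \<Rightarrow> nat \<Rightarrow> (nat \<Rightarrow> nat) set" where
  "multi_indices m n = {1..m} \<rightarrow>\<^sub>E {1..n}"

definition multilinear_form ::
    "nat \<Rightarrow> nat \<Rightarrow> ((nat \<Rightarrow> nat) \<Rightarrow> complex) \<Rightarrow> (nat \<Rightarrow> nat \<Rightarrow> complex) \<Rightarrow> complex" where
  "multilinear_form m n a x = (\<Sum>i\<in>multi_indices m n. a i * (\<Prod>k\<in>{1..m}. x k (i k)))"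

definition sup_norm :: "nat \<Rightarrow> (nat \<Rightarrow> complex) \<Rightarrow> real" where
  "sup_norm n v = Max ((\<lambda>j. cmod (v j)) ` {1..n})"

definition form_norm :: "nat \<Rightarrow> nat \<Rightarrow> ((nat \<Rightarrow> nat) \<Rightarrow> complex) \<Rightarrow> real" where
  "form_norm m n a =
     (SUP x\<in>{x. \<forall>k\<in>{1..m}. sup_norm n (x k) \<le> 1}. cmod (multilinear_form m n a x))"

definition bh_exponent :: "nat \<Rightarrow> real" where
  "bh_exponent m = 2 * real m / (real m + 1)"

definition ratio_ML :: "nat \<Rightarrow> nat \<Rightarrow> ((nat \<Rightarrow> nat) \<Rightarrow> complex) \<Rightarrow> real" where
  "ratio_ML m n a =
     (\<Sum>i\<in>multi_indices m n. cmod (a i) powr bh_exponent m) powr (1 / bh_exponent m)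
       / form_norm m n a"

definition tensor_sphere_measure :: "nat \<Rightarrow> nat \<Rightarrow> ((nat \<Rightarrow> nat) \<Rightarrow> complex) measure" where
  "tensor_sphere_measure m n = sphere_measure (multi_indices m n)"

lemma multi_indices_finite: "finite (multi_indices m n)"
  by (simp add: multi_indices_def finite_PiE)

lemma multi_indices_nonempty: "n > 0 \<Longrightarrow> multi_indices m n \<noteq> {}"
  by (auto simp: multi_indices_def PiE_eq_empty_iff)

lemma measurable_l2_norm [measurable]:
  "l2_norm I \<in> borel_measurable (\<Pi>\<^sub>M i\<in>I. borel)"
proof -
  have "(\<lambda>a. sqrt (\<Sum>i\<in>I. (cmod (a i))\<^sup>2)) \<in> borel_measurable (\<Pi>\<^sub>M i\<in>I. borel)"
    by measurable
  then show ?thesis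
    by (simp add: l2_norm_def L2_set_def fun_eq_iff cong: measurable_cong)
qed

lemma measurable_radial_proj [measurable]:
  "radial_proj I \<in> (\<Pi>\<^sub>M i\<in>I. borel) \<rightarrow>\<^sub>M (\<Pi>\<^sub>M i\<in>I. borel)"
proof -
  have "(\<lambda>a. \<lambda>i\<in>I. a i / complex_of_real (l2_norm I a))
          \<in> (\<Pi>\<^sub>M i\<in>I. borel) \<rightarrow>\<^sub>M (\<Pi>\<^sub>M i\<in>I. borel)"
    by measurable
  then show ?thesis
    by (simp add: radial_proj_def[abs_def])
qed

lemma sets_unit_ball [measurable]: "unit_ball I \<in> sets (\<Pi>\<^sub>M i\<in>I. borel)"
proof -
  have "{a \<in> space (\<Pi>\<^sub>M i\<in>I. borel). l2_norm I a \<le> 1} \<in> sets (\<Pi>\<^sub>M i\<in>I. borel)"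
    by measurable
  then show ?thesis by (simp add: unit_ball_def space_PiM)
qed

lemma sets_unit_sphere [measurable]: "unit_sphere I \<in> sets (\<Pi>\<^sub>M i\<in>I. borel)"
proof -
  have "{a \<in> space (\<Pi>\<^sub>M i\<in>I. borel). l2_norm I a = 1} \<in> sets (\<Pi>\<^sub>M i\<in>I. borel)"
    by measurable
  then show ?thesis by (simp add: unit_sphere_def space_PiM)
qed

lemma sets_PiM_lborel: "sets (\<Pi>\<^sub>M i\<in>I. lborel) = sets (\<Pi>\<^sub>M i\<in>I. borel)"
  by (rule sets_PiM_cong) auto

lemma emeasure_unit_ball_finite:
  assumes "finite I"
  shows "emeasure (\<Pi>\<^sub>M i\<in>I. (lborel :: complex measure)) (unit_ball I) \<noteq> \<infinity>"
proof -
  interpret product_sigma_finite "\<lambda>_. lborel :: complex measure" ..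
  have sub: "unit_ball I \<subseteq> (\<Pi>\<^sub>E i\<in>I. cball 0 1)"
  proof
    fix a assume a: "a \<in> unit_ball I"
    have "cmod (a i) \<le> 1" if "i \<in> I" for i
    proof -
      have "cmod (a i) \<le> L2_set (\<lambda>i. cmod (a i)) I"
        using member_le_L2_set[OF assms that, of "\<lambda>i. cmod (a i)"] by simp
      also have "\<dots> \<le> 1" using a by (simp add: unit_ball_def l2_norm_def)
      finally show ?thesis .
    qed
    with a show "a \<in> (\<Pi>\<^sub>E i\<in>I. cball 0 1)" by (auto simp: unit_ball_def PiE_iff)
  qed
  have "emeasure (\<Pi>\<^sub>M i\<in>I. (lborel :: complex measure)) (unit_ball I)
      \<le> emeasure (\<Pi>\<^sub>M i\<in>I. (lborel :: complex measure)) (\<Pi>\<^sub>E i\<in>I. cball 0 1)"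
    by (rule emeasure_mono[OF sub]) (auto intro!: sets_PiM_I_finite assms)
  also have "\<dots> = (\<Prod>i\<in>I. emeasure lborel (cball (0::complex) 1))"
    by (rule emeasure_PiM) (auto simp: assms)
  also have "\<dots> < \<infinity>"
    using emeasure_lborel_cball_finite[of "0::complex" 1]
    by (simp add: less_top[symmetric] power_eq_top_ennreal)
  finally show ?thesis by simp
qed

lemma emeasure_unit_ball_pos:
  assumes "finite I"
  shows "emeasure (\<Pi>\<^sub>M i\<in>I. (lborel :: complex measure)) (unit_ball I) \<noteq> 0"
proof -
  interpret product_sigma_finite "\<lambda>_. lborel :: complex measure" ..
  define r where "r = 1 / (real (card I) + 1)"
  have r: "r > 0" by (simp add: r_def add_nonneg_pos)
  have sub: "(\<Pi>\<^sub>E i\<in>I. ball 0 r) \<subseteq> unit_ball I"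
  proof
    fix a :: "'a \<Rightarrow> complex" assume a: "a \<in> (\<Pi>\<^sub>E i\<in>I. ball 0 r)"
    have "L2_set (\<lambda>i. cmod (a i)) I \<le> (\<Sum>i\<in>I. cmod (a i))"
      by (rule L2_set_le_sum) simp
    also have "\<dots> \<le> (\<Sum>i\<in>I. r)"
      using a by (intro sum_mono) (force simp: PiE_iff)
    also have "\<dots> \<le> 1" by (simp add: r_def divide_simps)
    finally show "a \<in> unit_ball I" using a by (auto simp: unit_ball_def l2_norm_def PiE_iff)
  qed
  have "0 < emeasure lborel (ball (0::complex) r)"
    using r by (simp add: emeasure_ball)
  then have "0 < (\<Prod>i\<in>I. emeasure lborel (ball (0::complex) r))"
    by (simp add: zero_less_iff_neq_zero assms)
  also have "\<dots> = emeasure (\<Pi>\<^sub>M i\<in>I. (lborel :: complex measure)) (\<Pi>\<^sub>E i\<in>I. ball 0 r)"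
    by (rule emeasure_PiM[symmetric]) (auto simp: assms)
  also have "\<dots> \<le> emeasure (\<Pi>\<^sub>M i\<in>I. (lborel :: complex measure)) (unit_ball I)"
    by (rule emeasure_mono[OF sub]) (simp add: sets_PiM_lborel)
  finally show ?thesis by simp
qed

lemma space_sphere_measure: "space (sphere_measure I) = unit_sphere I"
  by (auto simp: sphere_measure_def space_restrict_space space_PiM unit_sphere_def)

lemma sets_sphere_measure:
  "sets (sphere_measure I) = sets (restrict_space (\<Pi>\<^sub>M i\<in>I. borel) (unit_sphere I))"
  by (simp add: sphere_measure_def sets_restrict_space)

lemma radial_proj_in_unit_sphere:
  assumes "l2_norm I a \<noteq> 0"
  shows "radial_proj I a \<in> unit_sphere I"
proof -
  have pos: "L2_set (\<lambda>i. cmod (a i)) I > 0"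
    using assms L2_set_nonneg[of "\<lambda>i. cmod (a i)" I]
    unfolding l2_norm_def by linarith
  have "l2_norm I (radial_proj I a)
      = L2_set (\<lambda>i. (1 / l2_norm I a) * cmod (a i)) I"
    unfolding l2_norm_def radial_proj_def
    by (rule L2_set_cong) (use pos in \<open>auto simp: norm_divide\<close>)
  also have "\<dots> = (1 / l2_norm I a) * L2_set (\<lambda>i. cmod (a i)) I"
    by (rule L2_set_right_distrib[symmetric]) (use pos in \<open>simp add: l2_norm_def\<close>)
  also have "\<dots> = 1" using pos by (simp add: l2_norm_def)
  finally show ?thesis by (simp add: unit_sphere_def radial_proj_def)
qed

lemma prob_space_sphere_measure:
  assumes "finite I" "I \<noteq> {}"
  shows "prob_space (sphere_measure I)"
proof -
  let ?L = "\<Pi>\<^sub>M i\<in>I. (lborel :: complex measure)"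
  let ?B = "\<Pi>\<^sub>M i\<in>I. (borel :: complex measure)"
  let ?U = "uniform_measure ?L (unit_ball I)"
  interpret product_sigma_finite "\<lambda>_. lborel :: complex measure" ..
  interpret U: prob_space ?U
    using emeasure_unit_ball_pos[OF assms(1)] emeasure_unit_ball_finite[OF assms(1)]
    by (rule prob_space_uniform_measure)
  have spU: "space ?U = I \<rightarrow>\<^sub>E UNIV" by (simp add: space_PiM)
  have radial: "radial_proj I \<in> ?U \<rightarrow>\<^sub>M ?B"
    using measurable_radial_proj[of I]
    by (simp add: sets_PiM_lborel cong: measurable_cong_sets)
  interpret D: prob_space "distr ?U ?B (radial_proj I)"
    by (rule U.prob_space_distr[OF radial])
  have zero: "emeasure ?L {\<lambda>i\<in>I. 0} = 0"
  proof -
    have "{\<lambda>i\<in>I. 0} = (\<Pi>\<^sub>E i\<in>I. {0::complex})" by (auto simp: PiE_iff fun_eq_iff extensional_def)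
    then have "emeasure ?L {\<lambda>i\<in>I. 0} = (\<Prod>i\<in>I. emeasure lborel {0::complex})"
      using emeasure_PiM[OF assms(1), of "\<lambda>_. {0}"] by simp
    then show ?thesis using assms by (simp add: card_gt_0_iff)
  qed
  have "(\<Pi>\<^sub>E i\<in>I. {0::complex}) \<in> sets ?L"
    by (rule sets_PiM_I_finite) (use assms in auto)
  moreover have "(\<Pi>\<^sub>E i\<in>I. {0::complex}) = {\<lambda>i\<in>I. 0}"
    by (auto simp: PiE_iff fun_eq_iff extensional_def)
  ultimately have zs: "{\<lambda>i\<in>I. 0} \<in> sets ?L"
    by (simp only:)
  have "AE a in ?L. a \<noteq> (\<lambda>i\<in>I. 0)"
    by (rule AE_I[OF _ zero zs]) auto
  then have "AE a in ?U. a \<noteq> (\<lambda>i\<in>I. 0)"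
    by (intro AE_uniform_measureI) (auto simp: sets_PiM_lborel)
  then have "AE a in ?U. radial_proj I a \<in> unit_sphere I"
  proof (rule AE_mp, intro AE_I2 impI)
    fix a assume a: "a \<in> space ?U" "a \<noteq> (\<lambda>i\<in>I. 0)"
    have "l2_norm I a \<noteq> 0"
    proof
      assume "l2_norm I a = 0"
      then have "\<forall>i\<in>I. a i = 0" using assms by (simp add: l2_norm_def L2_set_eq_0_iff)
      with a show False unfolding spU by (auto simp: PiE_iff fun_eq_iff extensional_def split: if_splits)
    qed
    then show "radial_proj I a \<in> unit_sphere I" by (rule radial_proj_in_unit_sphere)
  qed
  then have "AE a in distr ?U ?B (radial_proj I). a \<in> unit_sphere I"
    by (subst AE_distr_iff[OF radial]) (use sets_unit_sphere[of I] in \<open>auto simp: unit_sphere_def space_PiM\<close>)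
  then have one: "emeasure (distr ?U ?B (radial_proj I)) (unit_sphere I) = 1"
    by (subst D.emeasure_eq_1_AE) simp_all
  have inter: "unit_sphere I \<inter> space (distr ?U ?B (radial_proj I)) = unit_sphere I"
    by (auto simp: unit_sphere_def space_PiM)
  have "emeasure (sphere_measure I) (unit_sphere I) = 1"
    unfolding sphere_measure_def
    by (subst emeasure_restrict_space) (simp_all only: inter one sets_distr sets_unit_sphere subset_refl)
  then show ?thesis
    by (intro prob_spaceI) (simp add: space_sphere_measure)
qed

lemma prob_space_tensor_sphere_measure:
  "n > 0 \<Longrightarrow> prob_space (tensor_sphere_measure m n)"
  by (simp add: tensor_sphere_measure_def prob_space_sphere_measure
      multi_indices_finite multi_indices_nonempty)

lemma sup_norm_le_iff:
  "n > 0 \<Longrightarrow> sup_norm n v \<le> c \<longleftrightarrow> (\<forall>j\<in>{1..n}. cmod (v j) \<le> c)"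
  unfolding sup_norm_def by (subst Max_le_iff) auto

lemma norm_multilinear_form_le:
  assumes "n > 0" "\<forall>k\<in>{1..m}. sup_norm n (x k) \<le> 1"
  shows "cmod (multilinear_form m n a x) \<le> (\<Sum>i\<in>multi_indices m n. cmod (a i))"
  unfolding multilinear_form_def
proof (rule sum_norm_le)
  fix i assume i: "i \<in> multi_indices m n"
  have "(\<Prod>k\<in>{1..m}. cmod (x k (i k))) \<le> 1"
    by (rule prod_le_1) (use i assms in \<open>auto simp: multi_indices_def PiE_iff sup_norm_le_iff\<close>)
  then show "cmod (a i * (\<Prod>k\<in>{1..m}. x k (i k))) \<le> cmod (a i)"
    by (simp add: norm_mult prod_norm mult_left_le)
qed

lemma bdd_above_multilinear_form:
  assumes "n > 0"
  shows "bdd_above ((\<lambda>x. cmod (multilinear_form m n a x)) `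
           {x. \<forall>k\<in>{1..m}. sup_norm n (x k) \<le> 1})"
  using norm_multilinear_form_le[OF assms] by (auto intro!: bdd_aboveI2)

lemma continuous_on_multilinear_form:
  "continuous_on UNIV (multilinear_form m n a)"
proof -
  have "continuous_on UNIV (\<lambda>x :: nat \<Rightarrow> nat \<Rightarrow> complex. x k j)" for k j
    by (rule continuous_on_product_then_coordinatewise[OF continuous_on_product_coordinates])
  then show ?thesis
    unfolding multilinear_form_def[abs_def] by (intro continuous_intros) 
qed

lemma measurable_form_norm:
  assumes "n > 0"
  shows "form_norm m n \<in> borel_measurable (\<Pi>\<^sub>M i\<in>multi_indices m n. borel)"
proof -
  let ?P = "{x :: nat \<Rightarrow> nat \<Rightarrow> complex. \<forall>k\<in>{1..m}. sup_norm n (x k) \<le> 1}"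
  obtain T where T: "countable T" "T \<subseteq> ?P" "?P \<subseteq> closure T"
    using separable[of ?P] by blast
  have "(\<lambda>_ _. 0) \<in> ?P" using assms by (simp add: sup_norm_le_iff)
  then have ne: "?P \<noteq> {}" "T \<noteq> {}" using T by auto
  have bddT: "bdd_above ((\<lambda>x. cmod (multilinear_form m n a x)) ` T)" for a
    by (rule bdd_above_mono[OF bdd_above_multilinear_form[OF assms]]) (use T in blast)
  have eq: "form_norm m n a = (SUP x\<in>T. cmod (multilinear_form m n a x))" for a
    unfolding form_norm_def
  proof (rule antisym)
    have cont: "continuous_on (closure T) (\<lambda>x. cmod (multilinear_form m n a x))"
      by (intro continuous_on_norm continuous_on_subset[OF continuous_on_multilinear_form]) auto
    show "(SUP x\<in>?P. cmod (multilinear_form m n a x)) \<le> (SUP x\<in>T. cmod (multilinear_form m n a x))"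
    proof (rule cSUP_least[OF ne(1)])
      fix x assume "x \<in> ?P"
      then have x: "x \<in> closure T" using T by blast
      show "cmod (multilinear_form m n a x) \<le> (SUP x\<in>T. cmod (multilinear_form m n a x))"
        by (rule continuous_le_on_closure[OF cont x]) (rule cSUP_upper[OF _ bddT])
    qed
    show "(SUP x\<in>T. cmod (multilinear_form m n a x)) \<le> (SUP x\<in>?P. cmod (multilinear_form m n a x))"
      by (rule cSUP_subset_mono[OF ne(2) bdd_above_multilinear_form[OF assms] T(2)]) simp
  qed
  have "(\<lambda>a. SUP x\<in>T. cmod (multilinear_form m n a x))
          \<in> borel_measurable (\<Pi>\<^sub>M i\<in>multi_indices m n. borel)"
  proof (rule borel_measurable_cSUP[OF T(1) _ bddT])
    fix x
    show "(\<lambda>a. cmod (multilinear_form m n a x))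
            \<in> borel_measurable (\<Pi>\<^sub>M i\<in>multi_indices m n. borel)"
      unfolding multilinear_form_def by measurable
  qed
  then show ?thesis by (simp add: eq[abs_def])
qed

lemma measurable_ratio_ML:
  assumes "n > 0"
  shows "ratio_ML m n \<in> borel_measurable (tensor_sphere_measure m n)"
proof -
  note [measurable] = measurable_form_norm[OF assms]
  have "ratio_ML m n \<in> borel_measurable (\<Pi>\<^sub>M i\<in>multi_indices m n. borel)"
    unfolding ratio_ML_def[abs_def] by measurable
  then have "ratio_ML m n \<in> borel_measurable
      (restrict_space (\<Pi>\<^sub>M i\<in>multi_indices m n. borel) (unit_sphere (multi_indices m n)))"
    by (rule measurable_restrict_space1)
  then show ?thesis
    by (simp add: tensor_sphere_measure_def sets_sphere_measure cong: measurable_cong_sets)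
qed

end

theory Submission
  imports Defs "HOL-Real_Asymp.Real_Asymp"
begin

text \<open>
  The ratio is invariant under scaling, so the uniform vector on the sphere may be replaced by a vector
  of \<open>N = n\<^sup>m\<close> independent standard complex Gaussians. Since \<open>q\<^sub>m\<close> tends to \<open>2\<close>, the law of large numbers
  shows that the numerator is close to \<open>\<surd>(N n)\<close>, the factor \<open>\<surd>n\<close> coming from \<open>N\<close> raised to the power
  \<open>1/q\<^sub>m - 1/2 = 1/(2m)\<close>. The norm is the supremum of a Gaussian process of variance \<open>N\<close>, and it is close to
  \<open>\<surd>(N log M)\<close>, where \<open>M\<close> is the number of essentially independent points.

  Modulo phases, a point of the torus has \<open>(n-1)m\<close> angles, and the correlation of two points is a product
  of \<open>m\<close> factors, so the relevant scale for each angle is \<open>m\<^sup>-\<^sup>1\<^sup>/\<^sup>2\<close> and \<open>log M\<close> is about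
  \<open>(n-1)/2 m log m\<close>. For the upper bound, the disc of radius \<open>1 - \<pi>\<^sup>2/(2 L\<^sup>2)\<close> lies in the convex hull
  of the \<open>L\<close>-th roots of unity; by convexity and homogeneity the grid of roots with \<open>L = K \<surd>m\<close> therefore
  computes the norm up to a factor close to \<open>1\<close>, and a union bound applies. For the lower bound, on a
  slightly coarser grid most pairs of points are almost uncorrelated, and the second moment method combined
  with the Efron--Stein inequality applies.
\<close>

subsection \<open>The complex Gaussian distribution\<close>

text \<open>The scale is set by one marginal: with E|z|^2 = 1 the real part of the form at a
  unimodular point has variance N/2, so it exceeds sqrt(s N) with probability about exp(-s), and s
  competes with the logarithm of the number of grid points. Both are of order m log m, hence every
  factor exp(O(m)), such as a constant in L or a count of sets of positions, is harmless; only the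
  power of m in L matters. The upper bound tolerates L = K sqrt m because m + 1 contractions by 1 -
  O(1/L^2) multiply to a constant near 1. For the lower bound, L = m^(1/2 - eta) makes points that
  differ in about eta m positions correlated by at most exp(-c m^(2 eta)), far below 1/s. The
  obstacle is that pairs are controlled by one-dimensional tails only, so the second moment method
  yields an event of probability of order s^(-1/2) and not one close to 1. Efron--Stein makes
  deviations of order sqrt(s N) have probability O(1/s); as 1/s is smaller than s^(-1/2), the two
  facts force the mean up, and with it the norm.\<close>

lemma measurable_Complex [measurable]: "(\<lambda>(x, y). Complex x y) \<in> borel \<Otimes>\<^sub>M borel \<rightarrow>\<^sub>M borel"
  unfolding Complex_eq case_prod_beta by measurable

text \<open>Gives Fubini in real and imaginary part for integrals over the plane. Since
  \<open>lborel\<close> is determined by its values on boxes, the rectangle spanned by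
  \<open>l\<close> and \<open>u\<close> decides.\<close>

lemma lborel_complex_eq_distr:
  "distr (lborel \<Otimes>\<^sub>M lborel) borel (\<lambda>(x, y). Complex x y) = lborel"
proof (rule lborel_eqI[symmetric])
  fix l u :: complex assume lu: "\<And>b. b \<in> Basis \<Longrightarrow> l \<bullet> b \<le> u \<bullet> b"
  then have le: "Re l \<le> Re u" "Im l \<le> Im u"
    using lu[of 1] lu[of \<i>] by (auto simp: Basis_complex_def inner_complex_def)
  have "(\<lambda>(x, y). Complex x y) -` box l u \<inter> space (lborel \<Otimes>\<^sub>M lborel) = {Re l<..<Re u} \<times> {Im l<..<Im u}"
    by (auto simp: in_box_complex_iff space_pair_measure)
  then show "emeasure (distr (lborel \<Otimes>\<^sub>M lborel) borel (\<lambda>(x, y). Complex x y)) (box l u)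
      = ennreal (\<Prod>b\<in>Basis. (u - l) \<bullet> b)"
    using le by (subst emeasure_distr)
      (auto simp: lborel.emeasure_pair_measure_Times Basis_complex_def complex_eq_iff ennreal_mult)
qed simp

text \<open>The standard complex normal law with E|z|^2 = 1: real and imaginary part are independent
  centred normals of variance 1/2.\<close>

definition cgauss :: "complex measure" where
  "cgauss = density lborel (\<lambda>z. ennreal (exp (- (cmod z)\<^sup>2) / pi))"

lemma space_cgauss [simp]: "space cgauss = UNIV"
  and sets_cgauss [simp, measurable_cong]: "sets cgauss = sets borel"
  by (simp_all add: cgauss_def)

lemma std_normal_prob: "prob_space std_normal_distribution"
  using real_distribution.axioms(1) real_dist_normal_dist by blast

text \<open>Substituting x / sqrt 2 and y / sqrt 2 turns exp(-x^2 - y^2) / pi into two standard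
  normal densities; the two Jacobians 1 / sqrt 2 supply the factor 1/2 in 1 / (2 pi).\<close>

lemma nn_integral_cgauss:
  assumes [measurable]: "f \<in> borel_measurable borel"
  shows "(\<integral>\<^sup>+z. f z \<partial>cgauss) =
    (\<integral>\<^sup>+x. (\<integral>\<^sup>+y. f (Complex (x / sqrt 2) (y / sqrt 2)) \<partial>std_normal_distribution) \<partial>std_normal_distribution)"
proof -
  have [measurable]: "(\<lambda>y. Complex x y) \<in> borel \<rightarrow>\<^sub>M borel" for x
    unfolding Complex_eq by measurable
  have "(\<integral>\<^sup>+z. f z \<partial>cgauss) = (\<integral>\<^sup>+z. f z * ennreal (exp (- (cmod z)\<^sup>2) / pi) \<partial>lborel)"
    unfolding cgauss_def by (subst nn_integral_density) (auto simp: mult.commute)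
  also have "\<dots> = (\<integral>\<^sup>+z. f z * ennreal (exp (- (cmod z)\<^sup>2) / pi) \<partial>distr (lborel \<Otimes>\<^sub>M lborel) borel (\<lambda>(x, y). Complex x y))"
    by (simp add: lborel_complex_eq_distr)
  also have "\<dots> = (\<integral>\<^sup>+x. (\<integral>\<^sup>+y. f (Complex x y) * ennreal (exp (- x\<^sup>2 - y\<^sup>2) / pi) \<partial>lborel) \<partial>lborel)"
    by (subst nn_integral_distr)
      (auto simp: lborel.nn_integral_fst[symmetric] cmod_power2)
  also have "\<dots> = (\<integral>\<^sup>+x. (\<integral>\<^sup>+y. f (Complex (x / sqrt 2) (y / sqrt 2)) * ennreal (std_normal_density y) \<partial>lborel) * ennreal (std_normal_density x) \<partial>lborel)"
  proof -
    have e: "ennreal (1 / sqrt 2) * (ennreal (1 / sqrt 2) * ennreal (exp (- (x / sqrt 2)\<^sup>2 - (y / sqrt 2)\<^sup>2) / pi))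
        = ennreal (std_normal_density y) * ennreal (std_normal_density x)" for x y :: real
    proof -
      have e': "exp (- (x / sqrt 2)\<^sup>2 - (y / sqrt 2)\<^sup>2) = exp (- (x\<^sup>2 / 2)) * exp (- (y\<^sup>2 / 2))"
        by (simp add: power_divide flip: exp_add)
      have "1 / sqrt 2 * (1 / sqrt 2 * (exp (- (x / sqrt 2)\<^sup>2 - (y / sqrt 2)\<^sup>2) / pi))
        = std_normal_density y * std_normal_density x"
        unfolding e' std_normal_density_def by (simp add: real_sqrt_mult divide_simps)
      then show ?thesis by (simp flip: ennreal_mult)
    qed
    define G where "G x y = f (Complex x y) * ennreal (exp (- x\<^sup>2 - y\<^sup>2) / pi)" for x y
    have [measurable]: "case_prod G \<in> borel_measurable (borel \<Otimes>\<^sub>M borel)"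
      unfolding G_def[abs_def] by measurable
    have inner: "(\<integral>\<^sup>+y. G x y \<partial>lborel) = ennreal (1 / sqrt 2) * (\<integral>\<^sup>+y. G x (y / sqrt 2) \<partial>lborel)" for x
      by (subst nn_integral_real_affine[where c="1 / sqrt 2" and t=0]) simp_all
    have "(\<integral>\<^sup>+x. (\<integral>\<^sup>+y. G x y \<partial>lborel) \<partial>lborel)
        = ennreal (1 / sqrt 2) * (\<integral>\<^sup>+x. (\<integral>\<^sup>+y. G (x / sqrt 2) y \<partial>lborel) \<partial>lborel)"
      by (subst nn_integral_real_affine[where c="1 / sqrt 2" and t=0]) simp_all
    also have "\<dots> = (\<integral>\<^sup>+x. (\<integral>\<^sup>+y. ennreal (1 / sqrt 2) * (ennreal (1 / sqrt 2) * G (x / sqrt 2) (y / sqrt 2)) \<partial>lborel) \<partial>lborel)"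
      unfolding inner by (simp add: nn_integral_cmult)
    also have "\<dots> = (\<integral>\<^sup>+x. (\<integral>\<^sup>+y. f (Complex (x / sqrt 2) (y / sqrt 2)) * ennreal (std_normal_density y) * ennreal (std_normal_density x) \<partial>lborel) \<partial>lborel)"
    proof (intro nn_integral_cong)
      fix x y :: real
      show "ennreal (1 / sqrt 2) * (ennreal (1 / sqrt 2) * G (x / sqrt 2) (y / sqrt 2))
        = f (Complex (x / sqrt 2) (y / sqrt 2)) * ennreal (std_normal_density y) * ennreal (std_normal_density x)"
        using e[of x y, THEN arg_cong[of _ _ "\<lambda>t. f (Complex (x / sqrt 2) (y / sqrt 2)) * t"]]
        unfolding G_def by (simp only: ac_simps)
    qed
    finally show ?thesis
      by (simp add: G_def nn_integral_multc)
  qed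
  also have "\<dots> = (\<integral>\<^sup>+x. (\<integral>\<^sup>+y. f (Complex (x / sqrt 2) (y / sqrt 2)) \<partial>std_normal_distribution) \<partial>std_normal_distribution)"
    by (simp add: nn_integral_density mult.commute)
  finally show ?thesis .
qed

lemma cgauss_eq_distr:
  "cgauss = distr (std_normal_distribution \<Otimes>\<^sub>M std_normal_distribution) borel
     (\<lambda>(x, y). Complex (x / sqrt 2) (y / sqrt 2))"
  (is "_ = distr ?P _ ?f")
proof (rule measure_eqI)
  interpret prob_space std_normal_distribution by (rule std_normal_prob)
  have [measurable]: "?f \<in> ?P \<rightarrow>\<^sub>M borel"
    unfolding Complex_eq case_prod_beta by measurable
  fix A assume "A \<in> sets cgauss"
  then have [measurable]: "A \<in> sets borel" by simp
  have "emeasure cgauss A = (\<integral>\<^sup>+z. indicator A z \<partial>cgauss)"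
    by simp
  also have "\<dots> = (\<integral>\<^sup>+p. indicator A (?f p) \<partial>?P)"
    by (subst nn_integral_cgauss) (auto simp: nn_integral_fst[symmetric])
  also have "\<dots> = emeasure (distr ?P borel ?f) A"
    by (subst nn_integral_indicator[symmetric], simp, subst nn_integral_distr) auto
  finally show "emeasure cgauss A = emeasure (distr ?P borel ?f) A" .
qed simp

lemma measurable_cgauss_map [measurable]:
  "(\<lambda>(x, y). Complex (x / sqrt 2) (y / sqrt 2)) \<in> std_normal_distribution \<Otimes>\<^sub>M std_normal_distribution \<rightarrow>\<^sub>M borel"
  unfolding Complex_eq case_prod_beta by measurable

lemma prob_space_cgauss: "prob_space cgauss"
proof -
  interpret prob_space std_normal_distribution by (rule std_normal_prob)
  interpret pair_prob_space std_normal_distribution std_normal_distribution ..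
  show ?thesis unfolding cgauss_eq_distr by (rule P.prob_space_distr) measurable
qed

text \<open>Re (c z) = Re c Re z - Im c Im z is a sum of two independent normals of total variance
  |c|^2 / 2.\<close>

lemma char_cgauss_linear:
  "(LINT z|cgauss. iexp (Re (c * z))) = exp (- ((cmod c)\<^sup>2 / 4))"
proof -
  interpret prob_space std_normal_distribution by (rule std_normal_prob)
  interpret pair_prob_space std_normal_distribution std_normal_distribution ..
  have ch: "(LINT x|std_normal_distribution. iexp (t * x)) = exp (- (t\<^sup>2) / 2)" for t
    using char_std_normal_distribution unfolding char_def fun_eq_iff by simp
  have [measurable]: "(\<lambda>z. iexp (Re (c * z))) \<in> borel_measurable borel" by measurable
  have "(LINT z|cgauss. iexp (Re (c * z))) =
    (LINT p|(std_normal_distribution \<Otimes>\<^sub>M std_normal_distribution). iexp (Re c / sqrt 2 * fst p) * iexp (- Im c / sqrt 2 * snd p))"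
    unfolding cgauss_eq_distr
    by (subst integral_distr) (auto intro!: Bochner_Integration.integral_cong simp: exp_add[symmetric] algebra_simps)
  also have "\<dots> = (LINT x|std_normal_distribution. LINT y|std_normal_distribution. iexp (Re c / sqrt 2 * x) * iexp (- Im c / sqrt 2 * y))"
    by (subst integral_fst'[symmetric])
      (auto intro!: P.integrable_const_bound[where B=1] simp: norm_mult)
  also have "\<dots> = complex_of_real (exp (- ((Re c / sqrt 2)\<^sup>2) / 2)) * exp (- ((- Im c / sqrt 2)\<^sup>2) / 2)"
    by (simp only: integral_mult_left_zero integral_mult_right_zero ch)
  also have "\<dots> = exp (- ((cmod c)\<^sup>2 / 4))"
    by (simp add: cmod_power2 power_divide add_divide_distrib flip: of_real_mult exp_add)
  finally show ?thesis .
qed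

text \<open>The factor x / t exceeds 1 beyond t and gives the density an explicit antiderivative.
  The gain 1 / t matters later: it keeps the loss in the second moment method at sqrt s instead of
  s.\<close>

lemma measure_std_normal_upper:
  assumes "t > 0"
  shows "measure std_normal_distribution {t<..} \<le> exp (- t\<^sup>2 / 2) / t"
proof -
  have "emeasure std_normal_distribution {t<..} = (\<integral>\<^sup>+x. ennreal (std_normal_density x) * indicator {t<..} x \<partial>lborel)"
    by (simp add: emeasure_density)
  also have "\<dots> \<le> (\<integral>\<^sup>+x. ennreal (x / t * std_normal_density x) * indicator {t..} x \<partial>lborel)"
    using assms by (intro nn_integral_mono)
      (auto split: split_indicator simp: field_simps intro!: ennreal_leI mult_right_mono)
  also have "\<dots> = ennreal (0 - (- (std_normal_density t / t)))"
  proof (rule nn_integral_FTC_atLeast[where F="\<lambda>x. - (std_normal_density x / t)" and T=0])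
    fix x assume "t \<le> x"
    show "((\<lambda>x. - (std_normal_density x / t)) has_real_derivative x / t * std_normal_density x) (at x)"
      unfolding std_normal_density_def using assms
      by (auto intro!: derivative_eq_intros simp: field_simps power2_eq_square)
    show "0 \<le> x / t * std_normal_density x" using assms \<open>t \<le> x\<close> by simp
  next
    have "((\<lambda>x. - (1 / sqrt (2 * pi) * exp (- x\<^sup>2 / 2) / t)) \<longlongrightarrow> - (1 / sqrt (2 * pi) * 0 / t)) at_top"
      using assms by (intro tendsto_intros) (auto, real_asymp)
    then show "((\<lambda>x. - (std_normal_density x / t)) \<longlongrightarrow> 0) at_top"
      by (simp add: std_normal_density_def)
  qed simp
  also have "\<dots> \<le> ennreal (exp (- t\<^sup>2 / 2) / t)"
  proof (rule ennreal_leI)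
    have "1 \<le> sqrt (2 * pi)" using pi_gt3 by (simp add: real_le_rsqrt)
    then have "1 / sqrt (2 * pi) * exp (- t\<^sup>2 / 2) \<le> 1 * exp (- t\<^sup>2 / 2)"
      by (intro mult_right_mono) auto
    then show "0 - (- (std_normal_density t / t)) \<le> exp (- t\<^sup>2 / 2) / t"
      using assms divide_right_mono[of _ _ t] by (fastforce simp: std_normal_density_def)
  qed
  finally show ?thesis
    using assms by (simp add: measure_def enn2real_leI)
qed

text \<open>Only an interval of length 1 / t is kept, on which x^2 <= t^2 + 2 + 1 / t^2 <= t^2 + 3;
  this is the origin of \<open>exp (- 3 / 2)\<close>.\<close>

lemma measure_std_normal_lower:
  assumes "t \<ge> 1"
  shows "exp (- 3 / 2) / sqrt (2 * pi) * (exp (- t\<^sup>2 / 2) / t) \<le> measure std_normal_distribution {t<..}"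
proof -
  interpret prob_space std_normal_distribution by (rule std_normal_prob)
  have "ennreal (exp (- 3 / 2) / sqrt (2 * pi) * (exp (- t\<^sup>2 / 2) / t))
      = (\<integral>\<^sup>+x. ennreal (exp (- 3 / 2) / sqrt (2 * pi) * exp (- t\<^sup>2 / 2)) * indicator {t<..t + 1 / t} x \<partial>lborel)"
    using assms by (simp add: nn_integral_cmult_indicator flip: ennreal_mult)
  also have "\<dots> \<le> (\<integral>\<^sup>+x. ennreal (std_normal_density x) * indicator {t<..} x \<partial>lborel)"
  proof (intro nn_integral_mono)
    fix x
    have "exp (- 3 / 2) / sqrt (2 * pi) * exp (- t\<^sup>2 / 2) \<le> std_normal_density x" if "t < x" "x \<le> t + 1 / t"
    proof -
      have "x\<^sup>2 \<le> (t + 1 / t)\<^sup>2" using that assms by (intro power_mono) auto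
      also have "\<dots> = t\<^sup>2 + 2 + (1 / t)\<^sup>2" using assms by (simp add: power2_sum)
      also have "(1 / t)\<^sup>2 \<le> 1" using assms by (simp add: power_le_one)
      finally have "exp (- 3 / 2 - t\<^sup>2 / 2) \<le> exp (- x\<^sup>2 / 2)" by simp
      then have "exp (- 3 / 2) * exp (- t\<^sup>2 / 2) \<le> exp (- x\<^sup>2 / 2)"
        by (simp flip: exp_add)
      then show ?thesis
        by (simp add: std_normal_density_def divide_right_mono)
    qed
    then show "ennreal (exp (- 3 / 2) / sqrt (2 * pi) * exp (- t\<^sup>2 / 2)) * indicator {t<..t + 1 / t} x
      \<le> ennreal (std_normal_density x) * indicator {t<..} x"
      by (auto split: split_indicator intro!: ennreal_leI)
  qed
  also have "\<dots> = emeasure std_normal_distribution {t<..}"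
    by (simp add: emeasure_density)
  finally show ?thesis
    by (simp add: emeasure_eq_measure)
qed

lemma nn_integral_std_normal_power:
  "(\<integral>\<^sup>+x. ennreal (x ^ (2 * k)) \<partial>std_normal_distribution) = ennreal (fact (2 * k) / (2 ^ k * fact k))"
  using std_normal_distribution_even_moments[of k]
  by (subst nn_integral_eq_integral) (auto simp: power_mult)

lemma ennreal_half_sum:
  assumes "a \<ge> 0" "b \<ge> 0"
  shows "ennreal (1 / 2 * a + 1 / 2 * b) = ennreal (1 / 2) * ennreal a + ennreal (1 / 2) * ennreal b"
proof -
  have "ennreal (1 / 2 * a + 1 / 2 * b) = ennreal (1 / 2 * a) + ennreal (1 / 2 * b)"
    using assms by (intro ennreal_plus) auto
  then show ?thesis
    using assms by (simp only: ennreal_mult')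
qed

lemma nn_integral_cgauss_norm_sq: "(\<integral>\<^sup>+z. ennreal ((cmod z)\<^sup>2) \<partial>cgauss) = 1"
proof -
  interpret prob_space std_normal_distribution by (rule std_normal_prob)
  have m: "(\<integral>\<^sup>+x. ennreal (x\<^sup>2) \<partial>std_normal_distribution) = 1"
    using nn_integral_std_normal_power[of 1] by simp
  have "(\<integral>\<^sup>+z. ennreal ((cmod z)\<^sup>2) \<partial>cgauss)
    = (\<integral>\<^sup>+x. (\<integral>\<^sup>+y. ennreal (1/2) * ennreal (x\<^sup>2) + ennreal (1/2) * ennreal (y\<^sup>2) \<partial>std_normal_distribution) \<partial>std_normal_distribution)"
    by (subst nn_integral_cgauss)
      (auto intro!: nn_integral_cong simp: cmod_power2 power_divide ennreal_half_sum[simplified, symmetric] field_simps)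
  also have "\<dots> = ennreal (1/2) * 1 + ennreal (1/2) * 1"
    by (simp add: nn_integral_add nn_integral_cmult m emeasure_space_1[simplified] del: ennreal_half)
  also have "\<dots> = 1" using ennreal_half_sum[of 1 1] by simp
  finally show ?thesis .
qed

text \<open>The exact value is 2. Convexity, ((x^2 + y^2) / 2)^2 <= (x^4 + y^4) / 2, gives 3 from
  the one-dimensional fourth moment without any mixed moment.\<close>

lemma nn_integral_cgauss_norm_4: "(\<integral>\<^sup>+z. ennreal ((cmod z) ^ 4) \<partial>cgauss) \<le> 3"
proof -
  interpret prob_space std_normal_distribution by (rule std_normal_prob)
  have m: "(\<integral>\<^sup>+x. ennreal (x ^ 4) \<partial>std_normal_distribution) = 3"
    using nn_integral_std_normal_power[of 2] by (simp add: fact_numeral)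
  have e: "(cmod (Complex (x / sqrt 2) (y / sqrt 2))) ^ 4 \<le> 1/2 * x ^ 4 + 1/2 * y ^ 4" for x y
  proof -
    have "(cmod (Complex (x / sqrt 2) (y / sqrt 2))) ^ 4 = ((cmod (Complex (x / sqrt 2) (y / sqrt 2)))\<^sup>2)\<^sup>2"
      by simp
    also have "\<dots> = ((x\<^sup>2 + y\<^sup>2) / 2)\<^sup>2"
      by (simp add: cmod_power2 power_divide add_divide_distrib)
    also have "\<dots> = 1/2 * x ^ 4 + 1/2 * y ^ 4 - ((x\<^sup>2 - y\<^sup>2) / 2)\<^sup>2"
      by (simp add: power2_eq_square power4_eq_xxxx field_simps)
    finally show ?thesis by simp
  qed
  have "(\<integral>\<^sup>+z. ennreal ((cmod z) ^ 4) \<partial>cgauss)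
    \<le> (\<integral>\<^sup>+x. (\<integral>\<^sup>+y. ennreal (1/2) * ennreal (x ^ 4) + ennreal (1/2) * ennreal (y ^ 4) \<partial>std_normal_distribution) \<partial>std_normal_distribution)"
    by (subst nn_integral_cgauss, measurable)
      (intro nn_integral_mono, simp only: zero_le_even_power even_numeral ennreal_half_sum[symmetric], intro ennreal_leI e)
  also have "\<dots> = ennreal (1/2) * 3 + ennreal (1/2) * 3"
    by (simp add: nn_integral_add nn_integral_cmult m emeasure_space_1[simplified] del: ennreal_half)
  also have "\<dots> = 3" using ennreal_half_sum[of 3 3] by simp
  finally show ?thesis .
qed

lemma integrable_cgauss_norm_sq: "integrable cgauss (\<lambda>z. (cmod z)\<^sup>2)"
  by (rule integrableI_nonneg) (auto simp: nn_integral_cgauss_norm_sq)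

lemma integral_cgauss_norm_sq: "(LINT z|cgauss. (cmod z)\<^sup>2) = 1"
  by (subst integral_eq_nn_integral) (auto simp: nn_integral_cgauss_norm_sq)

lemma integrable_cgauss_norm_4: "integrable cgauss (\<lambda>z. (cmod z) ^ 4)"
  using nn_integral_cgauss_norm_4 by (intro integrableI_nonneg) (auto simp: less_top[symmetric] top_unique)

lemma integral_cgauss_norm_4: "(LINT z|cgauss. (cmod z) ^ 4) \<le> 3"
  using nn_integral_cgauss_norm_4
  by (subst integral_eq_nn_integral) (auto intro!: enn2real_leI)

section \<open>Gaussian vectors and their linear functionals\<close>

definition gauss_vec :: "'i set \<Rightarrow> ('i \<Rightarrow> complex) measure" where
  "gauss_vec I = (\<Pi>\<^sub>M i\<in>I. cgauss)"

lemma prob_space_gauss_vec: "prob_space (gauss_vec I)"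
  unfolding gauss_vec_def by (intro prob_space_PiM prob_space_cgauss)

lemma sets_gauss_vec [measurable_cong]: "sets (gauss_vec I) = sets (\<Pi>\<^sub>M i\<in>I. borel)"
  unfolding gauss_vec_def by (rule sets_PiM_cong) auto

lemma space_gauss_vec: "space (gauss_vec I) = I \<rightarrow>\<^sub>E UNIV"
  by (simp add: gauss_vec_def space_PiM)

text \<open>By independence the characteristic function is a product of factors from
  \<open>char_cgauss_linear\<close>. The variances add up to S / 2, whence the normalization
  \<open>sqrt (2 / S)\<close>, and Levy's uniqueness theorem identifies the law.\<close>

lemma gauss_vec_linear_std_normal:
  assumes I: "finite I" and S: "S = (\<Sum>i\<in>I. (cmod (u i))\<^sup>2)" "S > 0"
  shows "distr (gauss_vec I) borel (\<lambda>g. sqrt (2 / S) * Re (\<Sum>i\<in>I. u i * g i)) = std_normal_distribution"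
proof (rule Levy_uniqueness)
  interpret G: prob_space "gauss_vec I" by (rule prob_space_gauss_vec)
  interpret C: prob_space cgauss by (rule prob_space_cgauss)
  interpret P: product_sigma_finite "\<lambda>_. cgauss" ..
  have m [measurable]: "(\<lambda>g. sqrt (2 / S) * Re (\<Sum>i\<in>I. u i * g i)) \<in> borel_measurable (gauss_vec I)"
    by measurable
  show "real_distribution (distr (gauss_vec I) borel (\<lambda>g. sqrt (2 / S) * Re (\<Sum>i\<in>I. u i * g i)))"
    by (rule G.real_distribution_distr) fact
  show "real_distribution std_normal_distribution" by (rule real_dist_normal_dist)
  show "char (distr (gauss_vec I) borel (\<lambda>g. sqrt (2 / S) * Re (\<Sum>i\<in>I. u i * g i))) = char std_normal_distribution"
  proof
    fix t
    define c where "c i = of_real (t * sqrt (2 / S)) * u i" for i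
    have "char (distr (gauss_vec I) borel (\<lambda>g. sqrt (2 / S) * Re (\<Sum>i\<in>I. u i * g i))) t
      = (LINT g|gauss_vec I. iexp (t * (sqrt (2 / S) * Re (\<Sum>i\<in>I. u i * g i))))"
      unfolding char_def by (subst integral_distr) auto
    also have "\<dots> = (LINT g|gauss_vec I. (\<Prod>i\<in>I. iexp (Re (c i * g i))))"
    proof (intro Bochner_Integration.integral_cong refl)
      fix g
      have "t * (sqrt (2 / S) * Re (\<Sum>i\<in>I. u i * g i)) = (\<Sum>i\<in>I. Re (c i * g i))"
        by (simp add: c_def sum_distrib_left algebra_simps)
      then show "iexp (t * (sqrt (2 / S) * Re (\<Sum>i\<in>I. u i * g i))) = (\<Prod>i\<in>I. iexp (Re (c i * g i)))"
        by (simp add: exp_sum[OF I] sum_distrib_left)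
    qed
    also have "\<dots> = (\<Prod>i\<in>I. (LINT z|cgauss. iexp (Re (c i * z))))"
      unfolding gauss_vec_def
      by (rule P.product_integral_prod[OF I])
        (auto intro!: C.integrable_const_bound[where B=1])
    also have "\<dots> = of_real (\<Prod>i\<in>I. exp (- ((cmod (c i))\<^sup>2 / 4)))"
      by (simp only: char_cgauss_linear of_real_prod)
    also have "(\<Prod>i\<in>I. exp (- ((cmod (c i))\<^sup>2 / 4))) = exp (\<Sum>i\<in>I. - ((cmod (c i))\<^sup>2 / 4))"
      by (rule exp_sum[OF I, symmetric])
    also have "(\<Sum>i\<in>I. - ((cmod (c i))\<^sup>2 / 4)) = (\<Sum>i\<in>I. - (t\<^sup>2 / (2 * S)) * (cmod (u i))\<^sup>2)"
      using S(2) by (intro sum.cong) (auto simp: c_def norm_mult power_mult_distrib field_simps)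
    also have "\<dots> = - (t\<^sup>2 / (2 * S)) * S" by (simp only: S(1) sum_distrib_left)
    also have "\<dots> = - t\<^sup>2 / 2" using S(2) by simp
    finally show "char (distr (gauss_vec I) borel (\<lambda>g. sqrt (2 / S) * Re (\<Sum>i\<in>I. u i * g i))) t = char std_normal_distribution t"
      by (simp add: char_std_normal_distribution)
  qed
qed

text \<open>Every estimate for values of the form is reduced to this one-dimensional tail, even the
  one for two points at once.\<close>

lemma gauss_vec_linear_tail:
  assumes I: "finite I" and S: "S = (\<Sum>i\<in>I. (cmod (u i))\<^sup>2)" "S > 0"
  shows "measure (gauss_vec I) {g \<in> space (gauss_vec I). \<tau> < Re (\<Sum>i\<in>I. u i * g i)}
    = measure std_normal_distribution {sqrt (2 / S) * \<tau><..}"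
proof -
  have m [measurable]: "(\<lambda>g. sqrt (2 / S) * Re (\<Sum>i\<in>I. u i * g i)) \<in> borel_measurable (gauss_vec I)"
    by measurable
  have "{g \<in> space (gauss_vec I). \<tau> < Re (\<Sum>i\<in>I. u i * g i)}
      = (\<lambda>g. sqrt (2 / S) * Re (\<Sum>i\<in>I. u i * g i)) -` {sqrt (2 / S) * \<tau><..} \<inter> space (gauss_vec I)"
    using S(2) by auto
  then show ?thesis
    unfolding gauss_vec_linear_std_normal[OF assms, symmetric]
    by (subst measure_distr) auto
qed

subsection \<open>Cones and the surface measure\<close>

definition scale_vec :: "'i set \<Rightarrow> real \<Rightarrow> ('i \<Rightarrow> complex) \<Rightarrow> 'i \<Rightarrow> complex" where
  "scale_vec I r a = (\<lambda>i\<in>I. of_real r * a i)"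

lemma measurable_scale_vec [measurable]:
  "scale_vec I r \<in> (\<Pi>\<^sub>M i\<in>I. lborel) \<rightarrow>\<^sub>M (\<Pi>\<^sub>M i\<in>I. lborel)"
  unfolding scale_vec_def[abs_def] by measurable

lemma l2_norm_nonneg: "0 \<le> l2_norm I a"
  by (simp add: l2_norm_def)

lemma l2_norm_scale_vec: "r \<ge> 0 \<Longrightarrow> l2_norm I (scale_vec I r a) = r * l2_norm I a"
  unfolding l2_norm_def scale_vec_def
  by (subst L2_set_right_distrib) (auto intro!: L2_set_cong simp: norm_mult)

lemma scale_vec_scale_vec: "scale_vec I r (scale_vec I s a) = scale_vec I (r * s) a"
  by (auto simp: scale_vec_def)

lemma scale_vec_1: "a \<in> I \<rightarrow>\<^sub>E UNIV \<Longrightarrow> scale_vec I 1 a = a"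
  by (auto simp: scale_vec_def PiE_def extensional_def)

text \<open>Each complex coordinate has real dimension 2 and contributes \<open>r ^ 2\<close>;
  agreement on boxes determines a product measure.\<close>

lemma emeasure_PiM_lborel_scale_vec:
  assumes I: "finite I" and r: "r > 0" and A: "A \<in> sets (\<Pi>\<^sub>M i\<in>I. lborel)"
  shows "emeasure (\<Pi>\<^sub>M i\<in>I. lborel) A
    = ennreal (r ^ (2 * card I)) * emeasure (\<Pi>\<^sub>M i\<in>I. lborel) (scale_vec I r -` A \<inter> (I \<rightarrow>\<^sub>E UNIV))"
proof -
  interpret product_sigma_finite "\<lambda>_. lborel :: complex measure" ..
  let ?L = "\<Pi>\<^sub>M i\<in>I. (lborel :: complex measure)"
  have one: "emeasure lborel B = ennreal (r ^ 2) * emeasure lborel ((\<lambda>z. of_real r * z) -` B)"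
    if [measurable]: "B \<in> sets borel" for B :: "complex set"
    using r
    by (subst lborel_affine[of r 0])
      (auto simp: emeasure_density nn_integral_cmult_indicator emeasure_distr scaleR_conv_of_real)
  have "density (distr ?L ?L (scale_vec I r)) (\<lambda>_. ennreal (r ^ (2 * card I))) = ?L"
  proof (rule PiM_eqI[OF I])
    fix B :: "'a \<Rightarrow> complex set" assume B: "\<And>i. i \<in> I \<Longrightarrow> B i \<in> sets lborel"
    then have [measurable]: "Pi\<^sub>E I B \<in> sets ?L" by (intro sets_PiM_I_finite I) auto
    have eq: "scale_vec I r -` Pi\<^sub>E I B \<inter> space ?L = (\<Pi>\<^sub>E i\<in>I. (\<lambda>z. of_real r * z) -` B i)"
      by (auto simp: scale_vec_def space_PiM PiE_iff)
    have m: "(\<lambda>z. of_real r * z) -` B i \<in> sets borel" if "i \<in> I" for i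
      using measurable_sets[of "\<lambda>z. of_real r * z" borel borel "B i"] B[OF that] by simp
    have "emeasure (density (distr ?L ?L (scale_vec I r)) (\<lambda>_. ennreal (r ^ (2 * card I)))) (Pi\<^sub>E I B)
      = ennreal (r ^ (2 * card I)) * (\<Prod>i\<in>I. emeasure lborel ((\<lambda>z. of_real r * z) -` B i))"
      by (simp add: emeasure_density nn_integral_cmult_indicator emeasure_distr eq emeasure_PiM[OF I] m)
    also have "\<dots> = (\<Prod>i\<in>I. ennreal (r ^ 2) * emeasure lborel ((\<lambda>z. of_real r * z) -` B i))"
      using r by (simp add: prod.distrib power_mult ennreal_power)
    also have "\<dots> = (\<Prod>i\<in>I. emeasure lborel (B i))"
      using B by (intro prod.cong) (auto simp: one[symmetric])
    finally show "emeasure (density (distr ?L ?L (scale_vec I r)) (\<lambda>_. ennreal (r ^ (2 * card I)))) (Pi\<^sub>E I B)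
      = (\<Prod>i\<in>I. emeasure lborel (B i))" .
  qed simp
  then have "emeasure ?L A = emeasure (density (distr ?L ?L (scale_vec I r)) (\<lambda>_. ennreal (r ^ (2 * card I)))) A"
    by simp
  also have "\<dots> = ennreal (r ^ (2 * card I)) * emeasure ?L (scale_vec I r -` A \<inter> (I \<rightarrow>\<^sub>E UNIV))"
    using A by (simp add: emeasure_density nn_integral_cmult_indicator emeasure_distr space_PiM)
  finally show ?thesis .
qed

lemma gauss_vec_eq_density:
  assumes I: "finite I"
  shows "gauss_vec I = density (\<Pi>\<^sub>M i\<in>I. lborel)
    (\<lambda>a. ennreal (1 / pi ^ card I) * ennreal (exp (- (l2_norm I a)\<^sup>2)))"
proof -
  interpret product_sigma_finite "\<lambda>_. lborel :: complex measure" ..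
  interpret C: prob_space cgauss by (rule prob_space_cgauss)
  interpret C: product_sigma_finite "\<lambda>_. cgauss" ..
  let ?L = "\<Pi>\<^sub>M i\<in>I. (lborel :: complex measure)"
  define w where "w z = ennreal (exp (- (cmod z)\<^sup>2) / pi)" for z
  have [measurable]: "w \<in> borel_measurable borel" unfolding w_def by measurable
  have w: "ennreal (1 / pi ^ card I) * ennreal (exp (- (l2_norm I a)\<^sup>2)) = (\<Prod>i\<in>I. w (a i))" for a
  proof -
    have "(\<Prod>i\<in>I. w (a i)) = ennreal (\<Prod>i\<in>I. exp (- (cmod (a i))\<^sup>2) / pi)"
      unfolding w_def by (rule prod_ennreal) simp
    also have "(\<Prod>i\<in>I. exp (- (cmod (a i))\<^sup>2) / pi) = 1 / pi ^ card I * exp (- (l2_norm I a)\<^sup>2)"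
      by (simp add: prod_dividef exp_sum[OF I, symmetric] l2_norm_def L2_set_def sum_nonneg sum_negf)
    also have "ennreal (1 / pi ^ card I * exp (- (l2_norm I a)\<^sup>2))
        = ennreal (1 / pi ^ card I) * ennreal (exp (- (l2_norm I a)\<^sup>2))"
      by (rule ennreal_mult) auto
    finally show ?thesis ..
  qed
  have "density ?L (\<lambda>a. \<Prod>i\<in>I. w (a i)) = gauss_vec I"
    unfolding gauss_vec_def
  proof (rule C.PiM_eqI[OF I])
    show "sets (density ?L (\<lambda>a. \<Prod>i\<in>I. w (a i))) = sets (\<Pi>\<^sub>M i\<in>I. cgauss)"
      by (auto intro!: sets_PiM_cong)
    fix B :: "'a \<Rightarrow> complex set" assume B: "\<And>i. i \<in> I \<Longrightarrow> B i \<in> sets cgauss"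
    then have [measurable]: "Pi\<^sub>E I B \<in> sets ?L" by (intro sets_PiM_I_finite I) auto
    have "emeasure (density ?L (\<lambda>a. \<Prod>i\<in>I. w (a i))) (Pi\<^sub>E I B)
      = (\<integral>\<^sup>+a. (\<Prod>i\<in>I. w (a i)) * indicator (Pi\<^sub>E I B) a \<partial>?L)"
      by (simp add: emeasure_density)
    also have "\<dots> = (\<integral>\<^sup>+a. (\<Prod>i\<in>I. w (a i) * indicator (B i) (a i)) \<partial>?L)"
    proof (intro nn_integral_cong)
      fix a assume "a \<in> space ?L"
      then have "a \<in> I \<rightarrow>\<^sub>E UNIV" by (simp add: space_PiM)
      then have "indicator (Pi\<^sub>E I B) a = (\<Prod>i\<in>I. indicator (B i) (a i) :: ennreal)"
        by (auto simp: indicator_def PiE_iff I prod_zero_iff[OF I] intro!: prod.neutral[symmetric] split: if_splits)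
      then show "(\<Prod>i\<in>I. w (a i)) * indicator (Pi\<^sub>E I B) a = (\<Prod>i\<in>I. w (a i) * indicator (B i) (a i))"
        by (simp add: prod.distrib)
    qed
    also have "\<dots> = (\<Prod>i\<in>I. \<integral>\<^sup>+z. w z * indicator (B i) z \<partial>lborel)"
      using B by (intro product_nn_integral_prod I) auto
    also have "\<dots> = (\<Prod>i\<in>I. emeasure cgauss (B i))"
      using B by (intro prod.cong refl) (auto simp: cgauss_def emeasure_density w_def)
    finally show "emeasure (density ?L (\<lambda>a. \<Prod>i\<in>I. w (a i))) (Pi\<^sub>E I B) = (\<Prod>i\<in>I. emeasure cgauss (B i))" .
  qed
  then show ?thesis by (simp add: w)
qed

text \<open>The layer-cake formula. For s = ||a||^2 the indicator, read as a function of a, is that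
  of the ball of radius sqrt t.\<close>

lemma exp_minus_eq_nn_integral:
  "ennreal (exp (- s)) = (\<integral>\<^sup>+t. ennreal (exp (- t)) * indicator {s..} t \<partial>lborel)" for s :: real
proof -
  have "(\<integral>\<^sup>+t. ennreal (exp (- t)) * indicator {s..} t \<partial>lborel) = ennreal (0 - (- exp (- s)))"
  proof (rule nn_integral_FTC_atLeast[where F="\<lambda>t. - exp (- t)" and T=0])
    show "((\<lambda>t::real. - exp (- t)) \<longlongrightarrow> 0) at_top" by real_asymp
  qed (auto intro!: derivative_eq_intros)
  then show ?thesis by simp
qed

text \<open>Writing the Gaussian weight as a superposition of indicator functions of balls
  shows that it gives a cone the same mass as the uniform distribution on the ball.\<close>

lemma emeasure_gauss_vec_cone:
  assumes I: "finite I" and E: "E \<in> sets (\<Pi>\<^sub>M i\<in>I. borel)"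
    and cone: "\<And>r a. r > 0 \<Longrightarrow> a \<in> E \<Longrightarrow> scale_vec I r a \<in> E"
  shows "emeasure (gauss_vec I) E * emeasure (\<Pi>\<^sub>M i\<in>I. lborel) (unit_ball I)
    = emeasure (\<Pi>\<^sub>M i\<in>I. lborel) (E \<inter> unit_ball I)"
proof -
  let ?L = "\<Pi>\<^sub>M i\<in>I. (lborel :: complex measure)"
  interpret product_sigma_finite "\<lambda>_. lborel :: complex measure" ..
  interpret L: sigma_finite_measure ?L by (rule sigma_finite[OF I])
  interpret LP: pair_sigma_finite ?L "lborel :: real measure" ..
  define C where "C = ennreal (1 / pi ^ card I)"
  \<comment> \<open>This is the factorial of \<open>card I\<close>, but its value cancels in the
    end.\<close>
  define K where "K = (\<integral>\<^sup>+t. ennreal (exp (- t)) * (ennreal (t ^ card I) * indicator {0<..} t) \<partial>lborel)"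
  note meas_borel = sets_PiM_lborel[of I]
  have [measurable]: "l2_norm I \<in> borel_measurable ?L"
    using measurable_l2_norm[of I] by (simp cong: measurable_cong_sets add: meas_borel)
  have [measurable]: "Measurable.pred (?L \<Otimes>\<^sub>M lborel) (\<lambda>x. snd x \<in> {(l2_norm I (fst x))\<^sup>2..})"
    unfolding atLeast_iff by measurable
  have [measurable]: "Measurable.pred ?L (\<lambda>a. t \<in> {(l2_norm I a)\<^sup>2..})" for t
    unfolding atLeast_iff by measurable
  have main: "emeasure (gauss_vec I) F = C * (emeasure ?L (F \<inter> unit_ball I) * K)"
    if F: "F \<in> sets ?L" and cF: "\<And>r a. r > 0 \<Longrightarrow> a \<in> F \<Longrightarrow> scale_vec I r a \<in> F" for F
  proof -
    note [measurable] = F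
    have Fsp: "F \<subseteq> I \<rightarrow>\<^sub>E UNIV" using sets.sets_into_space[OF F] by (simp add: space_PiM)
    have vol: "(\<integral>\<^sup>+a. indicator F a * indicator {(l2_norm I a)\<^sup>2..} t \<partial>?L)
      = emeasure ?L (F \<inter> unit_ball I) * (ennreal (t ^ card I) * indicator {0<..} t)" if "t \<noteq> 0" for t
    proof (cases "t > 0")
      case False
      have "indicator {(l2_norm I a)\<^sup>2..} t = (0 :: ennreal)" for a
        using False that by (auto simp: indicator_def) (meson leD less_le_trans linorder_neqE_linordered_idom zero_le_power2)
      then show ?thesis using False by simp
    next
      case True
      define A where "A = {a \<in> space ?L. a \<in> F \<and> (l2_norm I a)\<^sup>2 \<le> t}"
      have [measurable]: "A \<in> sets ?L" unfolding A_def by measurable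
      have "(\<integral>\<^sup>+a. indicator F a * indicator {(l2_norm I a)\<^sup>2..} t \<partial>?L) = (\<integral>\<^sup>+a. indicator A a \<partial>?L)"
        by (intro nn_integral_cong) (auto simp: A_def indicator_def)
      also have "\<dots> = emeasure ?L A" by simp
      also have "\<dots> = ennreal (sqrt t ^ (2 * card I)) * emeasure ?L (scale_vec I (sqrt t) -` A \<inter> (I \<rightarrow>\<^sub>E UNIV))"
        using True by (intro emeasure_PiM_lborel_scale_vec I) auto
      \<comment> \<open>Here the cone property enters: the part of \<open>F\<close> in the ball of
        radius sqrt t is the dilate of its part in the unit ball.\<close>
      also have "scale_vec I (sqrt t) -` A \<inter> (I \<rightarrow>\<^sub>E UNIV) = F \<inter> unit_ball I"
      proof -
        have "scale_vec I (sqrt t) a \<in> F \<longleftrightarrow> a \<in> F" if "a \<in> I \<rightarrow>\<^sub>E UNIV" for a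
        proof (rule iffI)
          assume "scale_vec I (sqrt t) a \<in> F"
          then have "scale_vec I (1 / sqrt t) (scale_vec I (sqrt t) a) \<in> F"
            by (rule cF[rotated]) (use True in simp)
          moreover have "scale_vec I (1 / sqrt t) (scale_vec I (sqrt t) a) = scale_vec I 1 a"
            using True unfolding scale_vec_scale_vec by simp
          ultimately show "a \<in> F" by (simp only: scale_vec_1[OF that])
        next
          assume "a \<in> F"
          then show "scale_vec I (sqrt t) a \<in> F" by (rule cF[rotated]) (use True in simp)
        qed
        moreover have "(l2_norm I (scale_vec I (sqrt t) a))\<^sup>2 \<le> t \<longleftrightarrow> l2_norm I a \<le> 1" for a
          using True l2_norm_nonneg[of I a] by (simp add: l2_norm_scale_vec power_mult_distrib abs_square_le_1)
        moreover have "scale_vec I (sqrt t) a \<in> space ?L" for a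
          by (auto simp: scale_vec_def space_PiM)
        ultimately show ?thesis
          using Fsp by (auto simp: A_def unit_ball_def)
      qed
      also have "sqrt t ^ (2 * card I) = t ^ card I" using True by (simp add: power_mult)
      finally show ?thesis using True by (simp add: mult.commute)
    qed
    have "emeasure (gauss_vec I) F = (\<integral>\<^sup>+a. C * (indicator F a * ennreal (exp (- (l2_norm I a)\<^sup>2))) \<partial>?L)"
      unfolding gauss_vec_eq_density[OF I] C_def
      by (subst emeasure_density) (auto simp: mult_ac)
    also have "\<dots> = C * (\<integral>\<^sup>+a. indicator F a * ennreal (exp (- (l2_norm I a)\<^sup>2)) \<partial>?L)"
      by (rule nn_integral_cmult) measurable
    also have "(\<integral>\<^sup>+a. indicator F a * ennreal (exp (- (l2_norm I a)\<^sup>2)) \<partial>?L)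
       = (\<integral>\<^sup>+a. (\<integral>\<^sup>+t. ennreal (exp (- t)) * (indicator F a * indicator {(l2_norm I a)\<^sup>2..} t) \<partial>lborel) \<partial>?L)"
    proof (rule nn_integral_cong)
      fix a
      have "indicator F a * ennreal (exp (- (l2_norm I a)\<^sup>2))
        = (\<integral>\<^sup>+t. indicator F a * (ennreal (exp (- t)) * indicator {(l2_norm I a)\<^sup>2..} t) \<partial>lborel)"
        by (subst exp_minus_eq_nn_integral, rule nn_integral_cmult[symmetric]) measurable
      then show "indicator F a * ennreal (exp (- (l2_norm I a)\<^sup>2))
        = (\<integral>\<^sup>+t. ennreal (exp (- t)) * (indicator F a * indicator {(l2_norm I a)\<^sup>2..} t) \<partial>lborel)"
        by (simp only: mult_ac)
    qed
    also have "(\<integral>\<^sup>+a. (\<integral>\<^sup>+t. ennreal (exp (- t)) * (indicator F a * indicator {(l2_norm I a)\<^sup>2..} t) \<partial>lborel) \<partial>?L)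
       = (\<integral>\<^sup>+t. (\<integral>\<^sup>+a. ennreal (exp (- t)) * (indicator F a * indicator {(l2_norm I a)\<^sup>2..} t) \<partial>?L) \<partial>lborel)"
      by (rule LP.Fubini'[symmetric]) measurable
    also have "\<dots> = (\<integral>\<^sup>+t. ennreal (exp (- t)) * (\<integral>\<^sup>+a. indicator F a * indicator {(l2_norm I a)\<^sup>2..} t \<partial>?L) \<partial>lborel)"
      by (intro nn_integral_cong nn_integral_cmult) measurable
    also have "\<dots> = (\<integral>\<^sup>+t. emeasure ?L (F \<inter> unit_ball I) * (ennreal (exp (- t)) * (ennreal (t ^ card I) * indicator {0<..} t)) \<partial>lborel)"
      using AE_lborel_singleton[of "0::real"]
      by (intro nn_integral_cong_AE) (auto elim!: eventually_mono simp: vol mult_ac)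
    also have "\<dots> = emeasure ?L (F \<inter> unit_ball I) * K"
      unfolding K_def by (rule nn_integral_cmult) measurable
    finally show ?thesis .
  qed
  interpret G: prob_space "gauss_vec I" by (rule prob_space_gauss_vec)
  \<comment> \<open>The whole space is itself a cone, and for it \<open>main\<close> fixes the
    product of \<open>C\<close>, \<open>K\<close> and the volume of the ball.\<close>
  have "(I \<rightarrow>\<^sub>E UNIV) \<in> sets ?L" using sets.top[of ?L] by (simp add: space_PiM)
  then have "emeasure (gauss_vec I) (I \<rightarrow>\<^sub>E UNIV) = C * (emeasure ?L ((I \<rightarrow>\<^sub>E UNIV) \<inter> unit_ball I) * K)"
    by (rule main) (auto simp: scale_vec_def)
  moreover have "(I \<rightarrow>\<^sub>E UNIV) \<inter> unit_ball I = unit_ball I" by (auto simp: unit_ball_def)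
  ultimately have one: "C * (emeasure ?L (unit_ball I) * K) = 1"
    using G.emeasure_space_1 by (simp add: space_gauss_vec)
  have "emeasure (gauss_vec I) E = C * (emeasure ?L (E \<inter> unit_ball I) * K)"
    using E by (intro main cone) (auto simp: meas_borel)
  then have "emeasure (gauss_vec I) E * emeasure ?L (unit_ball I)
      = emeasure ?L (E \<inter> unit_ball I) * (C * (emeasure ?L (unit_ball I) * K))"
    by (simp only: mult_ac)
  then show ?thesis by (simp add: one)
qed

text \<open>A vector is its norm times its projection, so whatever projects into a cone lies in the
  cone, and on cones the uniform law on the ball and the Gaussian law agree. An inequality suffices
  to carry over the smallness of exceptional sets.\<close>

lemma sphere_measure_cone_le:
  assumes I: "finite I" "I \<noteq> {}" and E: "E \<in> sets (\<Pi>\<^sub>M i\<in>I. borel)"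
    and cone: "\<And>r a. r > 0 \<Longrightarrow> a \<in> E \<Longrightarrow> scale_vec I r a \<in> E"
  shows "measure (sphere_measure I) (E \<inter> unit_sphere I) \<le> measure (gauss_vec I) E"
proof -
  let ?L = "\<Pi>\<^sub>M i\<in>I. (lborel :: complex measure)"
  let ?B = "\<Pi>\<^sub>M i\<in>I. (borel :: complex measure)"
  let ?U = "uniform_measure ?L (unit_ball I)"
  interpret S: prob_space "sphere_measure I" by (rule prob_space_sphere_measure[OF I])
  interpret G: prob_space "gauss_vec I" by (rule prob_space_gauss_vec)
  have radial: "radial_proj I \<in> ?U \<rightarrow>\<^sub>M ?B"
    using measurable_radial_proj[of I] by (simp add: sets_PiM_lborel cong: measurable_cong_sets)
  have ES: "E \<inter> unit_sphere I \<in> sets ?B" using E by auto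
  have sub: "radial_proj I -` (E \<inter> unit_sphere I) \<inter> space ?U \<subseteq> E"
  proof
    fix a assume a: "a \<in> radial_proj I -` (E \<inter> unit_sphere I) \<inter> space ?U"
    then have aE: "radial_proj I a \<in> E" "l2_norm I (radial_proj I a) = 1" "a \<in> I \<rightarrow>\<^sub>E UNIV"
      by (auto simp: unit_sphere_def space_PiM)
    \<comment> \<open>At the origin the projection divides by 0 and returns the zero vector, which
      is off the sphere.\<close>
    have "l2_norm I a \<noteq> 0"
    proof
      assume "l2_norm I a = 0"
      then have "radial_proj I a = (\<lambda>i\<in>I. 0)" by (simp add: radial_proj_def)
      with aE(2) show False by (simp add: l2_norm_def L2_set_def)
    qed
    then have pos: "l2_norm I a > 0" using l2_norm_nonneg[of I a] by simp
    have "scale_vec I (l2_norm I a) (radial_proj I a) = a"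
      using pos aE(3) by (auto simp: scale_vec_def radial_proj_def PiE_def extensional_def)
    with cone[OF pos aE(1)] show "a \<in> E" by simp
  qed
  have "emeasure (sphere_measure I) (E \<inter> unit_sphere I) = emeasure (distr ?U ?B (radial_proj I)) (E \<inter> unit_sphere I)"
  proof -
    have "unit_sphere I \<inter> (I \<rightarrow>\<^sub>E UNIV) = unit_sphere I" by (auto simp: unit_sphere_def)
    then show ?thesis
      unfolding sphere_measure_def using sets_unit_sphere[of I]
      by (subst emeasure_restrict_space) (auto simp: space_PiM)
  qed
  also have "\<dots> = emeasure ?U (radial_proj I -` (E \<inter> unit_sphere I) \<inter> space ?U)"
    by (rule emeasure_distr[OF radial ES])
  also have "\<dots> \<le> emeasure ?U E"
    by (rule emeasure_mono[OF sub]) (use E in \<open>simp add: sets_PiM_lborel\<close>)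
  also have "\<dots> = emeasure ?L (unit_ball I \<inter> E) / emeasure ?L (unit_ball I)"
    using E by (intro emeasure_uniform_measure) (auto simp: sets_PiM_lborel)
  also have "\<dots> = emeasure (gauss_vec I) E * emeasure ?L (unit_ball I) / emeasure ?L (unit_ball I)"
    by (subst emeasure_gauss_vec_cone[OF I(1) E cone]) (auto simp: Int_commute)
  also have "\<dots> = emeasure (gauss_vec I) E"
    using emeasure_unit_ball_finite[OF I(1)] emeasure_unit_ball_pos[OF I(1)]
    by (simp add: ennreal_mult_divide_eq)
  finally show ?thesis
    by (simp add: S.emeasure_eq_measure G.emeasure_eq_measure)
qed

subsection \<open>The Efron--Stein inequality\<close>

text \<open>Integrating out one coordinate preserves the hypothesis on the remaining ones, which makes
  the induction work.\<close>

lemma Efron_Stein: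
  fixes M :: "'a measure" and f :: "('i \<Rightarrow> 'a) \<Rightarrow> real" and w :: "'a \<Rightarrow> real"
  assumes M: "prob_space M" and w: "w \<in> borel_measurable M" "integrable M (\<lambda>z. (w z)\<^sup>2)"
    and z0: "z0 \<in> space M"
    and I: "finite I" and f: "f \<in> borel_measurable (PiM I (\<lambda>_. M))"
    and dep: "\<And>a i. a \<in> space (PiM I (\<lambda>_. M)) \<Longrightarrow> i \<in> I \<Longrightarrow> \<bar>f a - f (a(i := z0))\<bar> \<le> w (a i)"
  shows "integrable (PiM I (\<lambda>_. M)) (\<lambda>a. (f a)\<^sup>2) \<and>
    (LINT a|PiM I (\<lambda>_. M). (f a - (LINT b|PiM I (\<lambda>_. M). f b))\<^sup>2) \<le> card I * (LINT z|M. (w z)\<^sup>2)"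
  using I f dep
proof (induction I arbitrary: f rule: finite_induct)
  case empty
  interpret prob_space "PiM {} (\<lambda>_. M)" by (intro prob_space_PiM M)
  have e: "f a = f (\<lambda>_. undefined)" if "a \<in> space (PiM {} (\<lambda>_. M))" for a
    using that by (simp add: space_PiM)
  let ?u = "f (\<lambda>_. undefined)"
  have e2: "(f a)\<^sup>2 = ?u\<^sup>2" if "a \<in> space (PiM {} (\<lambda>_. M))" for a
    by (subst e[OF that]) (rule refl)
  have 1: "integrable (PiM {} (\<lambda>_. M)) (\<lambda>a. (f a)\<^sup>2)"
    by (subst Bochner_Integration.integrable_cong[OF refl e2]) auto
  have 2: "(LINT b|PiM {} (\<lambda>_. M). f b) = ?u"
    by (subst Bochner_Integration.integral_cong[OF refl e]) (auto simp: prob_space)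
  have e3: "(f a - ?u)\<^sup>2 = 0" if "a \<in> space (PiM {} (\<lambda>_. M))" for a
    by (subst e[OF that]) simp
  have "(LINT a|PiM {} (\<lambda>_. M). (f a - ?u)\<^sup>2) = 0"
    by (subst Bochner_Integration.integral_cong[OF refl e3]) auto
  with 1 2 show ?case by simp
next
  case (insert j I)
  interpret M: prob_space M by fact
  interpret product_sigma_finite "\<lambda>_. M" ..
  let ?P = "PiM I (\<lambda>_. M)" and ?Q = "PiM (insert j I) (\<lambda>_. M)"
  interpret P: prob_space ?P by (intro prob_space_PiM M)
  interpret Q: prob_space ?Q by (intro prob_space_PiM M)
  note [measurable] = insert.prems(1) w(1)
  have upd [measurable]: "(\<lambda>(x, y). x(j := y)) \<in> ?P \<Otimes>\<^sub>M M \<rightarrow>\<^sub>M ?Q"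
    by (rule measurable_add_dim)
  have m2 [measurable]: "(\<lambda>(x, y). f (x(j := y))) \<in> borel_measurable (?P \<Otimes>\<^sub>M M)"
    using measurable_compose[OF upd insert.prems(1)] unfolding case_prod_beta' .
  have m1 [measurable]: "(\<lambda>y. f (x(j := y))) \<in> borel_measurable M" if "x \<in> space ?P" for x
    using measurable_compose[OF measurable_Pair1'[OF that] m2] unfolding case_prod_conv .
  have xin: "x(j := y) \<in> space ?Q" if "x \<in> space ?P" "y \<in> space M" for x y
    using that by (auto simp: space_PiM PiE_iff extensional_def)
  have d1: "\<bar>f (x(j := y)) - f (x(j := z0))\<bar> \<le> w y" if "x \<in> space ?P" "y \<in> space M" for x y
    using insert.prems(2)[OF xin[OF that] insertI1] unfolding fun_upd_upd fun_upd_same .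
  have d2: "(f (x(j := y)) - f (x(j := z0)))\<^sup>2 \<le> (w y)\<^sup>2" if "x \<in> space ?P" "y \<in> space M" for x y
    using power_mono[OF d1[OF that] abs_ge_zero, of 2] by (simp only: power2_abs)
  have md: "(\<lambda>y. f (x(j := y)) - c) \<in> borel_measurable M" if "x \<in> space ?P" for x c
    by (rule borel_measurable_diff[OF m1[OF that] borel_measurable_const])
  have int1: "integrable M (\<lambda>y. (f (x(j := y)) - f (x(j := z0)))\<^sup>2)" if x: "x \<in> space ?P" for x
    by (rule Bochner_Integration.integrable_bound[OF w(2) borel_measurable_power[OF md[OF x]]])
      (use d2[OF x] in \<open>auto intro!: AE_I2\<close>)
  have int1': "integrable M (\<lambda>y. f (x(j := y)))" if x: "x \<in> space ?P" for x
  proof -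
    have "integrable M (\<lambda>y. f (x(j := y)) - f (x(j := z0)))"
      by (rule M.square_integrable_imp_integrable[OF md[OF x] int1[OF x]])
    then have "integrable M (\<lambda>y. (f (x(j := y)) - f (x(j := z0))) + f (x(j := z0)))"
      by (intro Bochner_Integration.integrable_add) auto
    then show ?thesis by simp
  qed
  have int2: "integrable M (\<lambda>y. (f (x(j := y)))\<^sup>2)" if x: "x \<in> space ?P" for x
  proof -
    have "integrable M (\<lambda>y. (f (x(j := y)) - f (x(j := z0)))\<^sup>2
        + (2 * f (x(j := z0)) * f (x(j := y)) - (f (x(j := z0)))\<^sup>2))"
      using int1[OF x] int1'[OF x] by (intro Bochner_Integration.integrable_add Bochner_Integration.integrable_diff integrable_mult_right) auto
    then show ?thesis by (simp add: power2_eq_square algebra_simps)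
  qed
  \<comment> \<open>Conditional mean and conditional variance given the coordinates in
    \<open>I\<close>; the total variance is the mean of \<open>V\<close> plus the variance of
    \<open>F\<close>.\<close>
  define F where "F x = (LINT y|M. f (x(j := y)))" for x
  define V where "V x = (LINT y|M. (f (x(j := y)) - F x)\<^sup>2)" for x
  have Fm [measurable]: "F \<in> borel_measurable ?P"
    unfolding F_def[abs_def] by measurable
  have Vle: "0 \<le> V x \<and> V x \<le> (LINT z|M. (w z)\<^sup>2)" if x: "x \<in> space ?P" for x
  proof -
    \<comment> \<open>A variance is at most the mean square deviation from any constant; the value
      at \<open>z0\<close> is the constant to which \<open>dep\<close> compares.\<close>
    let ?c = "f (x(j := z0))"
    have "V x = (LINT y|M. (f (x(j := y)))\<^sup>2) - (F x)\<^sup>2"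
      unfolding V_def F_def by (rule M.variance_eq[OF int1'[OF x] int2[OF x]])
    also have "\<dots> = (LINT y|M. (f (x(j := y)) - ?c)\<^sup>2) - (F x - ?c)\<^sup>2"
      using int1'[OF x] int2[OF x] by (simp add: power2_diff F_def M.prob_space)
    also have "\<dots> \<le> (LINT y|M. (f (x(j := y)) - ?c)\<^sup>2)" by simp
    also have "\<dots> \<le> (LINT z|M. (w z)\<^sup>2)"
      by (rule integral_mono[OF int1[OF x] w(2) d2[OF x]])
    finally show ?thesis by (simp add: V_def)
  qed
  have dF: "\<bar>F a - F (a(i := z0))\<bar> \<le> w (a i)" if a: "a \<in> space ?P" and i: "i \<in> I" for a i
  proof -
    have a': "a(i := z0) \<in> space ?P" using a i z0 by (auto simp: space_PiM PiE_iff extensional_def)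
    have ij: "i \<noteq> j" using i insert.hyps by auto
    have "\<bar>F a - F (a(i := z0))\<bar> = \<bar>LINT y|M. (f (a(j := y)) - f ((a(i := z0))(j := y)))\<bar>"
      unfolding F_def using int1'[OF a] int1'[OF a'] by simp
    also have "\<dots> \<le> (LINT y|M. \<bar>f (a(j := y)) - f ((a(i := z0))(j := y))\<bar>)"
      by (rule integral_abs_bound)
    also have "\<dots> \<le> (LINT y|M. w (a i))"
    proof (rule integral_mono)
      fix y assume y: "y \<in> space M"
      show "\<bar>f (a(j := y)) - f ((a(i := z0))(j := y))\<bar> \<le> w (a i)"
        using insert.prems(2)[OF xin[OF a y] insertI2[OF i]]
        unfolding fun_upd_twist[OF ij[symmetric]] fun_upd_other[OF ij] .
    qed (use int1'[OF a] int1'[OF a'] in \<open>auto intro!: Bochner_Integration.integrable_diff integrable_abs\<close>)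
    finally show ?thesis by (simp add: M.prob_space)
  qed
  have IH: "integrable ?P (\<lambda>a. (F a)\<^sup>2)"
    "(LINT a|?P. (F a - (LINT b|?P. F b))\<^sup>2) \<le> card I * (LINT z|M. (w z)\<^sup>2)"
    using insert.IH[OF Fm dF] by auto
  have VFm [measurable]: "V \<in> borel_measurable ?P"
    unfolding V_def[abs_def] by measurable
  have Vint: "integrable ?P V"
    by (rule P.integrable_const_bound[where B="LINT z|M. (w z)\<^sup>2"]) (use Vle in auto)
  \<comment> \<open>With c = 0 this yields square integrability on the larger product, with c the
    mean it yields the decomposition of the variance.\<close>
  have sq: "(LINT y|M. (f (x(j := y)) - c)\<^sup>2) = V x + (F x - c)\<^sup>2" if x: "x \<in> space ?P" for x c
  proof -
    have "V x = (LINT y|M. (f (x(j := y)))\<^sup>2) - (F x)\<^sup>2"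
      unfolding V_def F_def by (rule M.variance_eq[OF int1'[OF x] int2[OF x]])
    then show ?thesis
      using int1'[OF x] int2[OF x] by (simp add: power2_diff F_def M.prob_space)
  qed
  have fsq: "integrable ?Q (\<lambda>a. (f a)\<^sup>2)"
  proof (rule integrableI_nonneg)
    have "(\<integral>\<^sup>+a. ennreal ((f a)\<^sup>2) \<partial>?Q) = (\<integral>\<^sup>+x. (\<integral>\<^sup>+y. ennreal ((f (x(j := y)))\<^sup>2) \<partial>M) \<partial>?P)"
      using insert.hyps by (intro product_nn_integral_insert) auto
    also have "\<dots> = (\<integral>\<^sup>+x. ennreal (V x + (F x)\<^sup>2) \<partial>?P)"
      using sq[of _ 0] int2 by (intro nn_integral_cong) (simp add: nn_integral_eq_integral)
    also have "\<dots> = ennreal (LINT x|?P. V x + (F x)\<^sup>2)"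
      using Vint IH(1) Vle by (intro nn_integral_eq_integral) (auto intro!: AE_I2)
    also have "\<dots> < \<infinity>" by simp
    finally show "(\<integral>\<^sup>+a. ennreal ((f a)\<^sup>2) \<partial>?Q) < \<infinity>" .
  qed auto
  have fint: "integrable ?Q f" by (rule Q.square_integrable_imp_integrable[OF _ fsq]) simp
  have mean: "(LINT b|?Q. f b) = (LINT b|?P. F b)"
    unfolding F_def using insert.hyps by (intro product_integral_insert fint) auto
  let ?\<mu> = "LINT b|?P. F b"
  have Fint: "integrable ?P F" by (rule P.square_integrable_imp_integrable[OF _ IH(1)]) simp
  have "integrable ?Q (\<lambda>a. (f a - ?\<mu>)\<^sup>2)"
    using fsq fint by (simp add: power2_diff)
  then have "(LINT a|?Q. (f a - ?\<mu>)\<^sup>2) = (LINT x|?P. (LINT y|M. (f (x(j := y)) - ?\<mu>)\<^sup>2))"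
    using insert.hyps by (intro product_integral_insert) auto
  also have "\<dots> = (LINT x|?P. V x + (F x - ?\<mu>)\<^sup>2)"
    by (intro Bochner_Integration.integral_cong refl sq)
  also have "\<dots> = (LINT x|?P. V x) + (LINT x|?P. (F x - ?\<mu>)\<^sup>2)"
    using Fint IH(1) by (intro Bochner_Integration.integral_add Vint) (simp add: power2_diff)
  also have "(LINT x|?P. V x) \<le> (LINT z|M. (w z)\<^sup>2)"
  proof -
    have "(LINT x|?P. V x) \<le> (LINT x|?P. (LINT z|M. (w z)\<^sup>2))"
      using Vle by (intro integral_mono Vint) auto
    then show ?thesis by (simp add: P.prob_space)
  qed
  also note IH(2)
  finally show ?case
    using insert.hyps fsq by (simp add: mean algebra_simps)
qed

subsection \<open>The norm of a multilinear form and roots of unity\<close>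

definition root_of_unity :: "nat \<Rightarrow> real \<Rightarrow> complex" where
  "root_of_unity L t = cis (2 * pi * t / real L)"

definition unity_roots :: "nat \<Rightarrow> complex set" where
  "unity_roots L = (\<lambda>r. root_of_unity L (real r)) ` {..<L}"

lemma root_of_unity_add: "root_of_unity L (s + t) = root_of_unity L s * root_of_unity L t"
  by (simp add: root_of_unity_def cis_mult add_divide_distrib distrib_left)

lemma norm_root_of_unity [simp]: "cmod (root_of_unity L t) = 1"
  by (simp add: root_of_unity_def)

lemma root_of_unity_mod:
  assumes "L > 0"
  shows "root_of_unity L (real (nat (k mod int L))) = root_of_unity L (of_int k)"
proof -
  have "k = int L * (k div int L) + k mod int L" by simp
  then have "real_of_int k = real L * of_int (k div int L) + of_int (k mod int L)"
    by (metis of_int_add of_int_mult of_int_of_nat_eq)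
  then have "2 * pi * real_of_int k / real L = 2 * pi * of_int (k div int L) + 2 * pi * of_int (k mod int L) / L"
    using assms by (simp add: field_simps)
  then have "root_of_unity L (of_int k) = cis (2 * pi * of_int (k div int L)) * root_of_unity L (of_int (k mod int L))"
    by (simp only: root_of_unity_def cis_mult)
  moreover have "cis (2 * pi * of_int (k div int L)) = 1"
    by (rule cis_multiple_2pi) auto
  moreover have "real (nat (k mod int L)) = of_int (k mod int L)"
    using assms by simp
  ultimately show ?thesis by simp
qed

lemma root_of_unity_int_in_unity_roots:
  assumes "L > 0"
  shows "root_of_unity L (of_int k) \<in> unity_roots L"
  unfolding root_of_unity_mod[OF assms, symmetric] unity_roots_def
  using assms by (intro imageI) (simp add: nat_less_iff)

lemma cos_ge_quadratic: "1 - x\<^sup>2 / 2 \<le> cos x" for x :: real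
proof -
  have "\<bar>sin (x / 2)\<bar> \<le> \<bar>x / 2\<bar>" by (rule abs_sin_x_le_abs_x)
  then have "(sin (x / 2))\<^sup>2 \<le> (x / 2)\<^sup>2" by (simp only: abs_le_square_iff)
  moreover have "cos x = 1 - 2 * (sin (x / 2))\<^sup>2"
    using cos_double_sin[of "x / 2"] by simp
  ultimately show ?thesis by (simp add: power_divide)
qed

text \<open>Rounding the ideal rotation by - Arg a to a multiple of 2 pi / L leaves a phase of at
  most pi / L. The estimate bounds the support function of the polygon from below and also lets a
  real part stand in for a modulus.\<close>

lemma unity_roots_support:
  assumes L: "L > 0"
  shows "\<exists>w\<in>unity_roots L. cmod a * (1 - (pi / L)\<^sup>2 / 2) \<le> Re (a * w)"
proof -
  define k where "k = round (- Arg a * L / (2 * pi))"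
  define \<phi> where "\<phi> = Arg a + 2 * pi * of_int k / L"
  have "\<bar>of_int k - (- Arg a * L / (2 * pi))\<bar> \<le> 1 / 2"
    unfolding k_def by (rule of_int_round_abs_le)
  then have "(2 * pi / L) * \<bar>of_int k - (- Arg a * L / (2 * pi))\<bar> \<le> (2 * pi / L) * (1 / 2)"
    by (intro mult_left_mono) auto
  also have "(2 * pi / L) * \<bar>of_int k - (- Arg a * L / (2 * pi))\<bar>
      = \<bar>(2 * pi / L) * (of_int k - (- Arg a * L / (2 * pi)))\<bar>"
    unfolding abs_mult by simp
  also have "(2 * pi / L) * (of_int k - (- Arg a * L / (2 * pi))) = \<phi>"
    using L by (simp add: \<phi>_def field_simps)
  finally have "\<bar>\<phi>\<bar> \<le> \<bar>pi / L\<bar>" by simp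
  then have "\<phi>\<^sup>2 \<le> (pi / L)\<^sup>2" by (simp only: abs_le_square_iff)
  then have "1 - (pi / L)\<^sup>2 / 2 \<le> cos \<phi>"
    using cos_ge_quadratic[of \<phi>] by simp
  then have "cmod a * (1 - (pi / L)\<^sup>2 / 2) \<le> cmod a * cos \<phi>"
    by (intro mult_left_mono) auto
  also have "\<dots> = Re (of_real (cmod a) * cis \<phi>)" by simp
  also have "of_real (cmod a) * cis \<phi> = rcis (cmod a) (Arg a) * root_of_unity L (of_int k)"
    by (simp add: \<phi>_def rcis_def root_of_unity_def cis_mult mult.assoc)
  also have "rcis (cmod a) (Arg a) = a"
    by (rule rcis_cmod_Arg)
  finally show ?thesis
    using root_of_unity_int_in_unity_roots[OF L] by blast
qed

text \<open>A point outside the compact polygon is strictly separated from it, while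
  \<open>unity_roots_support\<close> shows that in every direction the polygon reaches at least as
  far as the disc.\<close>

lemma disc_subset_hull_unity_roots:
  assumes L: "L > 0" and z: "cmod z \<le> 1 - (pi / L)\<^sup>2 / 2"
  shows "z \<in> convex hull unity_roots L"
proof (rule ccontr)
  assume nz: "z \<notin> convex hull unity_roots L"
  have "finite (unity_roots L)" by (simp add: unity_roots_def)
  then have "closed (convex hull unity_roots L)"
    by (intro compact_imp_closed finite_imp_compact_convex_hull)
  then obtain a b where ab: "a \<bullet> z < b" "\<And>x. x \<in> convex hull unity_roots L \<Longrightarrow> b < a \<bullet> x"
    using separating_hyperplane_closed_point[OF convex_convex_hull _ nz] by blast
  \<comment> \<open>The separation puts the polygon on the upper side of the line, so the support
    bound is applied to the opposite direction, hence the sign.\<close>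
  have inner: "a \<bullet> x = - Re (- cnj a * x)" for x by (simp add: inner_complex_def)
  obtain w where w: "w \<in> unity_roots L" "cmod (- cnj a) * (1 - (pi / L)\<^sup>2 / 2) \<le> Re (- cnj a * w)"
    using unity_roots_support[OF L] by blast
  have "b < a \<bullet> w" using ab(2) w(1) by (simp add: hull_inc)
  also have "\<dots> \<le> - (cmod a * (1 - (pi / L)\<^sup>2 / 2))" using w(2) inner[of w] by simp
  also have "\<dots> \<le> - (cmod a * cmod z)" using z by (simp add: mult_left_mono)
  also have "\<dots> \<le> a \<bullet> z" using Cauchy_Schwarz_ineq2[of a z] by (simp add: abs_le_iff)
  finally show False using ab(1) by simp
qed

section \<open>From the polydisc to roots of unity\<close>

lemma multilinear_form_cong:
  assumes "\<And>k j. k \<in> {1..m} \<Longrightarrow> j \<in> {1..n} \<Longrightarrow> x k j = y k j"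
  shows "multilinear_form m n a x = multilinear_form m n a y"
  unfolding multilinear_form_def
proof (intro sum.cong refl arg_cong2[where f="(*)"] prod.cong)
  fix i k assume "i \<in> multi_indices m n" "k \<in> {1..m}"
  then show "x k (i k) = y k (i k)"
    by (intro assms) (auto simp: multi_indices_def PiE_iff)
qed

lemma multilinear_form_scale:
  "multilinear_form m n a (\<lambda>k j. c k * x k j) = (\<Prod>k\<in>{1..m}. c k) * multilinear_form m n a x"
  unfolding multilinear_form_def by (simp add: prod.distrib sum_distrib_left algebra_simps)

text \<open>Each monomial contains exactly one entry of the \<open>k\<close>-th vector, so it is
  either linear in entry \<open>j\<close> or free of it.\<close>

lemma multilinear_form_coordinate_affine:
  assumes "k \<in> {1..m}"
  shows "\<exists>A B. \<forall>z. multilinear_form m n a (x(k := (x k)(j := z))) = A * z + B"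
proof -
  define c where "c i = (\<Prod>k'\<in>{1..m} - {k}. x k' (i k'))" for i
  have "multilinear_form m n a (x(k := (x k)(j := z)))
    = (\<Sum>i\<in>multi_indices m n. a i * (if i k = j then c i else 0)) * z
    + (\<Sum>i\<in>multi_indices m n. a i * (if i k = j then 0 else x k (i k) * c i))" for z
  proof -
    have "(\<Prod>k'\<in>{1..m}. (x(k := (x k)(j := z))) k' (i k')) = (if i k = j then z else x k (i k)) * c i" for i
    proof -
      have "(\<Prod>k'\<in>{1..m}. (x(k := (x k)(j := z))) k' (i k'))
        = (x(k := (x k)(j := z))) k (i k) * (\<Prod>k'\<in>{1..m} - {k}. (x(k := (x k)(j := z))) k' (i k'))"
        by (rule prod.remove) (use assms in auto)
      also have "(\<Prod>k'\<in>{1..m} - {k}. (x(k := (x k)(j := z))) k' (i k')) = c i"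
        unfolding c_def by (intro prod.cong) auto
      finally show ?thesis unfolding fun_upd_same fun_upd_apply .
    qed
    then show ?thesis
      unfolding multilinear_form_def sum_distrib_right sum.distrib[symmetric]
      by (intro sum.cong) auto
  qed
  then show ?thesis by blast
qed

lemma convex_on_multilinear_form_coordinate:
  assumes "k \<in> {1..m}"
  shows "convex_on UNIV (\<lambda>z. cmod (multilinear_form m n a (x(k := (x k)(j := z)))))"
proof -
  obtain A B where AB: "\<And>z. multilinear_form m n a (x(k := (x k)(j := z))) = A * z + B"
    using multilinear_form_coordinate_affine[OF assms] by metis
  have "cmod (A * ((1 - t) *\<^sub>R u + t *\<^sub>R v) + B) \<le> (1 - t) * cmod (A * u + B) + t * cmod (A * v + B)"
    if "0 < t" "t < 1" for t u v
  proof -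
    have "A * ((1 - t) *\<^sub>R u + t *\<^sub>R v) + B = (1 - t) *\<^sub>R (A * u + B) + t *\<^sub>R (A * v + B)"
      by (simp add: scaleR_conv_of_real algebra_simps)
    then show ?thesis
      using that norm_triangle_ineq[of "(1 - t) *\<^sub>R (A * u + B)" "t *\<^sub>R (A * v + B)"] by simp
  qed
  then show ?thesis by (auto simp: AB intro!: convex_onI)
qed

text \<open>A maximum principle: the modulus is convex in each single entry with all others fixed,
  so a bound on \<open>R\<close> extends to the hull one entry at a time. Joint convexity would
  fail.\<close>

lemma norm_multilinear_form_le_hull:
  assumes B: "\<And>x. (\<And>k j. k \<in> {1..m} \<Longrightarrow> j \<in> {1..n} \<Longrightarrow> x k j \<in> R) \<Longrightarrow> cmod (multilinear_form m n a x) \<le> B"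
    and x: "\<And>k j. k \<in> {1..m} \<Longrightarrow> j \<in> {1..n} \<Longrightarrow> x k j \<in> convex hull R"
  shows "cmod (multilinear_form m n a x) \<le> B"
proof -
  \<comment> \<open>\<open>S\<close> lists the positions whose entries may already range over the
    hull; the induction releases them one by one.\<close>
  have main: "cmod (multilinear_form m n a x) \<le> B"
    if "finite S" "S \<subseteq> {1..m} \<times> {1..n}"
      and "\<And>k j. k \<in> {1..m} \<Longrightarrow> j \<in> {1..n} \<Longrightarrow> x k j \<in> (if (k, j) \<in> S then convex hull R else R)"
    for S x
    using that
  proof (induction S arbitrary: x rule: finite_induct)
    case empty
    then show ?case by (intro B) auto
  next
    case (insert p S)
    obtain k j where p: "p = (k, j)" by force
    have k: "k \<in> {1..m}" and j: "j \<in> {1..n}" using insert.prems(1) p by auto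
    define f where "f z = cmod (multilinear_form m n a (x(k := (x k)(j := z))))" for z
    have "f z \<le> B" if "z \<in> R" for z
      unfolding f_def
    proof (rule insert.IH)
      fix k' j' assume kj: "k' \<in> {1..m}" "j' \<in> {1..n}"
      show "(x(k := (x k)(j := z))) k' j' \<in> (if (k', j') \<in> S then convex hull R else R)"
      proof (cases "(k', j') = (k, j)")
        case True
        then show ?thesis using that insert.hyps p by auto
      next
        case False
        then show ?thesis using insert.prems(2)[OF kj] p by (auto split: if_splits)
      qed
    qed (use insert.prems in auto)
    moreover have "convex_on (convex hull R) f"
      unfolding f_def by (rule convex_on_subset[OF convex_on_multilinear_form_coordinate[OF k]]) auto
    ultimately have "f (x k j) \<le> B"
      using convex_on_convex_hull_bound[of R f B] insert.prems(2)[OF k j] p by auto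
    then show ?case by (simp add: f_def)
  qed
  show ?thesis by (rule main[of "{1..m} \<times> {1..n}"]) (use x in auto)
qed

text \<open>The label 0 at index 1 removes the common phase of each vector. This leaves n - 1 free
  angles, the source of n - 1 in the limit, and it prevents distinct words from being fully
  correlated.\<close>

definition phase_words :: "nat \<Rightarrow> nat \<Rightarrow> (nat \<Rightarrow> nat) set" where
  "phase_words n L = (\<Pi>\<^sub>E j\<in>{1..n}. if j = 1 then {0} else {..<L})"

definition phase_grid :: "nat \<Rightarrow> nat \<Rightarrow> nat \<Rightarrow> (nat \<Rightarrow> nat \<Rightarrow> nat) set" where
  "phase_grid m n L = {1..m} \<rightarrow>\<^sub>E phase_words n L"

definition grid_point :: "nat \<Rightarrow> (nat \<Rightarrow> nat \<Rightarrow> nat) \<Rightarrow> nat \<Rightarrow> nat \<Rightarrow> complex" where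
  "grid_point L e k j = root_of_unity L (real (e k j))"

lemma finite_phase_words [simp]: "finite (phase_words n L)"
  unfolding phase_words_def by (intro finite_PiE) auto

lemma finite_phase_grid [simp]: "finite (phase_grid m n L)"
  unfolding phase_grid_def by (intro finite_PiE) auto

lemma card_phase_words: "n \<ge> 1 \<Longrightarrow> card (phase_words n L) = L ^ (n - 1)"
proof -
  assume n: "n \<ge> 1"
  have "card (phase_words n L) = (\<Prod>j\<in>{1..n}. card (if j = 1 then {0} else {..<L}))"
    unfolding phase_words_def by (rule card_PiE) auto
  also have "\<dots> = (\<Prod>j\<in>insert 1 {2..n}. card (if j = 1 then {0} else {..<L}))"
    using n by (intro prod.cong) auto
  also have "\<dots> = (\<Prod>j\<in>{2..n}. card (if j = 1 then {0} else {..<L}))"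
    by (subst prod.insert) auto
  also have "\<dots> = (\<Prod>j\<in>{2..n}. L)" by (intro prod.cong) auto
  finally show ?thesis by simp
qed

lemma card_phase_grid: "n \<ge> 1 \<Longrightarrow> card (phase_grid m n L) = (L ^ (n - 1)) ^ m"
  unfolding phase_grid_def by (subst card_PiE) (auto simp: card_phase_words)

text \<open>Dividing each vector by its first coordinate changes the form only by a unimodular factor.\<close>

lemma multilinear_form_roots_normalize:
  assumes L: "L > 0" and x: "\<And>k j. k \<in> {1..m} \<Longrightarrow> j \<in> {1..n} \<Longrightarrow> x k j \<in> unity_roots L" and n: "n \<ge> 1"
  shows "\<exists>e\<in>phase_grid m n L. cmod (multilinear_form m n a x) = cmod (multilinear_form m n a (grid_point L e))"
proof -
  have "\<exists>r. \<forall>k\<in>{1..m}. \<forall>j\<in>{1..n}. x k j = root_of_unity L (real (r k j))"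
    using x unfolding unity_roots_def by (intro bchoice_iff[THEN iffD1] ballI exI[of _ "\<lambda>k j. SOME r. x k j = root_of_unity L (real r)"]) (metis (mono_tags, lifting) imageE someI_ex)
  then obtain r where r: "\<And>k j. k \<in> {1..m} \<Longrightarrow> j \<in> {1..n} \<Longrightarrow> x k j = root_of_unity L (real (r k j))"
    by blast
  define e where "e = (\<lambda>k\<in>{1..m}. \<lambda>j\<in>{1..n}. nat ((int (r k j) - int (r k 1)) mod int L))"
  have "e \<in> phase_grid m n L"
    using L by (auto simp: e_def phase_grid_def phase_words_def nat_less_iff split: if_splits)
  moreover have "multilinear_form m n a x = multilinear_form m n a (\<lambda>k j. root_of_unity L (real (r k 1)) * grid_point L e k j)"
  proof (rule multilinear_form_cong)
    fix k j assume kj: "k \<in> {1..m}" "j \<in> {1..n}"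
    then have "grid_point L e k j = root_of_unity L (of_int (int (r k j) - int (r k 1)))"
      unfolding grid_point_def e_def using root_of_unity_mod[OF L] by simp
    then have "root_of_unity L (real (r k 1)) * grid_point L e k j = root_of_unity L (real (r k j))"
      by (simp flip: root_of_unity_add)
    then show "x k j = root_of_unity L (real (r k 1)) * grid_point L e k j"
      using r[OF kj] by simp
  qed
  then have "cmod (multilinear_form m n a x) = cmod (multilinear_form m n a (grid_point L e))"
    unfolding multilinear_form_scale by (simp add: norm_mult prod_norm[symmetric])
  ultimately show ?thesis by blast
qed

lemma form_norm_leI:
  assumes "n \<ge> 1" "\<And>x. (\<And>k. k \<in> {1..m} \<Longrightarrow> sup_norm n (x k) \<le> 1) \<Longrightarrow> cmod (multilinear_form m n a x) \<le> b"
  shows "form_norm m n a \<le> b"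
  unfolding form_norm_def
proof (rule cSUP_least)
  have "(\<lambda>_ _. 0) \<in> {x :: nat \<Rightarrow> nat \<Rightarrow> complex. \<forall>k\<in>{1..m}. sup_norm n (x k) \<le> 1}"
    using assms(1) by (simp add: sup_norm_le_iff)
  then show "{x :: nat \<Rightarrow> nat \<Rightarrow> complex. \<forall>k\<in>{1..m}. sup_norm n (x k) \<le> 1} \<noteq> {}"
    by (metis empty_iff)
qed (use assms in auto)

text \<open>Shrinking all variables by \<open>\<kappa>\<close> moves the polydisc into the hull of the grid and costs \<open>\<kappa>\<^sup>m\<close>;
  the remaining factor \<open>\<kappa>\<close> pays for replacing moduli by real parts.\<close>

lemma form_norm_le_grid:
  assumes n: "n \<ge> 1" and L: "L > 0" and \<kappa>: "\<kappa> = 1 - (pi / L)\<^sup>2 / 2" "\<kappa> > 0"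
    and b: "\<And>e r. e \<in> phase_grid m n L \<Longrightarrow> r < L \<Longrightarrow>
      Re (root_of_unity L (real r) * multilinear_form m n a (grid_point L e)) \<le> \<tau>"
  shows "form_norm m n a \<le> \<tau> / \<kappa> ^ (m + 1)"
proof -
  have 1: "cmod (multilinear_form m n a (grid_point L e)) \<le> \<tau> / \<kappa>" if e: "e \<in> phase_grid m n L" for e
  proof -
    obtain w where "w \<in> unity_roots L" "cmod (multilinear_form m n a (grid_point L e)) * \<kappa>
        \<le> Re (multilinear_form m n a (grid_point L e) * w)"
      using unity_roots_support[OF L] \<kappa>(1) by blast
    then show ?thesis
      using b[OF e] \<kappa>(2) by (fastforce simp: unity_roots_def mult.commute pos_le_divide_eq)
  qed
  have 2: "cmod (multilinear_form m n a x) \<le> \<tau> / \<kappa>"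
    if "\<And>k j. k \<in> {1..m} \<Longrightarrow> j \<in> {1..n} \<Longrightarrow> x k j \<in> convex hull unity_roots L" for x
  proof (rule norm_multilinear_form_le_hull[OF _ that])
    fix y assume y: "\<And>k j. k \<in> {1..m} \<Longrightarrow> j \<in> {1..n} \<Longrightarrow> y k j \<in> unity_roots L"
    from multilinear_form_roots_normalize[where x=y and a=a and m=m, OF L y n] 1
    show "cmod (multilinear_form m n a y) \<le> \<tau> / \<kappa>" by auto
  qed
  show ?thesis
  proof (rule form_norm_leI[OF n])
    fix x assume x: "\<And>k. k \<in> {1..m} \<Longrightarrow> sup_norm n (x k) \<le> 1"
    have "cmod (multilinear_form m n a (\<lambda>k j. of_real \<kappa> * x k j)) \<le> \<tau> / \<kappa>"
    proof (rule 2)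
      fix k j assume kj: "k \<in> {1..m}" "j \<in> {1..n}"
      then have "cmod (x k j) \<le> 1" using x n by (auto simp: sup_norm_le_iff)
      then have "cmod (of_real \<kappa> * x k j) \<le> \<kappa>" using \<kappa>(2) by (simp add: norm_mult mult_left_le)
      then show "of_real \<kappa> * x k j \<in> convex hull unity_roots L"
        unfolding \<kappa>(1) by (rule disc_subset_hull_unity_roots[OF L])
    qed
    then have "\<kappa> ^ m * cmod (multilinear_form m n a x) \<le> \<tau> / \<kappa>"
      unfolding multilinear_form_scale using \<kappa>(2) by (simp add: norm_mult norm_power)
    then show "cmod (multilinear_form m n a x) \<le> \<tau> / \<kappa> ^ (m + 1)"
      using \<kappa>(2) by (simp add: field_simps)
  qed
qed

section \<open>Correlations between grid points\<close>

definition grid_vec :: "nat \<Rightarrow> nat \<Rightarrow> (nat \<Rightarrow> nat \<Rightarrow> nat) \<Rightarrow> (nat \<Rightarrow> nat) \<Rightarrow> complex" where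
  "grid_vec m L e i = (\<Prod>k\<in>{1..m}. grid_point L e k (i k))"

text \<open>Hence all evaluations at grid points are linear functionals with the same squared
  coefficient sum n^m and have a common tail.\<close>

lemma norm_grid_vec [simp]: "cmod (grid_vec m L e i) = 1"
  by (simp add: grid_vec_def grid_point_def prod_norm[symmetric])

lemma multilinear_form_grid_point:
  "multilinear_form m n a (grid_point L e) = (\<Sum>i\<in>multi_indices m n. grid_vec m L e i * a i)"
  by (simp add: multilinear_form_def grid_vec_def mult.commute)

lemma card_multi_indices: "card (multi_indices m n) = n ^ m"
  by (simp add: multi_indices_def card_PiE)

text \<open>With y = pi / (2 L) one has 1 - cos (pi / L) = 2 (sin y)^2. As y <= pi / 4, the mean
  value theorem gives sin y >= y / sqrt 2, and pi^2 >= 8 rounds the constant.\<close>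

lemma cos_pi_div_le:
  assumes "L \<ge> 2"
  shows "cos (pi / real L) \<le> 1 - 2 / (real L)\<^sup>2"
proof -
  define y where "y = pi / (2 * real L)"
  have "pi / (2 * real L) \<le> pi / 4" using assms by (intro divide_left_mono) auto
  then have y: "0 < y" "y \<le> pi / 4" using assms by (auto simp: y_def)
  obtain z where z: "0 < z" "z < y" "sin y - sin 0 = (y - 0) * cos z"
    using MVT2[of 0 y sin cos] y by auto
  have "sqrt 2 / 2 \<le> cos z"
    using cos_monotone_0_pi_le[of z "pi / 4"] z y by (simp add: cos_45)
  then have "y * (sqrt 2 / 2) \<le> sin y" using z y by simp
  then have "(y * (sqrt 2 / 2))\<^sup>2 \<le> (sin y)\<^sup>2" using y by (intro power_mono) auto
  then have "y\<^sup>2 \<le> 2 * (sin y)\<^sup>2" by (simp add: power_mult_distrib power_divide)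
  moreover have "cos (pi / real L) = 1 - 2 * (sin y)\<^sup>2"
    using cos_double_sin[of y] by (simp add: y_def)
  moreover have "2 / (real L)\<^sup>2 \<le> y\<^sup>2"
  proof -
    have "3 * 3 \<le> pi * pi" using pi_gt3 by (intro mult_mono) auto
    then have "8 \<le> pi\<^sup>2" by (simp add: power2_eq_square)
    then have "8 / (4 * (real L)\<^sup>2) \<le> pi\<^sup>2 / (4 * (real L)\<^sup>2)" by (intro divide_right_mono) auto
    then show ?thesis by (simp add: y_def power_divide power_mult_distrib)
  qed
  ultimately show ?thesis by linarith
qed

text \<open>The modulus is 2 |cos t| with t = pi d / L, and the condition on \<open>d\<close> keeps
  |t| at distance at least pi / L from both 0 and pi, where |cos| equals 1.\<close>

lemma norm_1_plus_root_of_unity_le: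
  assumes L: "L \<ge> 2" and d: "d \<noteq> 0" "\<bar>d\<bar> < int L"
  shows "cmod (1 + root_of_unity L (of_int d)) \<le> 2 - 4 / (real L)\<^sup>2"
proof -
  define t where "t = pi * of_int d / real L"
  have "1 + root_of_unity L (of_int d) = cis t * of_real (2 * cos t)"
  proof -
    have "cis t * of_real (2 * cos t) = cis t * (cis t + cis (- t))"
      by (simp add: complex_eq_iff)
    also have "\<dots> = cis (t + t) + 1" by (simp only: distrib_left cis_mult) simp
    finally show ?thesis by (simp add: root_of_unity_def t_def field_simps)
  qed
  then have "cmod (1 + root_of_unity L (of_int d)) = 2 * \<bar>cos t\<bar>"
    by (simp add: norm_mult)
  also have "\<bar>cos t\<bar> \<le> cos (pi / real L)"
  proof -
    define s where "s = \<bar>t\<bar>"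
    have c: "cos t = cos s" by (simp add: s_def)
    have s: "s = pi * \<bar>of_int d\<bar> / real L" by (simp add: s_def t_def abs_mult)
    have "1 \<le> \<bar>real_of_int d\<bar>" "\<bar>real_of_int d\<bar> \<le> real L - 1" using d by linarith+
    then have "pi * 1 / real L \<le> s" "s \<le> pi * (real L - 1) / real L"
      unfolding s by (intro divide_right_mono mult_left_mono; simp)+
    moreover have "pi * (real L - 1) / real L = pi - pi / real L"
      using L by (simp add: field_simps)
    ultimately have s2: "pi / real L \<le> s" "s \<le> pi - pi / real L" by auto
    have p: "0 \<le> pi / real L" by simp
    have "cos s \<le> cos (pi / real L)"
      by (rule cos_monotone_0_pi_le) (use s2 p in linarith)+
    moreover have "cos (pi - s) \<le> cos (pi / real L)"
      by (rule cos_monotone_0_pi_le) (use s2 p in linarith)+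
    ultimately show ?thesis unfolding c by (simp add: abs_le_iff)
  qed
  also have "2 * cos (pi / real L) \<le> 2 * (1 - 2 / (real L)\<^sup>2)"
    using cos_pi_div_le[OF L] by (intro mult_left_mono) auto
  finally show ?thesis by (simp add: algebra_simps)
qed

text \<open>The words agree at index 1 and differ at some \<open>j\<close>, so the terms at 1 and
  \<open>j\<close> cannot be aligned and their sum loses 4 / L^2; the other n - 2 terms are bounded
  trivially.\<close>

lemma phase_words_inner_le:
  assumes L: "L \<ge> 2" and n: "n \<ge> 1" and q: "q \<in> phase_words n L" "q' \<in> phase_words n L" "q \<noteq> q'"
  shows "cmod (\<Sum>j\<in>{1..n}. root_of_unity L (real (q j)) * cnj (root_of_unity L (real (q' j)))) \<le> real n - 4 / (real L)\<^sup>2"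
proof -
  have c: "root_of_unity L (real (q j)) * cnj (root_of_unity L (real (q' j))) = root_of_unity L (of_int (int (q j) - int (q' j)))" for j
    by (simp add: root_of_unity_def cis_cnj cis_mult algebra_simps diff_divide_distrib)
  obtain j where j: "j \<in> {1..n}" "q j \<noteq> q' j"
    using q unfolding phase_words_def by (metis PiE_ext)
  have one: "q 1 = 0" "q' 1 = 0" 
    using n PiE_mem[OF q(1)[unfolded phase_words_def], of 1] PiE_mem[OF q(2)[unfolded phase_words_def], of 1] by auto
  then have j1: "j \<noteq> 1" using j by auto
  have lt: "q j < L" "q' j < L" using q j j1 by (auto simp: phase_words_def PiE_iff split: if_splits)
  let ?f = "\<lambda>j. root_of_unity L (of_int (int (q j) - int (q' j)))"
  have "(\<Sum>j\<in>{1..n}. ?f j) = (?f 1 + ?f j) + (\<Sum>i\<in>{1..n} - {1, j}. ?f i)"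
  proof -
    have "(\<Sum>j\<in>{1..n}. ?f j) = (\<Sum>i\<in>{1, j}. ?f i) + (\<Sum>i\<in>{1..n} - {1, j}. ?f i)"
      using n j by (subst sum.subset_diff[of "{1, j}"]) (auto simp: add.commute)
    then show ?thesis using j1 by simp
  qed
  then have "cmod (\<Sum>j\<in>{1..n}. ?f j) \<le> cmod (?f 1 + ?f j) + cmod (\<Sum>i\<in>{1..n} - {1, j}. ?f i)"
    by (simp only: norm_triangle_ineq)
  also have "cmod (?f 1 + ?f j) \<le> 2 - 4 / (real L)\<^sup>2"
  proof -
    have "?f 1 = 1" unfolding one by (simp add: root_of_unity_def)
    moreover have "cmod (1 + ?f j) \<le> 2 - 4 / (real L)\<^sup>2"
      using j lt by (intro norm_1_plus_root_of_unity_le L) auto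
    ultimately show ?thesis by simp
  qed
  also have "cmod (\<Sum>i\<in>{1..n} - {1, j}. ?f i) \<le> (\<Sum>i\<in>{1..n} - {1, j}. 1)"
    by (rule sum_norm_le) simp
  also have "(\<Sum>i\<in>{1..n} - {1, j}. 1) = real n - 2"
  proof -
    have "card ({1..n} - {1, j}) = card {1..n} - card {1, j}"
      using j n by (intro card_Diff_subset) auto
    moreover have "n \<ge> 2" using j j1 by auto
    ultimately show ?thesis using j1 by (simp add: of_nat_diff)
  qed
  finally show ?thesis by (simp add: c)
qed

text \<open>The inner product of tensor products factors over the m positions. Each position with
  different words contributes at most n (1 - 4 / (n L^2)), estimated by an exponential.\<close>

lemma grid_vec_inner_le:
  assumes L: "L \<ge> 2" and n: "n \<ge> 1" and e: "e \<in> phase_grid m n L" "e' \<in> phase_grid m n L"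
  shows "cmod (\<Sum>i\<in>multi_indices m n. grid_vec m L e i * cnj (grid_vec m L e' i))
    \<le> real n ^ m * exp (- 4 * real (card {k\<in>{1..m}. e k \<noteq> e' k}) / (real n * (real L)\<^sup>2))"
proof -
  let ?S = "\<lambda>k. \<Sum>j\<in>{1..n}. grid_point L e k j * cnj (grid_point L e' k j)"
  let ?c = "- 4 / (real n * (real L)\<^sup>2)"
  have "(\<Sum>i\<in>multi_indices m n. grid_vec m L e i * cnj (grid_vec m L e' i)) = (\<Prod>k\<in>{1..m}. ?S k)"
    unfolding multi_indices_def grid_vec_def
    by (subst prod_sum_PiE) (auto simp: prod.distrib)
  then have "cmod (\<Sum>i\<in>multi_indices m n. grid_vec m L e i * cnj (grid_vec m L e' i)) = (\<Prod>k\<in>{1..m}. cmod (?S k))"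
    by (simp add: prod_norm)
  also have "\<dots> \<le> (\<Prod>k\<in>{1..m}. real n * exp (if e k \<noteq> e' k then ?c else 0))"
  proof (intro prod_mono conjI norm_ge_zero)
    fix k assume k: "k \<in> {1..m}"
    show "cmod (?S k) \<le> real n * exp (if e k \<noteq> e' k then ?c else 0)"
    proof (cases "e k = e' k")
      case True
      have "cmod (?S k) \<le> (\<Sum>j\<in>{1..n}. 1)"
        by (rule sum_norm_le) (simp add: norm_mult grid_point_def)
      then show ?thesis using True by simp
    next
      case False
      have "cmod (?S k) \<le> real n - 4 / (real L)\<^sup>2"
        unfolding grid_point_def
        by (rule phase_words_inner_le[OF L n _ _ False]) (use e k in \<open>auto simp: phase_grid_def PiE_iff\<close>)
      also have "\<dots> = real n * (1 + ?c)" using n L by (simp add: field_simps)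
      also have "\<dots> \<le> real n * exp ?c" by (intro mult_left_mono exp_ge_add_one_self) auto
      finally show ?thesis using False by simp
    qed
  qed
  also have "\<dots> = real n ^ m * exp (\<Sum>k\<in>{1..m}. if e k \<noteq> e' k then ?c else 0)"
    by (simp add: prod.distrib exp_sum)
  also have "(\<Sum>k\<in>{1..m}. if e k \<noteq> e' k then ?c else 0) = ?c * card {k\<in>{1..m}. e k \<noteq> e' k}"
    by (simp add: sum.inter_filter[symmetric])
  finally show ?thesis by (simp add: mult.commute)
qed

text \<open>A union over the set of differing positions, at most 2^m in number, with at most
  \<open>d\<close> free words each. The crude 2^m is absorbed later by a surplus of order m log
  m.\<close>

lemma card_phase_grid_close_le:
  assumes n: "n \<ge> 1" and L: "L \<ge> 1" and e: "e \<in> phase_grid m n L"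
  shows "card {e' \<in> phase_grid m n L. card {k\<in>{1..m}. e k \<noteq> e' k} \<le> d} \<le> 2 ^ m * (L ^ (n - 1)) ^ d"
proof -
  let ?q = "L ^ (n - 1)"
  define \<A> where "\<A> = {A. A \<subseteq> {1..m} \<and> card A \<le> d}"
  define B where "B A = (\<Pi>\<^sub>E k\<in>{1..m}. if k \<in> A then phase_words n L else {e k})" for A
  have finA: "finite \<A>" unfolding \<A>_def by (rule finite_subset[of _ "Pow {1..m}"]) auto
  have finB: "finite (B A)" for A unfolding B_def by (intro finite_PiE) auto
  have "{e' \<in> phase_grid m n L. card {k\<in>{1..m}. e k \<noteq> e' k} \<le> d} \<subseteq> (\<Union>A\<in>\<A>. B A)"
  proof
    fix e' assume e': "e' \<in> {e' \<in> phase_grid m n L. card {k\<in>{1..m}. e k \<noteq> e' k} \<le> d}"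
    then have "e' \<in> B {k\<in>{1..m}. e k \<noteq> e' k}"
      by (auto simp: B_def phase_grid_def PiE_iff)
    moreover have "{k\<in>{1..m}. e k \<noteq> e' k} \<in> \<A>" using e' by (auto simp: \<A>_def)
    ultimately show "e' \<in> (\<Union>A\<in>\<A>. B A)" by blast
  qed
  then have "card {e' \<in> phase_grid m n L. card {k\<in>{1..m}. e k \<noteq> e' k} \<le> d} \<le> card (\<Union>A\<in>\<A>. B A)"
    by (intro card_mono) (use finA finB in auto)
  also have "\<dots> \<le> (\<Sum>A\<in>\<A>. card (B A))" by (rule card_UN_le[OF finA])
  also have "\<dots> \<le> (\<Sum>A\<in>\<A>. ?q ^ d)"
  proof (rule sum_mono)
    fix A assume A: "A \<in> \<A>"
    have "card (B A) = (\<Prod>k\<in>{1..m}. if k \<in> A then ?q else 1)"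
      unfolding B_def using n by (subst card_PiE) (auto intro!: prod.cong simp: card_phase_words)
    also have "\<dots> = ?q ^ card {k\<in>{1..m}. k \<in> A}"
      by (simp add: prod.inter_filter[symmetric])
    also have "{k\<in>{1..m}. k \<in> A} = A" using A by (auto simp: \<A>_def)
    also have "?q ^ card A \<le> ?q ^ d" using A L by (intro power_increasing) (auto simp: \<A>_def)
    finally show "card (B A) \<le> ?q ^ d" .
  qed
  also have "\<dots> = card \<A> * ?q ^ d" by simp
  also have "card \<A> \<le> card (Pow {1..m})" by (intro card_mono) (auto simp: \<A>_def)
  then have "card \<A> * ?q ^ d \<le> 2 ^ m * ?q ^ d" by (simp add: card_Pow)
  finally show ?thesis .
qed

section \<open>Lower bounds, Lipschitz dependence and homogeneity of the norm\<close>

lemma grid_point_sup_norm: "n \<ge> 1 \<Longrightarrow> sup_norm n (grid_point L e k) \<le> 1"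
  by (simp add: sup_norm_le_iff grid_point_def)

lemma form_norm_ge:
  assumes "n \<ge> 1" "\<And>k. k \<in> {1..m} \<Longrightarrow> sup_norm n (x k) \<le> 1"
  shows "cmod (multilinear_form m n a x) \<le> form_norm m n a"
  unfolding form_norm_def using assms
  by (intro cSUP_upper bdd_above_multilinear_form) auto

lemma form_norm_ge_grid:
  assumes "n \<ge> 1"
  shows "Re (\<Sum>i\<in>multi_indices m n. grid_vec m L e i * a i) \<le> form_norm m n a"
  using form_norm_ge[OF assms, of m "grid_point L e" a, OF grid_point_sup_norm[OF assms]]
    complex_Re_le_cmod[of "\<Sum>i\<in>multi_indices m n. grid_vec m L e i * a i"]
  unfolding multilinear_form_grid_point by linarith

text \<open>Changing one coefficient alters the form by the change times a product of entries of
  modulus at most 1; this is the bounded influence that Efron--Stein requires.\<close>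

lemma form_norm_diff_le:
  assumes n: "n \<ge> 1" and i: "i \<in> multi_indices m n" and ab: "\<And>l. l \<in> multi_indices m n \<Longrightarrow> l \<noteq> i \<Longrightarrow> a l = b l"
  shows "form_norm m n a \<le> form_norm m n b + cmod (a i - b i)"
proof (rule form_norm_leI[OF n])
  fix x assume x: "\<And>k. k \<in> {1..m} \<Longrightarrow> sup_norm n (x k) \<le> 1"
  have "(\<Sum>l\<in>multi_indices m n. (a l - b l) * (\<Prod>k\<in>{1..m}. x k (l k)))
     = (\<Sum>l\<in>{i}. (a l - b l) * (\<Prod>k\<in>{1..m}. x k (l k)))"
    using i ab by (intro sum.mono_neutral_right) (auto simp: multi_indices_finite)
  then have "multilinear_form m n a x = multilinear_form m n b x + (a i - b i) * (\<Prod>k\<in>{1..m}. x k (i k))"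
    by (simp add: multilinear_form_def algebra_simps sum_subtractf)
  then have "cmod (multilinear_form m n a x) \<le> cmod (multilinear_form m n b x) + cmod (a i - b i) * (\<Prod>k\<in>{1..m}. cmod (x k (i k)))"
    using norm_triangle_ineq[of "multilinear_form m n b x" "(a i - b i) * (\<Prod>k\<in>{1..m}. x k (i k))"]
    by (simp add: norm_mult prod_norm)
  also have "(\<Prod>k\<in>{1..m}. cmod (x k (i k))) \<le> 1"
    by (rule prod_le_1) (use i n x in \<open>auto simp: multi_indices_def PiE_iff sup_norm_le_iff\<close>)
  then have "cmod (a i - b i) * (\<Prod>k\<in>{1..m}. cmod (x k (i k))) \<le> cmod (a i - b i)"
    by (rule mult_left_le) simp
  also have "cmod (multilinear_form m n b x) \<le> form_norm m n b"
    by (rule form_norm_ge[OF n x])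
  finally show "cmod (multilinear_form m n a x) \<le> form_norm m n b + cmod (a i - b i)" by simp
qed

lemma form_norm_scale_vec:
  assumes n: "n \<ge> 1" and r: "r > 0"
  shows "form_norm m n (scale_vec (multi_indices m n) r a) = r * form_norm m n a"
proof -
  have e: "multilinear_form m n (scale_vec (multi_indices m n) r a) x = of_real r * multilinear_form m n a x" for a x
    by (simp add: multilinear_form_def scale_vec_def sum_distrib_left mult.assoc)
  have "form_norm m n (scale_vec (multi_indices m n) r a) \<le> r * form_norm m n a"
  proof (rule form_norm_leI[OF n])
    fix x assume "\<And>k. k \<in> {1..m} \<Longrightarrow> sup_norm n (x k) \<le> 1"
    from form_norm_ge[of n m x a, OF n this]
    show "cmod (multilinear_form m n (scale_vec (multi_indices m n) r a) x) \<le> r * form_norm m n a"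
      using r by (simp add: e norm_mult)
  qed
  moreover have "form_norm m n a \<le> form_norm m n (scale_vec (multi_indices m n) r a) / r"
  proof (rule form_norm_leI[OF n])
    fix x assume x: "\<And>k. k \<in> {1..m} \<Longrightarrow> sup_norm n (x k) \<le> 1"
    have "r * cmod (multilinear_form m n a x) \<le> form_norm m n (scale_vec (multi_indices m n) r a)"
      using form_norm_ge[of n m x "scale_vec (multi_indices m n) r a", OF n x] r by (simp add: e norm_mult)
    then show "cmod (multilinear_form m n a x) \<le> form_norm m n (scale_vec (multi_indices m n) r a) / r"
      using r by (simp add: field_simps)
  qed
  ultimately show ?thesis using r by (simp add: field_simps)
qed

lemma ratio_ML_scale_vec:
  assumes n: "n \<ge> 1" and r: "r > 0" and m: "m \<ge> 1"
  shows "ratio_ML m n (scale_vec (multi_indices m n) r a) = ratio_ML m n a"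
proof -
  let ?q = "bh_exponent m"
  have q: "?q > 0" using m by (simp add: bh_exponent_def)
  have "(\<Sum>i\<in>multi_indices m n. cmod (scale_vec (multi_indices m n) r a i) powr ?q)
      = r powr ?q * (\<Sum>i\<in>multi_indices m n. cmod (a i) powr ?q)"
    using r by (simp add: scale_vec_def norm_mult powr_mult sum_distrib_left)
  then have "(\<Sum>i\<in>multi_indices m n. cmod (scale_vec (multi_indices m n) r a i) powr ?q) powr (1 / ?q)
      = r * (\<Sum>i\<in>multi_indices m n. cmod (a i) powr ?q) powr (1 / ?q)"
    using r q by (simp add: powr_mult powr_powr sum_nonneg)
  then show ?thesis
    unfolding ratio_ML_def form_norm_scale_vec[OF n r] using r by simp
qed

subsection \<open>Probability bounds for the norm\<close>

lemma form_norm_measurable [measurable]: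
  "n \<ge> 1 \<Longrightarrow> form_norm m n \<in> borel_measurable (gauss_vec (multi_indices m n))"
  using measurable_form_norm[of n m] by (simp cong: measurable_cong_sets add: sets_gauss_vec)

text \<open>Setting a coefficient to 0 moves the norm by at most its modulus, whose second moment is
  1. So the supremum fluctuates on the scale of a single value of the form, far below its own
  size.\<close>

lemma form_norm_variance_le:
  assumes n: "n \<ge> 1"
  shows "integrable (gauss_vec (multi_indices m n)) (\<lambda>a. (form_norm m n a)\<^sup>2)"
    and "(LINT a|gauss_vec (multi_indices m n). (form_norm m n a - (LINT b|gauss_vec (multi_indices m n). form_norm m n b))\<^sup>2)
      \<le> real n ^ m"
proof -
  have "\<bar>form_norm m n a - form_norm m n (a(i := 0))\<bar> \<le> cmod (a i)" if "i \<in> multi_indices m n" for a i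
    using form_norm_diff_le[OF n that, of a "a(i := 0)"] form_norm_diff_le[OF n that, of "a(i := 0)" a] by auto
  then have "integrable (gauss_vec (multi_indices m n)) (\<lambda>a. (form_norm m n a)\<^sup>2) \<and>
    (LINT a|gauss_vec (multi_indices m n). (form_norm m n a - (LINT b|gauss_vec (multi_indices m n). form_norm m n b))\<^sup>2)
      \<le> card (multi_indices m n) * (LINT z|cgauss. (cmod z)\<^sup>2)"
    unfolding gauss_vec_def using form_norm_measurable[OF n, of m]
    by (intro Efron_Stein[where ?z0.0=0] prob_space_cgauss integrable_cgauss_norm_sq multi_indices_finite)
      (auto simp: gauss_vec_def)
  then show "integrable (gauss_vec (multi_indices m n)) (\<lambda>a. (form_norm m n a)\<^sup>2)"
    "(LINT a|gauss_vec (multi_indices m n). (form_norm m n a - (LINT b|gauss_vec (multi_indices m n). form_norm m n b))\<^sup>2)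
      \<le> real n ^ m"
    by (auto simp: card_multi_indices integral_cgauss_norm_sq)
qed

section \<open>Laws of large numbers for the coefficients\<close>

lemma gauss_vec_component:
  fixes f :: "complex \<Rightarrow> real"
  assumes "i \<in> I" and [measurable]: "f \<in> borel_measurable borel"
  shows "integrable (gauss_vec I) (\<lambda>a. f (a i)) \<longleftrightarrow> integrable cgauss f"
    and "(LINT a|gauss_vec I. f (a i)) = (LINT z|cgauss. f z)"
proof -
  have d: "distr (gauss_vec I) cgauss (\<lambda>a. a i) = cgauss"
    unfolding gauss_vec_def using assms(1) by (intro distr_PiM_component prob_space_cgauss)
  have [measurable]: "(\<lambda>a. a i) \<in> gauss_vec I \<rightarrow>\<^sub>M cgauss"
    unfolding gauss_vec_def using assms(1) by measurable
  show "integrable (gauss_vec I) (\<lambda>a. f (a i)) \<longleftrightarrow> integrable cgauss f"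
    using integrable_distr_eq[of "\<lambda>a. a i" "gauss_vec I" cgauss f] unfolding d by simp
  show "(LINT a|gauss_vec I. f (a i)) = (LINT z|cgauss. f z)"
    using integral_distr[of "\<lambda>a. a i" "gauss_vec I" cgauss f] unfolding d by simp
qed

text \<open>Efron--Stein with influence |z|^2 bounds the variance by 3 times the number of
  coordinates, the 3 being the fourth moment bound; Chebyshev does the rest.\<close>

lemma sum_norm_sq_concentration:
  fixes \<delta> :: real
  assumes I: "finite I" "I \<noteq> {}" and \<delta>: "\<delta> > 0"
  shows "measure (gauss_vec I) {a \<in> space (gauss_vec I). \<delta> * card I \<le> \<bar>(\<Sum>i\<in>I. (cmod (a i))\<^sup>2) - card I\<bar>}
    \<le> 3 / (\<delta>\<^sup>2 * card I)"
proof -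
  interpret G: prob_space "gauss_vec I" by (rule prob_space_gauss_vec)
  let ?f = "\<lambda>a. \<Sum>i\<in>I. (cmod (a i))\<^sup>2"
  have N: "real (card I) > 0" using I by (simp add: card_gt_0_iff)
  have m [measurable]: "?f \<in> borel_measurable (gauss_vec I)" by measurable
  have "integrable (gauss_vec I) (\<lambda>a. (?f a)\<^sup>2) \<and>
    (LINT a|gauss_vec I. (?f a - (LINT b|gauss_vec I. ?f b))\<^sup>2) \<le> card I * (LINT z|cgauss. ((cmod z)\<^sup>2)\<^sup>2)"
    unfolding gauss_vec_def
  proof (rule Efron_Stein[where ?z0.0=0])
    show "integrable cgauss (\<lambda>z. ((cmod z)\<^sup>2)\<^sup>2)" using integrable_cgauss_norm_4 by simp
    fix a :: "'a \<Rightarrow> complex" and i assume i: "i \<in> I"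
    have "?f a - ?f (a(i := 0)) = (cmod (a i))\<^sup>2"
      using i I by (simp add: sum.remove[of I i])
    then show "\<bar>?f a - ?f (a(i := 0))\<bar> \<le> (cmod (a i))\<^sup>2" by simp
  qed (use I m in \<open>auto simp: gauss_vec_def intro: prob_space_cgauss\<close>)
  then have sq: "integrable (gauss_vec I) (\<lambda>a. (?f a)\<^sup>2)"
    and var: "(LINT a|gauss_vec I. (?f a - (LINT b|gauss_vec I. ?f b))\<^sup>2) \<le> card I * 3"
    using mult_left_mono[OF integral_cgauss_norm_4, of "real (card I)"] by auto
  have mean: "(LINT b|gauss_vec I. ?f b) = card I"
    using gauss_vec_component[of _ I "\<lambda>z. (cmod z)\<^sup>2"]
    by (subst Bochner_Integration.integral_sum) (auto simp: integrable_cgauss_norm_sq integral_cgauss_norm_sq)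
  have "measure (gauss_vec I) {a \<in> space (gauss_vec I). \<delta> * card I \<le> \<bar>?f a - (LINT b|gauss_vec I. ?f b)\<bar>}
      \<le> (LINT a|gauss_vec I. (?f a - (LINT b|gauss_vec I. ?f b))\<^sup>2) / (\<delta> * card I)\<^sup>2"
    using \<delta> N by (intro G.Chebyshev_inequality m sq) auto
  also have "\<dots> \<le> card I * 3 / (\<delta> * card I)\<^sup>2"
    by (intro divide_right_mono var) auto
  also have "\<dots> = 3 / (\<delta>\<^sup>2 * card I)"
    using N by (simp add: power2_eq_square)
  finally show ?thesis by (simp add: mean)
qed

text \<open>Markov's inequality. Fourth powers control the error made by an exponent slightly below
  2.\<close>

lemma sum_norm_4_tail:
  fixes c :: real
  assumes I: "finite I" "I \<noteq> {}" and c: "c > 0"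
  shows "measure (gauss_vec I) {a \<in> space (gauss_vec I). c * card I \<le> (\<Sum>i\<in>I. cmod (a i) ^ 4)} \<le> 3 / c"
proof -
  interpret G: prob_space "gauss_vec I" by (rule prob_space_gauss_vec)
  have N: "real (card I) > 0" using I by (simp add: card_gt_0_iff)
  let ?f = "\<lambda>a. \<Sum>i\<in>I. cmod (a i) ^ 4"
  have int: "integrable (gauss_vec I) ?f"
    using gauss_vec_component(1)[of _ I "\<lambda>z. cmod z ^ 4"] integrable_cgauss_norm_4
    by (intro Bochner_Integration.integrable_sum) auto
  have "(LINT a|gauss_vec I. ?f a) = (\<Sum>i\<in>I. (LINT z|cgauss. cmod z ^ 4))"
    using gauss_vec_component[of _ I "\<lambda>z. cmod z ^ 4"] integrable_cgauss_norm_4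
    by (subst Bochner_Integration.integral_sum) auto
  also have "\<dots> \<le> 3 * card I"
    using integral_cgauss_norm_4 by (simp add: mult.commute mult_left_mono)
  finally have mean: "(LINT a|gauss_vec I. ?f a) \<le> 3 * card I" .
  have "measure (gauss_vec I) {a \<in> space (gauss_vec I). c * card I \<le> ?f a} \<le> (LINT a|gauss_vec I. ?f a) / (c * card I)"
    using c N int by (intro integral_Markov_inequality_measure[where A="space (gauss_vec I)", simplified]) (auto intro!: sum_nonneg)
  also have "\<dots> \<le> 3 * card I / (c * card I)"
    using c N by (intro divide_right_mono mean) auto
  finally show ?thesis using N by simp
qed

text \<open>A union bound over the grid and over \<open>L\<close> rotations, which turn the modulus
  into real parts. Each of these has tail at most exp(-s), because the standardized threshold is
  sqrt (2 s).\<close>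

lemma form_norm_upper_tail:
  assumes n: "n \<ge> 1" and L: "L > 0" and \<kappa>: "\<kappa> = 1 - (pi / L)\<^sup>2 / 2" "\<kappa> > 0" and s: "s \<ge> 1"
  shows "measure (gauss_vec (multi_indices m n)) {a \<in> space (gauss_vec (multi_indices m n)).
      sqrt (s * real n ^ m) / \<kappa> ^ (m + 1) < form_norm m n a}
    \<le> real L * (real L ^ (n - 1)) ^ m * exp (- s)"
proof -
  define I where "I = multi_indices m n"
  interpret G: prob_space "gauss_vec I" by (rule prob_space_gauss_vec)
  define \<tau> where "\<tau> = sqrt (s * real n ^ m)"
  have I: "finite I" by (simp add: I_def multi_indices_finite)
  define E where "E p = {a \<in> space (gauss_vec I). \<tau> < Re (\<Sum>i\<in>I. (root_of_unity L (real (snd p)) * grid_vec m L (fst p) i) * a i)}" for p :: "(nat \<Rightarrow> nat \<Rightarrow> nat) \<times> nat"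
  define Q where "Q = phase_grid m n L \<times> {..<L}"
  have Em [measurable]: "E p \<in> sets (gauss_vec I)" for p unfolding E_def by measurable
  have pE: "measure (gauss_vec I) (E p) \<le> exp (- s)" for p
  proof -
    have N: "0 < real n ^ m" using n by simp
    have "measure (gauss_vec I) (E p) = measure std_normal_distribution {sqrt (2 / real n ^ m) * \<tau><..}"
      unfolding E_def using n
      by (intro gauss_vec_linear_tail[OF I]) (auto simp: norm_mult I_def card_multi_indices)
    also have "sqrt (2 / real n ^ m) * \<tau> = sqrt (2 * s)"
      unfolding \<tau>_def real_sqrt_mult[symmetric] using N by (auto simp: field_simps)
    also have "measure std_normal_distribution {sqrt (2 * s)<..} \<le> exp (- (sqrt (2 * s))\<^sup>2 / 2) / sqrt (2 * s)"
      using s by (intro measure_std_normal_upper) auto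
    also have "\<dots> \<le> exp (- (sqrt (2 * s))\<^sup>2 / 2) / 1"
      using s by (intro divide_left_mono) auto
    also have "\<dots> = exp (- s)" using s by simp
    finally show ?thesis .
  qed
  have "{a \<in> space (gauss_vec I). \<tau> / \<kappa> ^ (m + 1) < form_norm m n a} \<subseteq> (\<Union>p\<in>Q. E p)"
  proof (rule subsetI, rule ccontr)
    fix a assume a: "a \<in> {a \<in> space (gauss_vec I). \<tau> / \<kappa> ^ (m + 1) < form_norm m n a}" and na: "a \<notin> (\<Union>p\<in>Q. E p)"
    have "form_norm m n a \<le> \<tau> / \<kappa> ^ (m + 1)"
    proof (rule form_norm_le_grid[OF n L \<kappa>])
      fix e r assume "e \<in> phase_grid m n L" "r < L"
      then have "a \<notin> E (e, r)" using na by (auto simp: Q_def)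
      then show "Re (root_of_unity L (real r) * multilinear_form m n a (grid_point L e)) \<le> \<tau>"
        using a by (simp add: E_def multilinear_form_grid_point I_def sum_distrib_left mult.assoc)
    qed
    with a show False by simp
  qed
  then have "measure (gauss_vec I) {a \<in> space (gauss_vec I). \<tau> / \<kappa> ^ (m + 1) < form_norm m n a}
      \<le> measure (gauss_vec I) (\<Union>p\<in>Q. E p)"
    by (intro G.finite_measure_mono) (auto simp: Q_def intro!: sets.finite_UN)
  also have "\<dots> \<le> (\<Sum>p\<in>Q. measure (gauss_vec I) (E p))"
    by (intro G.finite_measure_subadditive_finite) (auto simp: Q_def)
  also have "\<dots> \<le> (\<Sum>p\<in>Q. exp (- s))" by (intro sum_mono pE)
  also have "\<dots> = real L * (real L ^ (n - 1)) ^ m * exp (- s)"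
    by (simp add: Q_def card_cartesian_product card_phase_grid[OF n])
  finally show ?thesis unfolding I_def \<tau>_def .
qed

text \<open>The elementary inequality \<open>2 \<lambda> z - (\<lambda> z)\<^sup>2 \<le> 1\<close> for the number \<open>z\<close> of events that
  occur replaces the Cauchy--Schwarz inequality in the second moment method.\<close>

lemma (in prob_space) second_moment_union:
  assumes P: "finite P" and E: "\<And>x. x \<in> P \<Longrightarrow> E x \<in> events"
  shows "2 * c * (\<Sum>x\<in>P. prob (E x)) - c\<^sup>2 * (\<Sum>x\<in>P. \<Sum>y\<in>P. prob (E x \<inter> E y)) \<le> prob (\<Union>x\<in>P. E x)"
proof -
  let ?Z = "\<lambda>w. \<Sum>x\<in>P. indicator (E x) w :: real"
  have sq: "(?Z w)\<^sup>2 = (\<Sum>x\<in>P. \<Sum>y\<in>P. indicator (E x \<inter> E y) w)" for w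
    by (simp add: power2_eq_square sum_product indicator_inter_arith)
  have U: "(\<Union>x\<in>P. E x) \<in> events" using P E by (intro sets.finite_UN) auto
  have "2 * c * (\<Sum>x\<in>P. prob (E x)) - c\<^sup>2 * (\<Sum>x\<in>P. \<Sum>y\<in>P. prob (E x \<inter> E y))
      = (LINT w|M. 2 * c * ?Z w - c\<^sup>2 * (\<Sum>x\<in>P. \<Sum>y\<in>P. indicator (E x \<inter> E y) w))"
    using E P by (simp add: Bochner_Integration.integral_diff Bochner_Integration.integral_sum Bochner_Integration.integrable_sum
      emeasure_eq_measure sets.Int)
  also have "\<dots> \<le> (LINT w|M. indicator (\<Union>x\<in>P. E x) w)"
  proof (rule integral_mono)
    fix w
    show "2 * c * ?Z w - c\<^sup>2 * (\<Sum>x\<in>P. \<Sum>y\<in>P. indicator (E x \<inter> E y) w) \<le> indicator (\<Union>x\<in>P. E x) w"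
    proof (cases "w \<in> (\<Union>x\<in>P. E x)")
      case True
      have "0 \<le> (c * ?Z w - 1)\<^sup>2" by simp
      then show ?thesis using True unfolding sq[symmetric] by (simp add: power2_eq_square algebra_simps)
    next
      case False
      then have "?Z w = 0" by (intro sum.neutral) auto
      then show ?thesis unfolding sq[symmetric] using False by simp
    qed
  qed (use E P U in \<open>auto simp: emeasure_eq_measure intro!: Bochner_Integration.integrable_diff Bochner_Integration.integrable_sum integrable_mult_right\<close>)
  also have "\<dots> = prob (\<Union>x\<in>P. E x)" using U by simp
  finally show ?thesis .
qed

definition tail_const :: real where
  "tail_const = exp (- 3 / 2) / sqrt (2 * pi)"

lemma tail_const_pos: "tail_const > 0"
  by (simp add: tail_const_def)

lemma tail_const_le_1: "tail_const \<le> 1"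
proof -
  have "1 \<le> sqrt (2 * pi)" using pi_gt3 by (simp add: real_le_rsqrt)
  then have "exp (- 3 / 2) \<le> sqrt (2 * pi)" by (rule order_trans[rotated]) simp
  then have "exp (- 3 / 2) / sqrt (2 * pi) \<le> 1" by (subst divide_le_eq_1_pos) auto
  then show ?thesis by (simp only: tail_const_def)
qed

text \<open>If two real variables both exceed a threshold, then their sum exceeds twice the threshold. Thus
  one-dimensional normal tails suffice, at the cost of a factor \<open>\<surd>s\<close> compared to independence.\<close>

lemma joint_tail_le:
  assumes n: "n \<ge> 1" and s: "s \<ge> 1"
    and \<rho>: "cmod (\<Sum>i\<in>multi_indices m n. u i * cnj (v i)) \<le> real n ^ m * \<rho>" "s * \<rho> \<le> 1 / 2" "\<rho> \<ge> 0"
    and u: "\<And>i. cmod (u i) = 1" and v: "\<And>i. cmod (v i) = 1"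
  shows "measure (gauss_vec (multi_indices m n)) {a \<in> space (gauss_vec (multi_indices m n)).
      sqrt (s * real n ^ m) < Re (\<Sum>i\<in>multi_indices m n. u i * a i) \<and>
      sqrt (s * real n ^ m) < Re (\<Sum>i\<in>multi_indices m n. v i * a i)}
    \<le> exp (1 - 2 * s) / sqrt (2 * s)"
proof -
  define I where "I = multi_indices m n"
  define N where "N = real n ^ m"
  interpret G: prob_space "gauss_vec I" by (rule prob_space_gauss_vec)
  have I: "finite I" by (simp add: I_def multi_indices_finite)
  have N: "N > 0" using n by (simp add: N_def)
  define R where "R = Re (\<Sum>i\<in>I. u i * cnj (v i))"
  have "\<bar>R\<bar> \<le> N * \<rho>" using \<rho>(1) abs_Re_le_cmod[of "\<Sum>i\<in>I. u i * cnj (v i)"] unfolding R_def I_def N_def by linarith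
  define S where "S = (\<Sum>i\<in>I. (cmod (u i + v i))\<^sup>2)"
  have "S = (\<Sum>i\<in>I. 2 + 2 * Re (u i * cnj (v i)))"
    unfolding S_def
  proof (intro sum.cong refl)
    fix i
    have "(cmod (u i + v i))\<^sup>2 = (cmod (u i))\<^sup>2 + (cmod (v i))\<^sup>2 + 2 * Re (u i * cnj (v i))"
      unfolding cmod_power2 by (simp add: power2_eq_square algebra_simps)
    then show "(cmod (u i + v i))\<^sup>2 = 2 + 2 * Re (u i * cnj (v i))" by (simp add: u v)
  qed
  also have "\<dots> = 2 * real (card I) + 2 * R"
    by (simp only: sum.distrib sum_distrib_left[symmetric] R_def Re_sum) simp
  also have "real (card I) = N" by (simp add: I_def N_def card_multi_indices)
  finally have S: "S = 2 * N + 2 * R" .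
  have "1 * \<rho> \<le> s * \<rho>" using s \<rho>(3) by (intro mult_right_mono) auto
  then have \<rho>': "\<rho> \<le> 1 / 2" using \<rho>(2) by linarith
  have "N * \<rho> \<le> N * (1 / 2)" using N \<rho>' by (intro mult_left_mono) auto
  then have "0 < S" using \<open>\<bar>R\<bar> \<le> N * \<rho>\<close> N unfolding S by linarith
  moreover have "S \<le> 2 * N * (1 + \<rho>)"
    using \<open>\<bar>R\<bar> \<le> N * \<rho>\<close> unfolding S by (simp add: algebra_simps)
  ultimately have Sb: "0 < S" "S \<le> 2 * N * (1 + \<rho>)" by blast+
  \<comment> \<open>The standardized threshold of the sum. For nearly orthogonal vectors S is close
    to 2 N and t^2 close to 4 s; the bound 4 s (1 - rho) comes from (1 - rho) (1 + rho) <=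
    1.\<close>
  define t where "t = sqrt (2 / S) * (2 * sqrt (s * N))"
  have t2_eq: "t\<^sup>2 = 8 * s * N / S"
    using Sb(1) N s by (simp add: t_def power_mult_distrib)
  have "4 * s * (1 - \<rho>) * S \<le> 4 * s * (1 - \<rho>) * (2 * N * (1 + \<rho>))"
    using Sb(2) s \<rho>' by (intro mult_left_mono) auto
  moreover have "4 * s * (1 - \<rho>) * (2 * N * (1 + \<rho>)) = 8 * s * N * (1 - \<rho>\<^sup>2)"
    by (simp add: power2_eq_square algebra_simps)
  moreover have "8 * s * N * (1 - \<rho>\<^sup>2) \<le> 8 * s * N * 1"
    using N s by (intro mult_left_mono) auto
  ultimately have "4 * s * (1 - \<rho>) * S \<le> 8 * s * N" by linarith
  then have t2: "4 * s * (1 - \<rho>) \<le> t\<^sup>2"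
    unfolding t2_eq using Sb(1) by (simp only: pos_le_divide_eq)
  have "4 * s * (1 / 2) \<le> 4 * s * (1 - \<rho>)" using s \<rho>' by (intro mult_left_mono) auto
  then have "2 * s \<le> t\<^sup>2" using t2 by linarith
  moreover have "t \<ge> 0" using Sb(1) N s by (simp add: t_def)
  ultimately have t: "sqrt (2 * s) \<le> t" by (intro real_le_lsqrt)
  have tpos: "t > 0" using t s by (smt (verit) real_sqrt_gt_zero)
  have "{a \<in> space (gauss_vec I). sqrt (s * N) < Re (\<Sum>i\<in>I. u i * a i) \<and> sqrt (s * N) < Re (\<Sum>i\<in>I. v i * a i)}
      \<subseteq> {a \<in> space (gauss_vec I). 2 * sqrt (s * N) < Re (\<Sum>i\<in>I. (u i + v i) * a i)}"
    by (auto simp: distrib_right sum.distrib)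
  then have "measure (gauss_vec I) {a \<in> space (gauss_vec I). sqrt (s * N) < Re (\<Sum>i\<in>I. u i * a i) \<and> sqrt (s * N) < Re (\<Sum>i\<in>I. v i * a i)}
      \<le> measure (gauss_vec I) {a \<in> space (gauss_vec I). 2 * sqrt (s * N) < Re (\<Sum>i\<in>I. (u i + v i) * a i)}"
    by (intro G.finite_measure_mono) measurable
  also have "\<dots> = measure std_normal_distribution {t<..}"
    unfolding t_def by (rule gauss_vec_linear_tail[OF I S_def Sb(1)])
  also have "\<dots> \<le> exp (- t\<^sup>2 / 2) / t" by (rule measure_std_normal_upper[OF tpos])
  also have "\<dots> \<le> exp (1 - 2 * s) / sqrt (2 * s)"
  proof (rule frac_le)
    \<comment> \<open>The correlation changes the exponent by 2 s rho <= 1, so it costs only a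
      factor e.\<close>
    have "4 * s * (1 - \<rho>) = 4 * s - 4 * (s * \<rho>)" by (simp add: algebra_simps)
    then have "- t\<^sup>2 / 2 \<le> 1 - 2 * s" using t2 \<rho>(2) by simp
    then show "exp (- t\<^sup>2 / 2) \<le> exp (1 - 2 * s)" by simp
  qed (use s t in auto)
  finally show ?thesis unfolding I_def N_def .
qed

text \<open>Pairs of grid points that differ in at most \<open>d\<close> positions are bounded by
  one tail \<open>p\<close>, and \<open>card\<close> makes them rare enough to contribute at most (M
  p)^2. The other pairs are nearly uncorrelated and contribute at most K' (M p)^2 with K' of order
  sqrt s; the result is 1 / (2 K').\<close>

lemma form_norm_lower_prob:
  assumes n: "n \<ge> 1" and L: "L \<ge> 2" and s: "s \<ge> 1"
    and \<rho>: "s * exp (- 4 * real d / (real n * (real L)\<^sup>2)) \<le> 1 / 2"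
    and card: "2 ^ m * (real L ^ (n - 1)) ^ d \<le> (real L ^ (n - 1)) ^ m * (tail_const * exp (- s) / sqrt (2 * s))"
  shows "tail_const\<^sup>2 / (2 * exp 1 * sqrt (2 * s)) \<le> measure (gauss_vec (multi_indices m n))
    {a \<in> space (gauss_vec (multi_indices m n)). sqrt (s * real n ^ m) < form_norm m n a}"
proof -
  define I where "I = multi_indices m n"
  define N where "N = real n ^ m"
  interpret G: prob_space "gauss_vec I" by (rule prob_space_gauss_vec)
  have I: "finite I" by (simp add: I_def multi_indices_finite)
  have N: "N > 0" using n by (simp add: N_def)
  define \<rho>' where "\<rho>' = exp (- 4 * real d / (real n * (real L)\<^sup>2))"
  define E where "E e = {a \<in> space (gauss_vec I). sqrt (s * N) < Re (\<Sum>i\<in>I. grid_vec m L e i * a i)}" for e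
  define W where "W = phase_grid m n L"
  define M where "M = (real L ^ (n - 1)) ^ m"
  define V where "V = 2 ^ m * (real L ^ (n - 1)) ^ d"
  define K where "K = exp (1 - 2 * s) / sqrt (2 * s)"
  define p where "p = measure std_normal_distribution {sqrt (2 * s)<..}"
  have Em [measurable]: "E e \<in> sets (gauss_vec I)" for e unfolding E_def by measurable
  have M: "M > 0" and V: "V > 0" using L by (simp_all add: M_def V_def)
  have cardW: "real (card W) = M" by (simp add: W_def M_def card_phase_grid[OF n])
  have finW: "finite W" by (simp add: W_def)
  have pE: "measure (gauss_vec I) (E e) = p" for e
  proof -
    have "measure (gauss_vec I) (E e) = measure std_normal_distribution {sqrt (2 / N) * sqrt (s * N)<..}"
      unfolding E_def using N by (intro gauss_vec_linear_tail[OF I]) (auto simp: I_def N_def card_multi_indices)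
    also have "sqrt (2 / N) * sqrt (s * N) = sqrt (2 * s)"
      unfolding real_sqrt_mult[symmetric] using N by simp
    finally show ?thesis by (simp add: p_def)
  qed
  have p: "tail_const * exp (- s) / sqrt (2 * s) \<le> p"
    using measure_std_normal_lower[of "sqrt (2 * s)"] s by (simp add: p_def tail_const_def)
  have p0: "0 < tail_const * exp (- s) / sqrt (2 * s)" using s tail_const_pos by simp
  then have ppos: "p > 0" using p by linarith
  have pair: "measure (gauss_vec I) (E e \<inter> E e') \<le> (if card {k\<in>{1..m}. e k \<noteq> e' k} \<le> d then p else 0) + K"
    if "e \<in> W" "e' \<in> W" for e e'
  proof (cases "card {k\<in>{1..m}. e k \<noteq> e' k} \<le> d")
    case True
    have "measure (gauss_vec I) (E e \<inter> E e') \<le> measure (gauss_vec I) (E e)"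
      by (intro G.finite_measure_mono) auto
    moreover have "0 \<le> K" using s by (simp add: K_def)
    ultimately show ?thesis using True by (simp add: pE)
  next
    case False
    have "cmod (\<Sum>i\<in>I. grid_vec m L e i * cnj (grid_vec m L e' i))
      \<le> N * exp (- 4 * real (card {k\<in>{1..m}. e k \<noteq> e' k}) / (real n * (real L)\<^sup>2))"
      using grid_vec_inner_le[OF L n, of e m e'] that by (simp add: W_def I_def N_def)
    also have "\<dots> \<le> N * \<rho>'"
      unfolding \<rho>'_def using False N by (intro mult_left_mono) (auto intro!: divide_right_mono)
    finally have "measure (gauss_vec I) {a \<in> space (gauss_vec I).
        sqrt (s * N) < Re (\<Sum>i\<in>I. grid_vec m L e i * a i) \<and> sqrt (s * N) < Re (\<Sum>i\<in>I. grid_vec m L e' i * a i)} \<le> K"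
      unfolding I_def N_def K_def using \<rho> by (intro joint_tail_le[OF n s, where \<rho>=\<rho>']) (auto simp: \<rho>'_def)
    moreover have "E e \<inter> E e' = {a \<in> space (gauss_vec I).
        sqrt (s * N) < Re (\<Sum>i\<in>I. grid_vec m L e i * a i) \<and> sqrt (s * N) < Re (\<Sum>i\<in>I. grid_vec m L e' i * a i)}"
      by (auto simp: E_def)
    ultimately show ?thesis using False by simp
  qed
  have "(\<Sum>e\<in>W. \<Sum>e'\<in>W. measure (gauss_vec I) (E e \<inter> E e'))
      \<le> (\<Sum>e\<in>W. \<Sum>e'\<in>W. (if card {k\<in>{1..m}. e k \<noteq> e' k} \<le> d then p else 0) + K)"
    by (intro sum_mono pair)
  also have "\<dots> \<le> (\<Sum>e\<in>W. V * p + M * K)"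
  proof (rule sum_mono)
    fix e assume e: "e \<in> W"
    have "(\<Sum>e'\<in>W. (if card {k\<in>{1..m}. e k \<noteq> e' k} \<le> d then p else 0))
      = real (card {e' \<in> W. card {k\<in>{1..m}. e k \<noteq> e' k} \<le> d}) * p"
      using finW by (simp add: sum.inter_filter[symmetric])
    also have "\<dots> \<le> V * p"
    proof (intro mult_right_mono)
      have "real (card {e' \<in> W. card {k\<in>{1..m}. e k \<noteq> e' k} \<le> d}) \<le> real (2 ^ m * (L ^ (n - 1)) ^ d)"
        unfolding W_def using L e by (intro of_nat_mono card_phase_grid_close_le n) (auto simp: W_def)
      then show "real (card {e' \<in> W. card {k\<in>{1..m}. e k \<noteq> e' k} \<le> d}) \<le> V" by (simp add: V_def)
    qed (use ppos in simp)
    finally show "(\<Sum>e'\<in>W. (if card {k\<in>{1..m}. e k \<noteq> e' k} \<le> d then p else 0) + K) \<le> V * p + M * K"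
      by (simp add: sum.distrib cardW)
  qed
  also have "\<dots> = M * (V * p + M * K)" by (simp add: cardW)
  finally have second: "(\<Sum>e\<in>W. \<Sum>e'\<in>W. measure (gauss_vec I) (E e \<inter> E e')) \<le> M * (V * p + M * K)" .
  \<comment> \<open>The quotient of the joint bound \<open>K\<close> by the square of the lower
    bound for \<open>p\<close>: exp(-2 s) cancels, and of the powers of s only sqrt s
    remains.\<close>
  define K' where "K' = exp 1 * sqrt (2 * s) / tail_const\<^sup>2"
  have "K = K' * (tail_const * exp (- s) / sqrt (2 * s))\<^sup>2"
  proof -
    have "exp (1 - 2 * s) = exp 1 * (exp (- s))\<^sup>2"
      by (simp add: power2_eq_square flip: exp_add)
    moreover have "sqrt (2 * s) * sqrt (2 * s) = 2 * s" using s by simp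
    ultimately show ?thesis
      using s tail_const_pos by (simp add: K_def K'_def power_divide power_mult_distrib field_simps)
  qed
  also have "\<dots> \<le> K' * p\<^sup>2"
    using p p0 s tail_const_pos by (intro mult_left_mono power_mono) (auto simp: K'_def)
  finally have K: "K \<le> K' * p\<^sup>2" .
  have "1 * 1 \<le> exp 1 * sqrt (2 * s)" using s by (intro mult_mono) auto
  also have "\<dots> \<le> exp 1 * sqrt (2 * s) / tail_const\<^sup>2"
  proof -
    have "tail_const\<^sup>2 \<le> 1\<^sup>2" using tail_const_le_1 tail_const_pos by (intro power_mono) auto
    then show ?thesis using tail_const_pos s by (simp add: pos_le_divide_eq mult_left_le)
  qed
  finally have K'1: "1 \<le> K'" by (simp add: K'_def)
  have "V \<le> M * p"
    using card p M unfolding V_def[symmetric] M_def[symmetric]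
    by (meson mult_left_mono less_imp_le order_trans)
  then have "V * p \<le> M * p * p" using ppos by (intro mult_right_mono) auto
  moreover have "M * K \<le> M * (K' * p\<^sup>2)" using K M by simp
  moreover have "M * p * p \<le> M * (K' * p\<^sup>2)"
    using K'1 M ppos by (simp add: power2_eq_square)
  ultimately have "V * p + M * K \<le> 2 * K' * p\<^sup>2 * M" by (simp add: algebra_simps)
  then have "M * (V * p + M * K) \<le> M * (2 * K' * p\<^sup>2 * M)" using M by (intro mult_left_mono) auto
  with second have second': "(\<Sum>e\<in>W. \<Sum>e'\<in>W. measure (gauss_vec I) (E e \<inter> E e')) \<le> 2 * K' * (M * p)\<^sup>2"
    by (simp add: power2_eq_square mult_ac)
  \<comment> \<open>The maximizer of 2 c (M p) - 2 c^2 K' (M p)^2.\<close>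
  define c where "c = 1 / (2 * K' * (M * p))"
  have Mp: "M * p > 0" using M ppos by simp
  have "1 / (2 * K') = 2 * c * (M * p) - c\<^sup>2 * (2 * K' * (M * p)\<^sup>2)"
    using M ppos K'1 by (simp add: c_def power2_eq_square field_simps)
  also have "\<dots> \<le> 2 * c * (\<Sum>e\<in>W. measure (gauss_vec I) (E e)) - c\<^sup>2 * (\<Sum>e\<in>W. \<Sum>e'\<in>W. measure (gauss_vec I) (E e \<inter> E e'))"
    using second' by (simp add: pE cardW mult_left_mono)
  also have "\<dots> \<le> measure (gauss_vec I) (\<Union>e\<in>W. E e)"
    by (rule G.second_moment_union) (use finW in auto)
  also have "\<dots> \<le> measure (gauss_vec I) {a \<in> space (gauss_vec I). sqrt (s * N) < form_norm m n a}"
  proof (rule G.finite_measure_mono)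
    show "(\<Union>e\<in>W. E e) \<subseteq> {a \<in> space (gauss_vec I). sqrt (s * N) < form_norm m n a}"
      using form_norm_ge_grid[OF n] by (force simp: E_def I_def intro: less_le_trans)
    show "{a \<in> space (gauss_vec I). sqrt (s * N) < form_norm m n a} \<in> sets (gauss_vec I)"
      using form_norm_measurable[OF n, of m] unfolding I_def by measurable
  qed
  also have "1 / (2 * K') = tail_const\<^sup>2 / (2 * exp 1 * sqrt (2 * s))"
    using tail_const_pos s by (simp add: K'_def)
  finally show ?thesis by (simp add: I_def N_def)
qed

text \<open>The second moment method only gives a probability of order \<open>s\<^sup>-\<^sup>1\<^sup>/\<^sup>2\<close>. Since the variance of
  the norm is at most \<open>n\<^sup>m\<close>, deviations of order \<open>\<surd>(s n\<^sup>m)\<close> have probability of order \<open>s\<^sup>-\<^sup>1\<close>,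
  so that the mean must be large, and then the norm is large with high probability.\<close>

lemma form_norm_lower_tail:
  assumes n: "n \<ge> 1" and s: "s \<ge> 1" and \<eta>: "\<eta> > 0"
    and lower: "b \<le> measure (gauss_vec (multi_indices m n))
      {a \<in> space (gauss_vec (multi_indices m n)). sqrt (s * real n ^ m) < form_norm m n a}"
    and b: "1 / (\<eta>\<^sup>2 * s) < b"
  shows "measure (gauss_vec (multi_indices m n))
      {a \<in> space (gauss_vec (multi_indices m n)). form_norm m n a \<le> (1 - 2 * \<eta>) * sqrt (s * real n ^ m)}
    \<le> 1 / (\<eta>\<^sup>2 * s)"
proof -
  define G where "G = gauss_vec (multi_indices m n)"
  define B where "B = sqrt (s * real n ^ m)"
  define \<mu> where "\<mu> = (LINT a|G. form_norm m n a)"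
  interpret G: prob_space G unfolding G_def by (rule prob_space_gauss_vec)
  have N: "0 < real n ^ m" using n by simp
  have B: "B > 0" using N s by (simp add: B_def)
  have [measurable]: "form_norm m n \<in> borel_measurable G" unfolding G_def by (rule form_norm_measurable[OF n])
  have "measure G {a \<in> space G. \<eta> * B \<le> \<bar>form_norm m n a - \<mu>\<bar>} \<le> (LINT a|G. (form_norm m n a - \<mu>)\<^sup>2) / (\<eta> * B)\<^sup>2"
    unfolding \<mu>_def using \<eta> B form_norm_variance_le(1)[OF n, of m]
    by (intro G.Chebyshev_inequality) (auto simp: G_def[symmetric])
  also have "\<dots> \<le> real n ^ m / (\<eta> * B)\<^sup>2"
    using form_norm_variance_le(2)[OF n, of m] by (intro divide_right_mono) (auto simp: G_def \<mu>_def)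
  also have "\<dots> = 1 / (\<eta>\<^sup>2 * s)"
    using N s \<eta> by (simp add: B_def power_mult_distrib)
  finally have dev: "measure G {a \<in> space G. \<eta> * B \<le> \<bar>form_norm m n a - \<mu>\<bar>} \<le> 1 / (\<eta>\<^sup>2 * s)" .
  \<comment> \<open>The event of large norm is more probable than a deviation by eta B, so at some
    point the norm exceeds B while being within eta B of the mean.\<close>
  have "\<not> {a \<in> space G. B < form_norm m n a} \<subseteq> {a \<in> space G. \<eta> * B \<le> \<bar>form_norm m n a - \<mu>\<bar>}"
  proof
    assume "{a \<in> space G. B < form_norm m n a} \<subseteq> {a \<in> space G. \<eta> * B \<le> \<bar>form_norm m n a - \<mu>\<bar>}"
    then have "measure G {a \<in> space G. B < form_norm m n a} \<le> measure G {a \<in> space G. \<eta> * B \<le> \<bar>form_norm m n a - \<mu>\<bar>}"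
      by (intro G.finite_measure_mono) measurable
    with dev lower b show False by (simp add: G_def[symmetric] B_def[symmetric])
  qed
  then have \<mu>: "(1 - \<eta>) * B < \<mu>" by (auto simp: algebra_simps)
  have "{a \<in> space G. form_norm m n a \<le> (1 - 2 * \<eta>) * B} \<subseteq> {a \<in> space G. \<eta> * B \<le> \<bar>form_norm m n a - \<mu>\<bar>}"
    using \<mu> by (auto simp: algebra_simps)
  then have "measure G {a \<in> space G. form_norm m n a \<le> (1 - 2 * \<eta>) * B} \<le> measure G {a \<in> space G. \<eta> * B \<le> \<bar>form_norm m n a - \<mu>\<bar>}"
    by (intro G.finite_measure_mono) measurable
  with dev show ?thesis by (simp add: G_def B_def)
qed

subsection \<open>Asymptotics\<close>

text \<open>The predicted value sqrt (N log M). Dividing sqrt (N n) by it leaves sqrt (2 n / (n -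
  1)) / sqrt (m log m).\<close>

definition typical_norm :: "nat \<Rightarrow> nat \<Rightarrow> real" where
  "typical_norm m n = sqrt (real n ^ m * ((real n - 1) / 2 * (real m * ln (real m))))"

lemma tendsto_0_squeeze:
  fixes f g :: "nat \<Rightarrow> real"
  assumes "eventually (\<lambda>m. 0 \<le> f m \<and> f m \<le> g m) sequentially" "g \<longlonglongrightarrow> 0"
  shows "f \<longlonglongrightarrow> 0"
  by (rule tendsto_sandwich[OF _ _ tendsto_const assms(2)]) (use assms(1) in \<open>auto elim: eventually_mono\<close>)

text \<open>The slack \<open>\<theta>\<close> is split evenly: one factor sqrt theta pays for the
  discretization, the other raises the level \<open>s\<close> above the logarithm of the number of
  grid points.\<close>

lemma form_norm_upper_limit:
  assumes n: "n \<ge> 2" and \<theta>: "\<theta> > 1"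
  shows "(\<lambda>m. measure (gauss_vec (multi_indices m n)) {a \<in> space (gauss_vec (multi_indices m n)).
      \<theta> * typical_norm m n < form_norm m n a}) \<longlonglongrightarrow> 0"
proof -
  define \<nu> where "\<nu> = real n - 1"
  have \<nu>: "\<nu> > 0" using n by (simp add: \<nu>_def)
  have sq\<theta>: "sqrt \<theta> > 1" using \<theta> by simp
  \<comment> \<open>With pi < 4 and m + 1 <= 2 m one gets (m + 1) (pi / L)^2 / 2 <= 16 / K^2, and K
    makes this at most 1 - 1 / sqrt theta; Bernoulli's inequality then gives kappa^(m + 1) >= 1 /
    sqrt theta.\<close>
  obtain K :: nat where K: "K > 0" "16 / (1 - 1 / sqrt \<theta>) < real K"
  proof -
    obtain K :: nat where K: "16 / (1 - 1 / sqrt \<theta>) < real K" using reals_Archimedean2 by blast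
    moreover have "0 < 16 / (1 - 1 / sqrt \<theta>)" using sq\<theta> by simp
    ultimately have "K > 0" by (metis less_trans of_nat_0_less_iff)
    then show ?thesis using K that by blast
  qed
  have K16: "16 / (real K)\<^sup>2 \<le> 1 - 1 / sqrt \<theta>"
  proof -
    have pos: "0 < 1 - 1 / sqrt \<theta>" using sq\<theta> by simp
    have "16 < real K * (1 - 1 / sqrt \<theta>)" using K(2) pos by (simp add: pos_divide_less_eq)
    also have "\<dots> \<le> (real K)\<^sup>2 * (1 - 1 / sqrt \<theta>)"
      using K(1) pos by (intro mult_right_mono) (auto simp: power2_eq_square)
    finally show ?thesis using K(1) by (simp add: pos_divide_le_eq mult.commute)
  qed
  define L where "L m = K * nat \<lceil>sqrt (real m)\<rceil>" for m
  define s where "s m = \<theta> * (\<nu> / 2) * (real m * ln (real m))" for m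
  define \<kappa> where "\<kappa> m = 1 - (pi / L m)\<^sup>2 / 2" for m
  define bound where "bound m = real (L m) * (real (L m) ^ (n - 1)) ^ m * exp (- s m)" for m
  define C where "C = \<bar>ln (2 * real K)\<bar>"
  \<comment> \<open>The surplus of \<open>s\<close> over nu / 2 m log m, the leading term of the
    logarithm of the number of events. All remaining terms, including those with K, are
    O(m).\<close>
  define A where "A = (\<theta> - 1) * (\<nu> / 2)"
  have A: "A > 0" using \<theta> \<nu> by (simp add: A_def)
  have slim: "filterlim s at_top sequentially"
  proof -
    have "\<theta> * (\<nu> / 2) > 0" using \<theta> \<nu> by simp
    then show ?thesis unfolding s_def by real_asymp
  qed
  have L_lower: "real K * sqrt (real m) \<le> real (L m)" for m
    using mult_left_mono[OF real_nat_ceiling_ge, of "real K" "sqrt (real m)"] by (simp add: L_def)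
  have main: "measure (gauss_vec (multi_indices m n)) {a \<in> space (gauss_vec (multi_indices m n)).
      \<theta> * typical_norm m n < form_norm m n a} \<le> bound m" if m: "m \<ge> 1" and s1: "s m \<ge> 1" for m
  proof -
    interpret G: prob_space "gauss_vec (multi_indices m n)" by (rule prob_space_gauss_vec)
    have KL: "0 < real K * sqrt (real m)" using m K by simp
    have Lpos: "L m > 0" using L_lower[of m] KL by (metis less_le_trans of_nat_0_less_iff)
    have "(pi / L m)\<^sup>2 \<le> (4 / (real K * sqrt (real m)))\<^sup>2"
      using L_lower[of m] KL pi_less_4 by (intro power_mono frac_le) auto
    also have "\<dots> = 16 / (real K)\<^sup>2 / real m" using m by (simp add: power_divide power_mult_distrib)
    finally have p: "(pi / L m)\<^sup>2 \<le> 16 / (real K)\<^sup>2 / real m" .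
    have "real (m + 1) * ((pi / L m)\<^sup>2 / 2) \<le> (2 * real m) * (16 / (real K)\<^sup>2 / real m / 2)"
    proof (rule mult_mono)
      show "(pi / L m)\<^sup>2 / 2 \<le> 16 / (real K)\<^sup>2 / real m / 2" using p by (rule divide_right_mono) simp
    qed (use m in auto)
    also have "\<dots> = 16 / (real K)\<^sup>2" using m by simp
    finally have "real (m + 1) * ((pi / L m)\<^sup>2 / 2) \<le> 1 - 1 / sqrt \<theta>" using K16 by linarith
    then have p2: "1 / sqrt \<theta> \<le> 1 + real (m + 1) * (- ((pi / L m)\<^sup>2 / 2))" by simp
    have p3: "(pi / L m)\<^sup>2 / 2 < 1"
    proof -
      have "1 * ((pi / L m)\<^sup>2 / 2) \<le> real (m + 1) * ((pi / L m)\<^sup>2 / 2)" by (intro mult_right_mono) auto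
      moreover have "1 / sqrt \<theta> > 0" using sq\<theta> by simp
      ultimately show ?thesis using p2 by linarith
    qed
    have "1 + real (m + 1) * (- ((pi / L m)\<^sup>2 / 2)) \<le> (1 + (- ((pi / L m)\<^sup>2 / 2))) ^ (m + 1)"
      using p3 by (intro Bernoulli_inequality) simp
    with p2 have \<kappa>: "1 / sqrt \<theta> \<le> \<kappa> m ^ (m + 1)" by (simp add: \<kappa>_def)
    have \<kappa>0: "\<kappa> m > 0" using p3 by (simp add: \<kappa>_def)
    have "sqrt (s m * real n ^ m) / \<kappa> m ^ (m + 1) \<le> sqrt (s m * real n ^ m) / (1 / sqrt \<theta>)"
      using \<kappa> \<kappa>0 sq\<theta> s1 by (intro divide_left_mono) auto
    also have "\<dots> = sqrt \<theta> * sqrt (\<theta> * (real n ^ m * (\<nu> / 2 * (real m * ln (real m)))))"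
      by (simp add: s_def mult_ac)
    also have "\<dots> = \<theta> * typical_norm m n"
      using \<theta> unfolding typical_norm_def \<nu>_def real_sqrt_mult[of \<theta>] by simp
    finally have le: "sqrt (s m * real n ^ m) / \<kappa> m ^ (m + 1) \<le> \<theta> * typical_norm m n" .
    have [measurable]: "form_norm m n \<in> borel_measurable (gauss_vec (multi_indices m n))"
      using n by (intro form_norm_measurable) auto
    have "measure (gauss_vec (multi_indices m n)) {a \<in> space (gauss_vec (multi_indices m n)).
      \<theta> * typical_norm m n < form_norm m n a}
      \<le> measure (gauss_vec (multi_indices m n)) {a \<in> space (gauss_vec (multi_indices m n)).
      sqrt (s m * real n ^ m) / \<kappa> m ^ (m + 1) < form_norm m n a}"
      using le by (intro G.finite_measure_mono) (auto intro: le_less_trans)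
    also have "\<dots> \<le> bound m"
      unfolding bound_def using n Lpos \<kappa>0 s1 by (intro form_norm_upper_tail) (auto simp: \<kappa>_def)
    finally show ?thesis .
  qed
  have bound_le: "bound m \<le> exp (C + C * \<nu> * real m + 1 / 2 * ln (real m) - A * real m * ln (real m))" if m: "m \<ge> 1" for m
  proof -
    have KL: "0 < real K * sqrt (real m)" using m K by simp
    have Lpos: "real (L m) > 0" using L_lower[of m] KL by linarith
    have "real (nat \<lceil>sqrt (real m)\<rceil>) \<le> sqrt (real m) + 1" by (simp add: of_nat_nat)
    also have "\<dots> \<le> 2 * sqrt (real m)" using m by simp
    finally have "real (L m) \<le> 2 * real K * sqrt (real m)"
      unfolding L_def using K(1) by (simp add: mult_left_mono)
    then have "ln (real (L m)) \<le> ln (2 * real K * sqrt (real m))" using Lpos by (intro ln_mono) auto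
    also have "\<dots> = ln (2 * real K) + 1 / 2 * ln (real m)"
      using m K by (simp add: ln_mult ln_sqrt)
    finally have lnL: "ln (real (L m)) \<le> C + 1 / 2 * ln (real m)" by (simp add: C_def)
    have nm: "real ((n - 1) * m) = \<nu> * real m" using n by (simp add: \<nu>_def of_nat_diff)
    have "bound m = real (L m) * real (L m) ^ ((n - 1) * m) * exp (- s m)"
      by (simp add: bound_def power_mult)
    also have "\<dots> = exp (ln (real (L m)) + real ((n - 1) * m) * ln (real (L m)) - s m)"
      using Lpos by (simp only: exp_add exp_diff exp_minus exp_of_nat_mult exp_ln divide_inverse)
    also have "\<dots> = exp ((1 + \<nu> * real m) * ln (real (L m)) - s m)"
      by (simp only: nm) (simp add: algebra_simps)
    also have "\<dots> \<le> exp ((1 + \<nu> * real m) * (C + 1 / 2 * ln (real m)) - s m)"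
      using lnL \<nu> by (simp add: mult_left_mono)
    also have "(1 + \<nu> * real m) * (C + 1 / 2 * ln (real m)) - s m
        = C + C * \<nu> * real m + 1 / 2 * ln (real m) - A * real m * ln (real m)"
      unfolding s_def A_def by algebra
    finally show ?thesis .
  qed
  show ?thesis
  proof (rule tendsto_0_squeeze)
    show "(\<lambda>m. exp (C + C * \<nu> * real m + 1 / 2 * ln (real m) - A * real m * ln (real m))) \<longlonglongrightarrow> 0"
      using A by real_asymp
    have "eventually (\<lambda>m. s m \<ge> 1) sequentially" using slim by (simp add: filterlim_at_top)
    then show "eventually (\<lambda>m. 0 \<le> measure (gauss_vec (multi_indices m n)) {a \<in> space (gauss_vec (multi_indices m n)).
      \<theta> * typical_norm m n < form_norm m n a} \<and> measure (gauss_vec (multi_indices m n)) {a \<in> space (gauss_vec (multi_indices m n)).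
      \<theta> * typical_norm m n < form_norm m n a} \<le> exp (C + C * \<nu> * real m + 1 / 2 * ln (real m) - A * real m * ln (real m))) sequentially"
      using eventually_ge_at_top[of 1]
      by eventually_elim (use main bound_le order_trans in \<open>blast intro: measure_nonneg\<close>)
  qed
qed

text \<open>The slack is spent on a coarser grid (exponent 1/2 - eta), on ignoring a fraction eta of
  the positions, on a level \<open>s\<close> below the number of grid points, and on the passage
  through the mean.\<close>

lemma form_norm_lower_limit:
  assumes n: "n \<ge> 2" and \<theta>: "0 < \<theta>" "\<theta> < 1"
  shows "(\<lambda>m. measure (gauss_vec (multi_indices m n)) {a \<in> space (gauss_vec (multi_indices m n)).
      form_norm m n a \<le> \<theta> * typical_norm m n}) \<longlonglongrightarrow> 0"
proof -
  define \<nu> where "\<nu> = real n - 1"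
  have \<nu>: "\<nu> > 0" using n by (simp add: \<nu>_def)
  \<comment> \<open>The final loss is (1 - 2 eta) (1 - 4 eta) >= 1 - 6 eta = theta.\<close>
  define \<eta> where "\<eta> = (1 - \<theta>) / 6"
  have \<eta>: "0 < \<eta>" "\<eta> < 1 / 6" using \<theta> by (auto simp: \<eta>_def)
  \<comment> \<open>With L of order m^(1/2 - eta) and (1 - eta) m positions, the log count is nu (1
    - eta) (1/2 - eta) m log m; lowering 1/2 - eta to 1/2 - 2 eta leaves the surplus
    \<open>A\<close>.\<close>
  define \<sigma> where "\<sigma> = \<nu> * (1 - \<eta>) * (1 / 2 - 2 * \<eta>)"
  have \<sigma>: "\<sigma> > 0" using \<nu> \<eta> by (simp add: \<sigma>_def)
  define L where "L m = nat \<lfloor>real m powr (1 / 2 - \<eta>)\<rfloor>" for m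
  define d where "d m = nat \<lfloor>\<eta> * real m\<rfloor>" for m
  define s where "s m = \<sigma> * (real m * ln (real m))" for m
  have slim: "filterlim s at_top sequentially"
    unfolding s_def using \<sigma> by real_asymp
  have e_s: "eventually (\<lambda>m. s m \<ge> 1) sequentially" using slim by (simp add: filterlim_at_top)
  have e_L: "eventually (\<lambda>m. 4 \<le> real m powr (1 / 2 - \<eta>)) sequentially"
  proof -
    have "0 < 1 / 2 - \<eta>" using \<eta> by simp
    then have "filterlim (\<lambda>m. real m powr (1 / 2 - \<eta>)) at_top sequentially" by real_asymp
    then show ?thesis by (simp add: filterlim_at_top)
  qed
  have e_d: "eventually (\<lambda>m. 2 \<le> \<eta> * real m) sequentially"
  proof -
    have "filterlim (\<lambda>m. \<eta> * real m) at_top sequentially" using \<eta> by real_asymp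
    then show ?thesis by (simp add: filterlim_at_top)
  qed
  \<comment> \<open>For distances above d >= eta m / 2 and L^2 <= m^(1 - 2 eta) the correlation
    decays like a stretched exponential in m, which beats the polynomial growth of
    \<open>s\<close>.\<close>
  have e_\<rho>: "eventually (\<lambda>m. s m * exp (- (2 * \<eta> / real n) * real m powr (2 * \<eta>)) \<le> 1 / 2) sequentially"
  proof -
    have "2 * \<eta> / real n > 0" "2 * \<eta> > 0" using \<eta> n by auto
    moreover have "(\<lambda>m. c * (real m * ln (real m)) * exp (- a * real m powr b)) \<longlonglongrightarrow> 0"
      if "a > 0" "b > 0" for a b c :: real
      using that by real_asymp
    ultimately have "(\<lambda>m. s m * exp (- (2 * \<eta> / real n) * real m powr (2 * \<eta>))) \<longlonglongrightarrow> 0"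
      unfolding s_def by blast
    then have "eventually (\<lambda>m. s m * exp (- (2 * \<eta> / real n) * real m powr (2 * \<eta>)) < 1 / 2) sequentially"
      by (rule order_tendstoD) simp
    then show ?thesis by (rule eventually_mono) simp
  qed
  define A where "A = \<nu> * (1 - \<eta>) * \<eta>"
  have A: "A > 0" using \<nu> \<eta> by (simp add: A_def)
  \<comment> \<open>Collects the O(m) losses: ln 2 from the number of position sets, and the rest
    from the rounding in L >= m^(1/2 - eta) / 2.\<close>
  define C where "C = ln 2 + \<nu> * (1 - \<eta>) * ln 2"
  have e_card: "eventually (\<lambda>m. 0 \<le> A * real m * ln (real m) - C * real m - 1 / 2 * ln (2 * s m) + ln tail_const) sequentially"
  proof -
    have "filterlim (\<lambda>m. A * real m * ln (real m) - C * real m - 1 / 2 * ln (2 * s m) + ln tail_const) at_top sequentially"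
      unfolding s_def using A \<sigma> by real_asymp
    then show ?thesis by (simp add: filterlim_at_top)
  qed
  \<comment> \<open>The decisive comparison: the second moment probability is of order s^(-1/2), the
    Chebyshev bound of order 1 / s.\<close>
  have e_b: "eventually (\<lambda>m. 1 / (\<eta>\<^sup>2 * s m) < tail_const\<^sup>2 / (2 * exp 1 * sqrt (2 * s m))) sequentially"
  proof -
    define c where "c = tail_const\<^sup>2 * \<eta>\<^sup>2 / (2 * exp 1 * sqrt 2)"
    have c: "c > 0" using tail_const_pos \<eta> by (simp add: c_def)
    have "filterlim (\<lambda>m. c * sqrt (s m)) at_top sequentially"
      by (rule filterlim_tendsto_pos_mult_at_top[OF tendsto_const c filterlim_compose[OF sqrt_at_top slim]])
    then have "eventually (\<lambda>m. c * sqrt (s m) > 1) sequentially" by (simp add: filterlim_at_top_dense)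
    then show ?thesis using e_s
    proof eventually_elim
      case (elim m)
      have "c * sqrt (s m) * (2 * exp 1 * sqrt (2 * s m)) = tail_const\<^sup>2 * (\<eta>\<^sup>2 * s m)"
        using elim by (simp add: c_def real_sqrt_mult)
      moreover have "1 * (2 * exp 1 * sqrt (2 * s m)) < c * sqrt (s m) * (2 * exp 1 * sqrt (2 * s m))"
        using elim by (intro mult_strict_right_mono) auto
      ultimately have "2 * exp 1 * sqrt (2 * s m) < tail_const\<^sup>2 * (\<eta>\<^sup>2 * s m)" by simp
      moreover have "0 < \<eta>\<^sup>2 * s m" "0 < 2 * exp 1 * sqrt (2 * s m)" using elim \<eta> by auto
      moreover have "1 / Y < c / X" if "X < c * Y" "0 < Y" "0 < X" for c X Y :: real
        using that by (simp add: field_simps)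
      ultimately show ?case by blast
    qed
  qed
  have main: "measure (gauss_vec (multi_indices m n)) {a \<in> space (gauss_vec (multi_indices m n)).
      form_norm m n a \<le> \<theta> * typical_norm m n} \<le> 1 / (\<eta>\<^sup>2 * s m)"
    if m: "m \<ge> 1" and s1: "s m \<ge> 1" and L4: "4 \<le> real m powr (1 / 2 - \<eta>)" and d2: "2 \<le> \<eta> * real m"
      and \<rho>: "s m * exp (- (2 * \<eta> / real n) * real m powr (2 * \<eta>)) \<le> 1 / 2"
      and card: "0 \<le> A * real m * ln (real m) - C * real m - 1 / 2 * ln (2 * s m) + ln tail_const"
      and b: "1 / (\<eta>\<^sup>2 * s m) < tail_const\<^sup>2 / (2 * exp 1 * sqrt (2 * s m))" for m
  proof -
    interpret G: prob_space "gauss_vec (multi_indices m n)" by (rule prob_space_gauss_vec)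
    let ?x = "real m powr (1 / 2 - \<eta>)"
    have m0: "real m > 0" using m by simp
    have Lu: "real (L m) \<le> ?x" and Ll: "?x - 1 \<le> real (L m)"
      unfolding L_def by (simp_all add: of_nat_nat)
    have L2: "2 \<le> L m" using Ll L4 by linarith
    have du: "real (d m) \<le> \<eta> * real m" and dl: "\<eta> * real m - 1 \<le> real (d m)"
      unfolding d_def using d2 by (simp_all add: of_nat_nat)
    have \<rho>': "s m * exp (- 4 * real (d m) / (real n * (real (L m))\<^sup>2)) \<le> 1 / 2"
    proof -
      have "(real (L m))\<^sup>2 \<le> ?x\<^sup>2" using Lu by (intro power_mono) auto
      also have "?x\<^sup>2 = real m powr (1 - 2 * \<eta>)"
        using m0 by (simp add: power2_eq_square algebra_simps flip: powr_add)
      finally have L_sq: "(real (L m))\<^sup>2 \<le> real m powr (1 - 2 * \<eta>)" .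
      have "2 * \<eta> / real n * real m powr (2 * \<eta>) = 2 * \<eta> * real m / (real n * real m powr (1 - 2 * \<eta>))"
        using m0 n by (simp add: powr_diff field_simps)
      also have "\<dots> \<le> 4 * real (d m) / (real n * (real (L m))\<^sup>2)"
        using L_sq dl d2 \<eta> n L2 by (intro frac_le mult_left_mono) auto
      finally have "exp (- 4 * real (d m) / (real n * (real (L m))\<^sup>2)) \<le> exp (- (2 * \<eta> / real n) * real m powr (2 * \<eta>))"
        by simp
      then have "s m * exp (- 4 * real (d m) / (real n * (real (L m))\<^sup>2)) \<le> s m * exp (- (2 * \<eta> / real n) * real m powr (2 * \<eta>))"
        using s1 by (intro mult_left_mono) auto
      then show ?thesis using \<rho> by linarith
    qed
    have card': "2 ^ m * (real (L m) ^ (n - 1)) ^ d m \<le> (real (L m) ^ (n - 1)) ^ m * (tail_const * exp (- s m) / sqrt (2 * s m))"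
    proof -
      let ?l = "ln (real (L m))"
      have Lpos: "real (L m) > 0" using L2 by simp
      have "(1 / 2 - \<eta>) * ln (real m) - ln 2 = ln (?x / 2)"
        using m0 by (simp add: ln_div ln_powr)
      also have "\<dots> \<le> ?l" using L4 Ll m0 by (intro ln_mono) auto
      finally have lnL: "(1 / 2 - \<eta>) * ln (real m) - ln 2 \<le> ?l" .
      have md: "(1 - \<eta>) * real m \<le> real m - real (d m)" using du by (simp add: algebra_simps)
      have l0: "0 \<le> ?l" using L2 by simp
      have "\<nu> * ((1 - \<eta>) * real m) * ((1 / 2 - \<eta>) * ln (real m) - ln 2) \<le> \<nu> * ((1 - \<eta>) * real m) * ?l"
        using \<nu> \<eta> m0 lnL by (intro mult_left_mono) auto
      also have "\<dots> \<le> \<nu> * (real m - real (d m)) * ?l"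
        using \<nu> md l0 by (intro mult_right_mono mult_left_mono) auto
      finally have 1: "\<nu> * ((1 - \<eta>) * real m) * ((1 / 2 - \<eta>) * ln (real m) - ln 2) \<le> \<nu> * (real m - real (d m)) * ?l" .
      have 2: "\<nu> * ((1 - \<eta>) * real m) * ((1 / 2 - \<eta>) * ln (real m) - ln 2)
        = s m + A * real m * ln (real m) + ln 2 * real m - C * real m"
        unfolding s_def \<sigma>_def A_def C_def by algebra
      have "real m * ln 2 + \<nu> * real (d m) * ?l \<le> \<nu> * real m * ?l + (ln tail_const - s m - 1 / 2 * ln (2 * s m))"
        using 1 2 card by (simp add: algebra_simps)
      then have "exp (real m * ln 2 + \<nu> * real (d m) * ?l) \<le> exp (\<nu> * real m * ?l + (ln tail_const - s m - 1 / 2 * ln (2 * s m)))"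
        by simp
      moreover have pw: "(real (L m) ^ (n - 1)) ^ k = exp (\<nu> * real k * ?l)" for k
      proof -
        have "real ((n - 1) * k) = \<nu> * real k" using n by (simp add: \<nu>_def of_nat_diff)
        then have "exp (\<nu> * real k * ?l) = exp (real ((n - 1) * k) * ?l)" by (simp only:)
        also have "\<dots> = real (L m) ^ ((n - 1) * k)" using Lpos by (simp only: exp_of_nat_mult exp_ln)
        finally show ?thesis by (simp add: power_mult)
      qed
      moreover have "exp (real m * ln 2) = 2 ^ m" by (simp add: exp_of_nat_mult)
      moreover have "exp (ln tail_const - s m - 1 / 2 * ln (2 * s m)) = tail_const * exp (- s m) / sqrt (2 * s m)"
      proof -
        have "1 / 2 * ln (2 * s m) = ln (sqrt (2 * s m))" using s1 by (simp add: ln_sqrt)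
        then have "exp (1 / 2 * ln (2 * s m)) = sqrt (2 * s m)" using s1 by simp
        then show ?thesis using tail_const_pos by (simp only: exp_diff exp_ln exp_minus divide_inverse)
      qed
      ultimately show ?thesis by (simp add: exp_add)
    qed
    have n1: "n \<ge> 1" using n by simp
    have tail: "measure (gauss_vec (multi_indices m n)) {a \<in> space (gauss_vec (multi_indices m n)).
      form_norm m n a \<le> (1 - 2 * \<eta>) * sqrt (s m * real n ^ m)} \<le> 1 / (\<eta>\<^sup>2 * s m)"
      by (rule form_norm_lower_tail[OF n1 s1 \<eta>(1) form_norm_lower_prob[OF n1 L2 s1 \<rho>' card'] b])
    have "\<theta> * typical_norm m n \<le> (1 - 2 * \<eta>) * sqrt (s m * real n ^ m)"
    proof -
      let ?T = "real n ^ m * (\<nu> / 2 * (real m * ln (real m)))"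
      have T: "0 \<le> ?T" using \<nu> m by simp
      have "(1 - 4 * \<eta>) * (1 - 4 * \<eta>) \<le> (1 - \<eta>) * (1 - 4 * \<eta>)"
        using \<eta> by (intro mult_right_mono) auto
      then have "(1 - 4 * \<eta>)\<^sup>2 * ?T \<le> (1 - \<eta>) * (1 - 4 * \<eta>) * ?T"
        using T by (intro mult_right_mono) (auto simp: power2_eq_square)
      also have "\<dots> = s m * real n ^ m"
      proof -
        have "\<sigma> = (1 - \<eta>) * (1 - 4 * \<eta>) * (\<nu> / 2)" by (simp add: \<sigma>_def field_simps)
        then show ?thesis by (simp only: s_def mult_ac)
      qed
      finally have le: "sqrt ((1 - 4 * \<eta>)\<^sup>2 * ?T) \<le> sqrt (s m * real n ^ m)" by (rule real_sqrt_le_mono)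
      have eq: "sqrt ((1 - 4 * \<eta>)\<^sup>2 * ?T) = (1 - 4 * \<eta>) * typical_norm m n"
        using \<eta> unfolding typical_norm_def \<nu>_def real_sqrt_mult[of "(1 - 4 * \<eta>)\<^sup>2"] by simp
      have "(1 - 2 * \<eta>) * ((1 - 4 * \<eta>) * typical_norm m n) \<le> (1 - 2 * \<eta>) * sqrt (s m * real n ^ m)"
        using \<eta> le unfolding eq by (intro mult_left_mono) auto
      moreover have "\<theta> * typical_norm m n \<le> (1 - 2 * \<eta>) * (1 - 4 * \<eta>) * typical_norm m n"
      proof (rule mult_right_mono)
        have "\<theta> = 1 - 6 * \<eta>" by (simp add: \<eta>_def field_simps)
        then show "\<theta> \<le> (1 - 2 * \<eta>) * (1 - 4 * \<eta>)" using \<eta> by (simp add: algebra_simps)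
        show "0 \<le> typical_norm m n" using T by (simp add: typical_norm_def \<nu>_def)
      qed
      ultimately show ?thesis by (simp add: mult.assoc)
    qed
    moreover have [measurable]: "form_norm m n \<in> borel_measurable (gauss_vec (multi_indices m n))"
      by (rule form_norm_measurable[OF n1])
    ultimately have "measure (gauss_vec (multi_indices m n)) {a \<in> space (gauss_vec (multi_indices m n)).
      form_norm m n a \<le> \<theta> * typical_norm m n}
      \<le> measure (gauss_vec (multi_indices m n)) {a \<in> space (gauss_vec (multi_indices m n)).
      form_norm m n a \<le> (1 - 2 * \<eta>) * sqrt (s m * real n ^ m)}"
      by (intro G.finite_measure_mono) auto
    with tail show ?thesis by linarith
  qed
  show ?thesis
  proof (rule tendsto_0_squeeze)
    show "(\<lambda>m. 1 / (\<eta>\<^sup>2 * s m)) \<longlonglongrightarrow> 0"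
      unfolding s_def using \<sigma> \<eta>(1) by real_asymp
    show "eventually (\<lambda>m. 0 \<le> measure (gauss_vec (multi_indices m n)) {a \<in> space (gauss_vec (multi_indices m n)).
      form_norm m n a \<le> \<theta> * typical_norm m n} \<and> measure (gauss_vec (multi_indices m n)) {a \<in> space (gauss_vec (multi_indices m n)).
      form_norm m n a \<le> \<theta> * typical_norm m n} \<le> 1 / (\<eta>\<^sup>2 * s m)) sequentially"
      using eventually_ge_at_top[of 1] e_s e_L e_d e_\<rho> e_card e_b
      by eventually_elim (use main in \<open>blast intro: measure_nonneg\<close>)
  qed
qed

section \<open>The numerator: sums of powers with exponent close to 2\<close>

lemma powr_ge_minus_square:
  assumes x: "x \<ge> (0 :: real)" and m: "m \<ge> (1 :: nat)"
  shows "x - x\<^sup>2 / (real m + 1) \<le> x powr (real m / (real m + 1))"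
proof (cases "x = 0")
  case False
  then have x0: "x > 0" using x by simp
  let ?h = "1 / (real m + 1)"
  \<comment> \<open>With h = 1 / (m + 1) the power is x exp(-h ln x) >= x (1 - h ln x), and ln x <=
    x. For x = |a|^2 the error becomes a fourth power.\<close>
  have "x - x\<^sup>2 / (real m + 1) \<le> x * (1 + - (?h * ln x))"
  proof -
    have "ln x \<le> x" using ln_le_minus_one[OF x0] by simp
    then have "x * (?h * ln x) \<le> x * (?h * x)" using x0 by (intro mult_left_mono) auto
    then show ?thesis by (simp add: algebra_simps power2_eq_square)
  qed
  also have "\<dots> \<le> x * exp (- (?h * ln x))"
    using x0 exp_ge_add_one_self[of "- (?h * ln x)"] by (intro mult_left_mono) auto
  also have "\<dots> = x powr 1 * x powr (- ?h)"
    using x0 by (simp add: powr_def)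
  also have "\<dots> = x powr (real m / (real m + 1))"
    unfolding powr_add[symmetric] by (simp add: field_simps)
  finally show ?thesis .
qed simp

text \<open>Weighted arithmetic-geometric mean of x and 1, obtained from convexity of exp between ln
  x and 0.\<close>

lemma powr_le_affine:
  assumes x: "x \<ge> (0 :: real)" and m: "m \<ge> (1 :: nat)"
  shows "x powr (real m / (real m + 1)) \<le> real m / (real m + 1) * x + 1 / (real m + 1)"
proof (cases "x = 0")
  case False
  then have x0: "x > 0" using x by simp
  let ?t = "real m / (real m + 1)"
  have "x powr ?t = exp (?t * ln x + (1 - ?t) * 0)" using x0 by (simp add: powr_def)
  also have "\<dots> \<le> ?t * exp (ln x) + (1 - ?t) * exp 0"
    using convex_onD[OF exp_convex, of "1 - ?t" "ln x" 0] by (simp add: field_simps)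
  also have "\<dots> = ?t * x + 1 / (real m + 1)" using x0 by (simp add: field_simps)
  finally show ?thesis .
qed simp

definition bh_sum :: "nat \<Rightarrow> nat \<Rightarrow> ((nat \<Rightarrow> nat) \<Rightarrow> complex) \<Rightarrow> real" where
  "bh_sum m n a = (\<Sum>i\<in>multi_indices m n. cmod (a i) powr bh_exponent m) powr (1 / bh_exponent m)"

text \<open>The two elementary inequalities compare the sum of powers with the sum of squares. The
  allowance sqrt m in the fourth-power hypothesis is divided by m + 1 and becomes at most 1 / sqrt
  m; the outer exponent \<open>h\<close> is at most 1, so relative errors are not amplified.\<close>

lemma bh_sum_bounds:
  assumes n: "n \<ge> 1" and m: "m \<ge> 1" and \<delta>: "0 < \<delta>" "\<delta> < 1 / 2" "1 / sqrt (real m) \<le> \<delta>"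
    and sq: "\<bar>(\<Sum>i\<in>multi_indices m n. (cmod (a i))\<^sup>2) - real n ^ m\<bar> \<le> \<delta> * real n ^ m"
    and four: "(\<Sum>i\<in>multi_indices m n. cmod (a i) ^ 4) \<le> sqrt (real m) * real n ^ m"
  shows "(1 - 2 * \<delta>) * (sqrt (real n ^ m) * sqrt (real n)) \<le> bh_sum m n a"
    and "bh_sum m n a \<le> (1 + \<delta>) * (sqrt (real n ^ m) * sqrt (real n))"
proof -
  define N where "N = real n ^ m"
  define h where "h = (real m + 1) / (2 * real m)"
  let ?I = "multi_indices m n"
  let ?t = "real m / (real m + 1)"
  have N: "N > 0" using n by (simp add: N_def)
  have cardI: "real (card ?I) = N" by (simp add: N_def card_multi_indices)
  have h: "1 / bh_exponent m = h" "0 \<le> h" "h \<le> 1"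
    using m by (simp_all add: h_def bh_exponent_def field_simps)
  define \<Sigma> where "\<Sigma> = (\<Sum>i\<in>?I. cmod (a i) powr bh_exponent m)"
  have \<Sigma>: "\<Sigma> = (\<Sum>i\<in>?I. ((cmod (a i))\<^sup>2) powr ?t)"
    unfolding \<Sigma>_def
  proof (intro sum.cong refl)
    fix i
    show "cmod (a i) powr bh_exponent m = ((cmod (a i))\<^sup>2) powr ?t"
    proof (cases "a i = 0")
      case False
      then have "(cmod (a i))\<^sup>2 = cmod (a i) powr 2" by simp
      then show ?thesis by (simp only: powr_powr) (simp add: bh_exponent_def)
    qed simp
  qed
  have "\<Sigma> \<le> (\<Sum>i\<in>?I. ?t * (cmod (a i))\<^sup>2 + 1 / (real m + 1))"
    unfolding \<Sigma> by (intro sum_mono powr_le_affine m) simp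
  also have "\<dots> = ?t * (\<Sum>i\<in>?I. (cmod (a i))\<^sup>2) + N / (real m + 1)"
    by (simp only: sum.distrib sum_distrib_left[symmetric] sum_constant cardI) simp
  also have "\<dots> \<le> ?t * ((1 + \<delta>) * N) + N / (real m + 1)"
    using sq by (intro add_right_mono mult_left_mono) (auto simp: N_def algebra_simps)
  also have "\<dots> \<le> ?t * ((1 + \<delta>) * N) + (1 + \<delta>) * N / (real m + 1)"
    using N \<delta> by (intro add_left_mono divide_right_mono) auto
  also have "\<dots> = (?t + 1 / (real m + 1)) * ((1 + \<delta>) * N)" by (simp only: distrib_right) simp
  also have "?t + 1 / (real m + 1) = 1" by (simp add: field_simps)
  finally have up: "\<Sigma> \<le> (1 + \<delta>) * N" by simp
  have "(1 - 2 * \<delta>) * N \<le> (1 - \<delta>) * N - \<delta> * N" by (simp add: algebra_simps)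
  also have "\<dots> \<le> (\<Sum>i\<in>?I. (cmod (a i))\<^sup>2) - (\<Sum>i\<in>?I. cmod (a i) ^ 4) / (real m + 1)"
  proof -
    have "(\<Sum>i\<in>?I. cmod (a i) ^ 4) / (real m + 1) \<le> sqrt (real m) * N / (real m)"
      using four m N by (intro frac_le) (auto simp: N_def)
    also have "sqrt (real m) * N / real m = 1 / sqrt (real m) * N"
      using m by (simp add: field_simps)
    also have "\<dots> \<le> \<delta> * N" using \<delta> N by (intro mult_right_mono) auto
    finally have "(\<Sum>i\<in>?I. cmod (a i) ^ 4) / (real m + 1) \<le> \<delta> * N" .
    moreover have "(1 - \<delta>) * N \<le> (\<Sum>i\<in>?I. (cmod (a i))\<^sup>2)"
      using sq by (simp add: N_def algebra_simps)
    ultimately show ?thesis by linarith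
  qed
  also have "\<dots> = (\<Sum>i\<in>?I. (cmod (a i))\<^sup>2 - ((cmod (a i))\<^sup>2)\<^sup>2 / (real m + 1))"
    by (simp add: sum_subtractf sum_divide_distrib)
  also have "\<dots> \<le> \<Sigma>"
    unfolding \<Sigma> by (intro sum_mono powr_ge_minus_square m) simp
  finally have lo: "(1 - 2 * \<delta>) * N \<le> \<Sigma>" .
  \<comment> \<open>Origin of sqrt n: h = 1/2 + 1 / (2 m), and N^(1 / (2 m)) = sqrt n.\<close>
  have Nh: "N powr h = sqrt N * sqrt (real n)"
  proof -
    have n0: "real n > 0" using n by simp
    have "N powr h = real n powr (real m * h)"
      using n0 by (simp add: N_def powr_powr flip: powr_realpow)
    also have "real m * h = real m / 2 + 1 / 2" using m by (simp add: h_def field_simps)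
    also have "real n powr (real m / 2 + 1 / 2) = (real n powr real m) powr (1 / 2) * real n powr (1 / 2)"
      by (simp only: powr_add powr_powr) simp
    also have "\<dots> = sqrt N * sqrt (real n)"
      using n0 by (simp add: N_def powr_half_sqrt powr_realpow)
    finally show ?thesis .
  qed
  have S: "bh_sum m n a = \<Sigma> powr h" by (simp add: bh_sum_def \<Sigma>_def h(1))
  have "(1 - 2 * \<delta>) * N powr h \<le> (1 - 2 * \<delta>) powr h * N powr h"
  proof (rule mult_right_mono)
    have "(1 - 2 * \<delta>) powr 1 \<le> (1 - 2 * \<delta>) powr h"
      using \<delta> h by (intro powr_mono') auto
    then show "1 - 2 * \<delta> \<le> (1 - 2 * \<delta>) powr h" using \<delta> by simp
  qed simp
  also have "\<dots> = ((1 - 2 * \<delta>) * N) powr h" using \<delta> N by (simp add: powr_mult)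
  also have "\<dots> \<le> \<Sigma> powr h" using lo \<delta> N h by (intro powr_mono2) auto
  finally show "(1 - 2 * \<delta>) * (sqrt (real n ^ m) * sqrt (real n)) \<le> bh_sum m n a"
    unfolding S Nh unfolding N_def .
  have "\<Sigma> powr h \<le> ((1 + \<delta>) * N) powr h"
    using up h by (intro powr_mono2) (auto simp: \<Sigma>_def sum_nonneg)
  also have "\<dots> = (1 + \<delta>) powr h * N powr h" using \<delta> N by (simp add: powr_mult)
  also have "\<dots> \<le> (1 + \<delta>) * N powr h"
  proof (rule mult_right_mono)
    have "(1 + \<delta>) powr h \<le> (1 + \<delta>) powr 1" using \<delta> h by (intro powr_mono) auto
    then show "(1 + \<delta>) powr h \<le> 1 + \<delta>" using \<delta> by simp
  qed simp
  finally show "bh_sum m n a \<le> (1 + \<delta>) * (sqrt (real n ^ m) * sqrt (real n))"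
    unfolding S Nh unfolding N_def .
qed

text \<open>For delta <= 1/4 both (1 + delta) / (1 - delta) <= 1 + 4 delta and (1 - 2 delta) / (1 +
  delta) >= 1 - 4 delta hold.\<close>

lemma ratio_ML_close:
  assumes n: "n \<ge> 2" and m: "m \<ge> 2" and \<delta>: "0 < \<delta>" "\<delta> \<le> 1 / 4"
    and num: "(1 - 2 * \<delta>) * (sqrt (real n ^ m) * sqrt (real n)) \<le> bh_sum m n a"
      "bh_sum m n a \<le> (1 + \<delta>) * (sqrt (real n ^ m) * sqrt (real n))"
    and den: "(1 - \<delta>) * typical_norm m n < form_norm m n a" "form_norm m n a \<le> (1 + \<delta>) * typical_norm m n"
  shows "\<bar>sqrt (real m * ln (real m)) * ratio_ML m n a - sqrt (2 * real n / (real n - 1))\<bar>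
    \<le> 4 * \<delta> * sqrt (2 * real n / (real n - 1))"
proof -
  define c where "c = sqrt (2 * real n / (real n - 1))"
  define \<Lambda> where "\<Lambda> = sqrt (real m * ln (real m))"
  define B where "B = typical_norm m n"
  define Q where "Q = sqrt (real n ^ m) * sqrt (real n)"
  have \<nu>: "real n - 1 > 0" using n by simp
  have "ln (real m) > 0" using m by simp
  then have \<Lambda>: "\<Lambda> > 0" using m by (simp add: \<Lambda>_def)
  have Q: "Q > 0" using n by (simp add: Q_def)
  have cpos: "c > 0" using \<nu> n by (simp add: c_def)
  \<comment> \<open>The identity that produces the limit constant: typical norm and typical
    numerator differ exactly by c / sqrt (m log m).\<close>
  have BQ: "c * B = \<Lambda> * Q"
  proof -
    have "c * B = sqrt (2 * real n / (real n - 1) * (real n ^ m * ((real n - 1) / 2 * (real m * ln (real m)))))"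
      unfolding c_def B_def typical_norm_def by (simp only: real_sqrt_mult)
    also have "2 * real n / (real n - 1) * (real n ^ m * ((real n - 1) / 2 * (real m * ln (real m))))
        = (real m * ln (real m)) * (real n ^ m * real n)"
      using \<nu> by (simp add: field_simps)
    finally show ?thesis by (simp only: \<Lambda>_def Q_def real_sqrt_mult)
  qed
  have Bpos: "B > 0" using BQ cpos \<Lambda> Q by (metis mult_pos_pos zero_less_mult_pos)
  define F where "F = form_norm m n a"
  have F: "(1 - \<delta>) * B < F" "F \<le> (1 + \<delta>) * B" using den by (simp_all add: F_def B_def)
  have "0 < (1 - \<delta>) * B" using \<delta> Bpos by simp
  then have Fpos: "F > 0" using F by linarith
  have X: "\<Lambda> * ratio_ML m n a = \<Lambda> * bh_sum m n a / F"
    by (simp add: ratio_ML_def bh_sum_def F_def)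
  have "\<Lambda> * bh_sum m n a \<le> \<Lambda> * ((1 + \<delta>) * Q)"
    using num(2) \<Lambda> by (intro mult_left_mono) (auto simp: Q_def)
  also have "\<dots> = (1 + \<delta>) * c * B" using BQ by (simp add: mult_ac)
  also have "\<dots> \<le> (1 + 4 * \<delta>) * (1 - \<delta>) * c * B"
  proof (intro mult_right_mono)
    have "\<delta> * \<delta> \<le> \<delta> * (1 / 4)" using \<delta> by (intro mult_left_mono) auto
    then show "1 + \<delta> \<le> (1 + 4 * \<delta>) * (1 - \<delta>)" using \<delta> by (simp add: algebra_simps)
  qed (use cpos Bpos in auto)
  also have "\<dots> = (1 + 4 * \<delta>) * c * ((1 - \<delta>) * B)" by (simp add: mult_ac)
  also have "\<dots> \<le> (1 + 4 * \<delta>) * c * F" using F \<delta> cpos by (intro mult_left_mono) auto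
  finally have up: "\<Lambda> * ratio_ML m n a \<le> (1 + 4 * \<delta>) * c"
    unfolding X using Fpos by (simp add: pos_divide_le_eq)
  have "(1 - 4 * \<delta>) * c * F \<le> (1 - 4 * \<delta>) * c * ((1 + \<delta>) * B)"
    using F \<delta> cpos by (intro mult_left_mono) auto
  also have "\<dots> = ((1 - 4 * \<delta>) * (1 + \<delta>)) * (c * B)" by (simp add: mult_ac)
  also have "\<dots> \<le> (1 - 2 * \<delta>) * (c * B)"
    using cpos Bpos \<delta> by (intro mult_right_mono) (auto simp: algebra_simps)
  also have "\<dots> = \<Lambda> * ((1 - 2 * \<delta>) * Q)" using BQ by (simp add: mult_ac)
  also have "\<dots> \<le> \<Lambda> * bh_sum m n a"
    using num(1) \<Lambda> by (intro mult_left_mono) (auto simp: Q_def)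
  finally have lo: "(1 - 4 * \<delta>) * c \<le> \<Lambda> * ratio_ML m n a"
    unfolding X using Fpos by (simp add: pos_le_divide_eq)
  show ?thesis
    using up lo unfolding c_def[symmetric] \<Lambda>_def[symmetric] by (simp add: abs_le_iff algebra_simps)
qed

section \<open>Transfer to the sphere and conclusion\<close>

lemma ratio_ML_measurable_PiM:
  assumes "n \<ge> 1"
  shows "ratio_ML m n \<in> borel_measurable (\<Pi>\<^sub>M i\<in>multi_indices m n. borel)"
proof -
  have [measurable]: "form_norm m n \<in> borel_measurable (\<Pi>\<^sub>M i\<in>multi_indices m n. borel)"
    using assms by (intro measurable_form_norm) simp
  show ?thesis unfolding ratio_ML_def[abs_def] by measurable
qed

text \<open>The ratio does not change under scaling, so the exceptional set is a cone and the sphere may be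
  replaced by a Gaussian vector.\<close>

lemma tensor_sphere_measure_ratio_le:
  assumes n: "n \<ge> 1" and m: "m \<ge> 1"
  shows "measure (tensor_sphere_measure m n)
      {a \<in> space (tensor_sphere_measure m n). \<bar>c * ratio_ML m n a - d\<bar> > \<epsilon>}
    \<le> measure (gauss_vec (multi_indices m n))
      {a \<in> space (gauss_vec (multi_indices m n)). \<bar>c * ratio_ML m n a - d\<bar> > \<epsilon>}"
proof -
  let ?I = "multi_indices m n"
  let ?E = "{a \<in> space (gauss_vec ?I). \<bar>c * ratio_ML m n a - d\<bar> > \<epsilon>}"
  have [measurable]: "ratio_ML m n \<in> borel_measurable (\<Pi>\<^sub>M i\<in>?I. borel)"
    by (rule ratio_ML_measurable_PiM[OF n])
  have "{a \<in> space (\<Pi>\<^sub>M i\<in>?I. (borel :: complex measure)). \<bar>c * ratio_ML m n a - d\<bar> > \<epsilon>} \<in> sets (\<Pi>\<^sub>M i\<in>?I. borel)"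
    by measurable
  then have E: "?E \<in> sets (\<Pi>\<^sub>M i\<in>?I. borel)" by (simp add: space_gauss_vec space_PiM)
  have "measure (sphere_measure ?I) (?E \<inter> unit_sphere ?I) \<le> measure (gauss_vec ?I) ?E"
  proof (rule sphere_measure_cone_le[OF multi_indices_finite _ E])
    fix r :: real and a assume "r > 0" "a \<in> ?E"
    then show "scale_vec ?I r a \<in> ?E"
      using ratio_ML_scale_vec[OF n _ m] by (auto simp: space_gauss_vec scale_vec_def)
  qed (use multi_indices_nonempty n in simp)
  moreover have "?E \<inter> unit_sphere ?I = {a \<in> space (tensor_sphere_measure m n). \<bar>c * ratio_ML m n a - d\<bar> > \<epsilon>}"
    by (auto simp: tensor_sphere_measure_def space_sphere_measure space_gauss_vec unit_sphere_def)
  ultimately show ?thesis by (simp add: tensor_sphere_measure_def)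
qed

theorem theoremF:
  fixes n :: nat and \<epsilon> :: real
  assumes "n \<ge> 2" and "\<epsilon> > 0"
  shows "(\<lambda>m. measure (tensor_sphere_measure m n)
            {a \<in> space (tensor_sphere_measure m n).
               \<bar>sqrt (real m * ln (real m)) * ratio_ML m n a
                  - sqrt (2 * real n / (real n - 1))\<bar> > \<epsilon>}) \<longlonglongrightarrow> 0"
proof -
  define c where "c = sqrt (2 * real n / (real n - 1))"
  have c: "c > 0" using assms(1) by (simp add: c_def)
  define \<delta> where "\<delta> = min (1 / 4) (\<epsilon> / (4 * c))"
  have \<delta>: "0 < \<delta>" "\<delta> \<le> 1 / 4" "\<delta> \<le> \<epsilon> / (4 * c)" using assms(2) c by (auto simp: \<delta>_def)
  have \<delta>c: "4 * \<delta> * c \<le> \<epsilon>" using \<delta>(3) c by (simp add: field_simps)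
  have n1: "n \<ge> 1" using assms(1) by simp
  define G where "G m = gauss_vec (multi_indices m n)" for m
  define bad1 where "bad1 m = {a \<in> space (G m). (1 + \<delta>) * typical_norm m n < form_norm m n a}" for m
  define bad2 where "bad2 m = {a \<in> space (G m). form_norm m n a \<le> (1 - \<delta>) * typical_norm m n}" for m
  define bad3 where "bad3 m = {a \<in> space (G m).
    \<delta> * card (multi_indices m n) \<le> \<bar>(\<Sum>i\<in>multi_indices m n. (cmod (a i))\<^sup>2) - card (multi_indices m n)\<bar>}" for m
  \<comment> \<open>The level sqrt m grows, so that the probability 3 / sqrt m vanishes, but more
    slowly than m, so that the error in the numerator vanishes too.\<close>
  define bad4 where "bad4 m = {a \<in> space (G m).
    sqrt (real m) * card (multi_indices m n) \<le> (\<Sum>i\<in>multi_indices m n. cmod (a i) ^ 4)}" for m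
  define bound where "bound m = measure (G m) (bad1 m) + measure (G m) (bad2 m) + 3 / (\<delta>\<^sup>2 * real n ^ m) + 3 / sqrt (real m)" for m
  have main: "measure (tensor_sphere_measure m n) {a \<in> space (tensor_sphere_measure m n).
      \<bar>sqrt (real m * ln (real m)) * ratio_ML m n a - c\<bar> > \<epsilon>} \<le> bound m"
    if m: "m \<ge> 2" and m\<delta>: "1 / sqrt (real m) \<le> \<delta>" for m
  proof -
    interpret G: prob_space "G m" unfolding G_def by (rule prob_space_gauss_vec)
    have m1: "m \<ge> 1" using m by simp
    let ?I = "multi_indices m n"
    have I: "finite ?I" "?I \<noteq> {}" using n1 by (simp_all add: multi_indices_finite multi_indices_nonempty)
    have cardI: "real (card ?I) = real n ^ m" by (simp add: card_multi_indices)
    have [measurable]: "form_norm m n \<in> borel_measurable (G m)" unfolding G_def by (rule form_norm_measurable[OF n1])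
    have [measurable_cong]: "sets (G m) = sets (\<Pi>\<^sub>M i\<in>?I. borel)" unfolding G_def by (rule sets_gauss_vec)
    have [measurable]: "bad1 m \<in> sets (G m)" "bad2 m \<in> sets (G m)" "bad3 m \<in> sets (G m)" "bad4 m \<in> sets (G m)"
      unfolding bad1_def bad2_def bad3_def bad4_def by measurable
    have sub: "{a \<in> space (G m). \<bar>sqrt (real m * ln (real m)) * ratio_ML m n a - c\<bar> > \<epsilon>}
        \<subseteq> bad1 m \<union> bad2 m \<union> bad3 m \<union> bad4 m"
    proof (rule subsetI, rule ccontr)
      fix a assume a: "a \<in> {a \<in> space (G m). \<bar>sqrt (real m * ln (real m)) * ratio_ML m n a - c\<bar> > \<epsilon>}"
        and nb: "a \<notin> bad1 m \<union> bad2 m \<union> bad3 m \<union> bad4 m"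
      have sq: "\<bar>(\<Sum>i\<in>?I. (cmod (a i))\<^sup>2) - real n ^ m\<bar> \<le> \<delta> * real n ^ m"
        and four: "(\<Sum>i\<in>?I. cmod (a i) ^ 4) \<le> sqrt (real m) * real n ^ m"
        using a nb by (auto simp: bad3_def bad4_def cardI)
      have den: "(1 - \<delta>) * typical_norm m n < form_norm m n a" "form_norm m n a \<le> (1 + \<delta>) * typical_norm m n"
        using a nb by (auto simp: bad1_def bad2_def)
      have "\<delta> < 1 / 2" using \<delta> by simp
      note num = bh_sum_bounds[OF n1 m1 \<delta>(1) this m\<delta> sq four]
      have "\<bar>sqrt (real m * ln (real m)) * ratio_ML m n a - c\<bar> \<le> 4 * \<delta> * c"
        unfolding c_def by (rule ratio_ML_close[OF assms(1) m \<delta>(1,2) num den])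
      with \<delta>c a show False by auto
    qed
    have "measure (tensor_sphere_measure m n) {a \<in> space (tensor_sphere_measure m n).
      \<bar>sqrt (real m * ln (real m)) * ratio_ML m n a - c\<bar> > \<epsilon>}
      \<le> measure (G m) {a \<in> space (G m). \<bar>sqrt (real m * ln (real m)) * ratio_ML m n a - c\<bar> > \<epsilon>}"
      unfolding G_def by (rule tensor_sphere_measure_ratio_le[OF n1 m1])
    also have "\<dots> \<le> measure (G m) (bad1 m \<union> bad2 m \<union> bad3 m \<union> bad4 m)"
      by (rule G.finite_measure_mono[OF sub]) measurable
    also have "\<dots> \<le> measure (G m) (bad1 m) + measure (G m) (bad2 m) + measure (G m) (bad3 m) + measure (G m) (bad4 m)"
      by (intro order_trans[OF measure_Un_le] add_right_mono order_refl) measurable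
    also have "measure (G m) (bad3 m) \<le> 3 / (\<delta>\<^sup>2 * card ?I)"
      unfolding bad3_def G_def by (rule sum_norm_sq_concentration[OF I \<delta>(1)])
    also have "measure (G m) (bad4 m) \<le> 3 / sqrt (real m)"
      unfolding bad4_def G_def using m by (intro sum_norm_4_tail I) simp
    finally show ?thesis by (simp add: bound_def cardI)
  qed
  have "(\<lambda>m. 3 / (\<delta>\<^sup>2 * real n ^ m)) \<longlonglongrightarrow> 0"
  proof -
    have "real n > 1" "\<delta>\<^sup>2 > 0" using assms(1) \<delta> by auto
    then show ?thesis by real_asymp
  qed
  moreover have "(\<lambda>m. 3 / sqrt (real m)) \<longlonglongrightarrow> 0" by real_asymp
  moreover have "(\<lambda>m. measure (G m) (bad1 m)) \<longlonglongrightarrow> 0"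
    unfolding G_def bad1_def using \<delta> by (intro form_norm_upper_limit assms(1)) auto
  moreover have "(\<lambda>m. measure (G m) (bad2 m)) \<longlonglongrightarrow> 0"
    unfolding G_def bad2_def using \<delta> by (intro form_norm_lower_limit assms(1)) auto
  ultimately have "bound \<longlonglongrightarrow> 0 + 0 + 0 + 0"
    unfolding bound_def by (intro tendsto_add)
  then have lim: "bound \<longlonglongrightarrow> 0" by simp
  have "(\<lambda>m. 1 / sqrt (real m)) \<longlonglongrightarrow> 0" by real_asymp
  then have "eventually (\<lambda>m. 1 / sqrt (real m) < \<delta>) sequentially"
    by (rule order_tendstoD) (rule \<delta>(1))
  then have "eventually (\<lambda>m. 0 \<le> measure (tensor_sphere_measure m n) {a \<in> space (tensor_sphere_measure m n).
      \<bar>sqrt (real m * ln (real m)) * ratio_ML m n a - c\<bar> > \<epsilon>} \<and> measure (tensor_sphere_measure m n) {a \<in> space (tensor_sphere_measure m n).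
      \<bar>sqrt (real m * ln (real m)) * ratio_ML m n a - c\<bar> > \<epsilon>} \<le> bound m) sequentially"
    using eventually_ge_at_top[of 2] by eventually_elim (use main in \<open>auto intro: less_imp_le\<close>)
  then show ?thesis
    unfolding c_def[symmetric] by (rule tendsto_0_squeeze[OF _ lim])
qed

end
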